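(* Let $\{X_n\}$ be a $\phi$-irreducible Markov chain on $(\mathcal{X},\mathcal{F})$ with transition kernel $P$, stationary probability distribution $\pi(\cdot)$ and period $D \ge 1$. Let $G$ be the set of $x\in\mathcal{X}$ such that $\lim_{n\to\infty}\|(1/D)\sum_{r=1}^{D}P^{nD+r}(x,\cdot)-\pi(\cdot)\|=0$. Then the following are equivalent: (i) The chain is Harris recurrent. (ii) For all $A\in\mathcal{F}$ with $\pi(A)>0$ and all $x\in\mathcal{X}$, $\mathbf{P}(X_n\in A \text{ for infinitely many } n \mid X_0=x)=1$. (iii) For all $x\in\mathcal{X}$, $\lim_{n\to\infty}\|(1/D)\sum_{r=1}^{D}P^{nD+r}(x,\cdot)-\pi(\cdot)\|=0$. (iv) For all $x\in\mathcal{X}$, $\mathbf{P}[\tau_G<\infty\mid X_0=x]=1$. (v) For all $x\in\mathcal{X}$ and all $A\in\mathcal{F}$ with $\pi(A)=1$, $\mathbf{P}[\tau_A<\infty\mid X_0=x]=1$. (vi) For all $x\in\mathcal{X}$ and all $A\in\mathcal{F}$ with $\pi(A)=0$, $\mathbf{P}[X_n\in A \text{ for all } n\mid X_0=x]=0$.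
   Context: $\{X_n\}$ is a (time-homogeneous) Markov chain with transition probabilities $P(x,\cdot)$ on a state space $\mathcal{X}$ with $\sigma$-algebra $\mathcal{F}$; $P^n$ is the $n$-step kernel. For $A\in\mathcal{F}$, $\tau_A=\inf\{n\ge 1: X_n\in A\}$, with $\tau_A=\infty$ if the chain never returns to $A$. $\|\cdot\|$ is total variation distance. The chain is $\phi$-irreducible if there is a nonzero $\sigma$-finite measure $\psi$ on $(\mathcal{X},\mathcal{F})$ such that $\mathbf{P}[\tau_A<\infty\mid X_0=x]>0$ for all $x\in\mathcal{X}$ and all $A\in\mathcal{F}$ with $\psi(A)>0$. A probability distribution $\pi$ is stationary if $\int_{\mathcal{X}}\pi(dx)P(x,A)=\pi(A)$ for all $A\in\mathcal{F}$. The period of a $\phi$-irreducible chain with stationary distribution $\pi$ is the largest $D\in\{1,2,\dots\}$ for which there exist disjoint $\mathcal{X}_1,\dots,\mathcal{X}_D\in\mathcal{F}$ with $\pi(\mathcal{X}_i)>0$ such that $P(x,\mathcal{X}_{i+1})=1$ for all $x\in\mathcal{X}_i$ ($1\le i\le D-1$) and $P(x,\mathcal{X}_1)=1$ for all $x\in\mathcal{X}_D$. A $\phi$-irreducible chain with stationary distribution $\pi$ is Harris recurrent if for all $A\in\mathcal{F}$ with $\pi(A)>0$ and all $x\in\mathcal{X}$, $\mathbf{P}(\tau_A<\infty\mid X_0=x)=1$. *)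

theory Defs
  imports "HOL-Probability.Probability"
begin

text \<open>
  A measurable space \<open>S\<close> carries the state space (\<open>space S\<close>) and its \<open>\<sigma>\<close>-algebra (\<open>sets S\<close>);
  a transition kernel is a map \<open>K \<in> S \<rightarrow>\<^sub>M prob_algebra S\<close>, with \<open>P(x, A) = measure (K x) A\<close>.
\<close>

primrec nstep :: "'a measure \<Rightarrow> ('a \<Rightarrow> 'a measure) \<Rightarrow> nat \<Rightarrow> 'a \<Rightarrow> 'a measure" where
  "nstep S K 0 x = return S x"
| "nstep S K (Suc n) x = K x \<bind> nstep S K n"

definition chain_kernel ::
    "'a measure \<Rightarrow> ('a \<Rightarrow> 'a measure) \<Rightarrow> 'a \<Rightarrow> nat \<Rightarrow> (nat \<Rightarrow> 'a) \<Rightarrow> 'a measure" where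
  "chain_kernel S K x i \<omega> = (case i of 0 \<Rightarrow> return S x | Suc n \<Rightarrow> K (\<omega> n))"

text \<open>
  The law of the trajectory \<open>X\<^sub>0, X\<^sub>1, \<dots>\<close> of the chain started at \<open>x\<close>, as a measure on the infinite
  product space, obtained from the Ionescu-Tulcea theorem. Conditional probabilities given
  \<open>X\<^sub>0 = x\<close> are probabilities under this measure, with \<open>X\<^sub>n(\<omega>) = \<omega> n\<close>. The lemmas
  \<open>chain_law_initial\<close> and \<open>chain_law_step\<close> determine it.
\<close>

definition chain_law :: "'a measure \<Rightarrow> ('a \<Rightarrow> 'a measure) \<Rightarrow> 'a \<Rightarrow> (nat \<Rightarrow> 'a) measure" where
  "chain_law S K x =
     projective_family.lim UNIV (Ionescu_Tulcea.CI (chain_kernel S K x) (\<lambda>_. S)) (\<lambda>_. S)"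

lemma Ionescu_Tulcea_chain_kernel:
  assumes K: "K \<in> S \<rightarrow>\<^sub>M prob_algebra S" and x: "x \<in> space S"
  shows "Ionescu_Tulcea (chain_kernel S K x) (\<lambda>_. S)"
proof (rule Ionescu_Tulcea.intro)
  note [measurable] = measurable_prob_algebraD[OF K]
  show "chain_kernel S K x i \<in> PiM {0..<i} (\<lambda>_. S) \<rightarrow>\<^sub>M subprob_algebra S" for i
  proof (cases i)
    case 0
    have "return S x \<in> space (subprob_algebra S)"
      using x by (simp add: measurable_space[OF return_measurable])
    then show ?thesis
      using 0 by (simp add: chain_kernel_def[abs_def])
  next
    case (Suc n)
    then show ?thesis
      unfolding chain_kernel_def[abs_def] by simp
  qed
  show "prob_space (chain_kernel S K x i \<omega>)"
    if \<omega>: "\<omega> \<in> space (PiM {0..<i} (\<lambda>_. S))" for i \<omega>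
  proof (cases i)
    case 0
    then show ?thesis
      using x by (simp add: chain_kernel_def prob_space_return)
  next
    case (Suc n)
    then have "\<omega> n \<in> space S"
      using \<omega> by (auto simp: space_PiM PiE_iff)
    then show ?thesis
      using Suc measurable_space[OF K] by (auto simp: chain_kernel_def space_prob_algebra)
  qed
qed

lemma sets_chain_law:
  assumes "K \<in> S \<rightarrow>\<^sub>M prob_algebra S" and "x \<in> space S"
  shows "sets (chain_law S K x) = sets (PiM UNIV (\<lambda>_. S))"
proof -
  interpret Ionescu_Tulcea "chain_kernel S K x" "\<lambda>_. S"
    by (rule Ionescu_Tulcea_chain_kernel[OF assms])
  show ?thesis
    by (simp add: chain_law_def)
qed

lemma distr_chain_law:
  assumes K: "K \<in> S \<rightarrow>\<^sub>M prob_algebra S" and x: "x \<in> space S"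
  shows "distr (chain_law S K x) (PiM {0..<n} (\<lambda>_. S)) (\<lambda>\<omega>. restrict \<omega> {0..<n})
    = Ionescu_Tulcea.C (chain_kernel S K x) (\<lambda>_. S) 0 n (\<lambda>_. undefined)"
proof -
  interpret Ionescu_Tulcea "chain_kernel S K x" "\<lambda>_. S"
    by (rule Ionescu_Tulcea_chain_kernel[OF K x])
  have sets_C0: "sets (C 0 n (\<lambda>_. undefined)) = sets (PiM {0..<n} (\<lambda>_. S))"
    using sets_C[of "\<lambda>_. undefined" 0 n] by (simp add: space_PiM)
  show ?thesis
  proof (rule measure_eqI)
    fix A assume "A \<in> sets (distr (chain_law S K x) (PiM {0..<n} (\<lambda>_. S)) (\<lambda>\<omega>. restrict \<omega> {0..<n}))"
    then have A: "A \<in> sets (PiM {0..<n} (\<lambda>_. S))"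
      by simp
    then have id: "PF.emb {0..<n} {0..<n} A = A"
      using sets.sets_into_space[OF A] by (intro prod_emb_id) (simp add: space_PiM)
    have "emeasure (distr (chain_law S K x) (PiM {0..<n} (\<lambda>_. S)) (\<lambda>\<omega>. restrict \<omega> {0..<n})) A
        = emeasure PF.lim (PF.emb UNIV {0..<n} A)"
      unfolding chain_law_def using A
      by (intro emeasure_distr_restrict) auto
    also have "\<dots> = emeasure (CI {0..<n}) A"
      using A by (intro lim) auto
    also have "\<dots> = emeasure (C 0 n (\<lambda>_. undefined)) A"
      using A by (simp add: emeasure_CI[of _ n] id)
    finally show "emeasure (distr (chain_law S K x) (PiM {0..<n} (\<lambda>_. S)) (\<lambda>\<omega>. restrict \<omega> {0..<n})) A
      = emeasure (C 0 n (\<lambda>_. undefined)) A" .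
  qed (simp add: sets_C0)
qed

lemma prob_space_chain_law:
  assumes K: "K \<in> S \<rightarrow>\<^sub>M prob_algebra S" and x: "x \<in> space S"
  shows "prob_space (chain_law S K x)"
proof -
  interpret Ionescu_Tulcea "chain_kernel S K x" "\<lambda>_. S"
    by (rule Ionescu_Tulcea_chain_kernel[OF K x])
  have "prob_space (distr (chain_law S K x) (PiM {0..<0} (\<lambda>_. S)) (\<lambda>\<omega>. restrict \<omega> {0..<0}))"
    unfolding distr_chain_law[OF K x] by (rule prob_space_C) (simp add: space_PiM)
  then show ?thesis
    by (rule prob_space_distrD[rotated])
       (simp add: measurable_cong_sets[OF sets_chain_law[OF K x] refl])
qed

lemma chain_law_initial:
  assumes K: "K \<in> S \<rightarrow>\<^sub>M prob_algebra S" and x: "x \<in> space S" and B: "B \<in> sets S"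
  shows "emeasure (chain_law S K x) {\<omega> \<in> space (chain_law S K x). \<omega> 0 \<in> B} = indicator B x"
proof -
  interpret Ionescu_Tulcea "chain_kernel S K x" "\<lambda>_. S"
    by (rule Ionescu_Tulcea_chain_kernel[OF K x])
  note [measurable_cong] = sets_chain_law[OF K x]
  note [measurable] = B
  let ?A = "{\<omega> \<in> space (PiM {0..<1::nat} (\<lambda>_. S)). \<omega> 0 \<in> B}"
  have u: "(\<lambda>_. undefined) \<in> space (PiM {0..<0::nat} (\<lambda>_. S))"
    by (simp add: space_PiM)
  have A: "?A \<in> sets (PiM {0..<1::nat} (\<lambda>_. S))"
    by measurable
  have "emeasure (chain_law S K x) {\<omega> \<in> space (chain_law S K x). \<omega> 0 \<in> B}
      = emeasure (distr (chain_law S K x) (PiM {0..<1::nat} (\<lambda>_. S)) (\<lambda>\<omega>. restrict \<omega> {0..<1::nat})) ?A"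
    using A by (subst emeasure_distr)
      (auto intro!: arg_cong[where f="emeasure _"] simp: space_PiM PiE_iff
        sets_eq_imp_space_eq[OF sets_chain_law[OF K x]])
  also have "\<dots> = emeasure (eP 0 (\<lambda>_. undefined)) ?A"
    unfolding distr_chain_law[OF K x] using bind_return[OF measurable_eP[of 0] u] by simp
  also have "\<dots> = emeasure (return S x) (fun_upd (\<lambda>_. undefined) 0 -` ?A \<inter> space S)"
    using A by (subst emeasure_eP) (auto simp: u chain_kernel_def)
  also have "fun_upd (\<lambda>_. undefined) 0 -` ?A \<inter> space S = B"
    using sets.sets_into_space[OF B] by (auto simp: space_PiM PiE_iff extensional_def)
  finally show ?thesis
    using B by simp
qed

lemma chain_law_step:
  assumes K: "K \<in> S \<rightarrow>\<^sub>M prob_algebra S" and x: "x \<in> space S"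
    and A: "A \<in> sets (PiM {0..<Suc n} (\<lambda>_. S))" and B: "B \<in> sets S"
  shows "emeasure (chain_law S K x)
      {\<omega> \<in> space (chain_law S K x). restrict \<omega> {0..<Suc n} \<in> A \<and> \<omega> (Suc n) \<in> B}
    = (\<integral>\<^sup>+\<omega>. indicator A (restrict \<omega> {0..<Suc n}) * emeasure (K (\<omega> n)) B \<partial>chain_law S K x)"
proof -
  interpret Ionescu_Tulcea "chain_kernel S K x" "\<lambda>_. S"
    by (rule Ionescu_Tulcea_chain_kernel[OF K x])
  note [measurable_cong] = sets_chain_law[OF K x]
  note [measurable] = A B measurable_prob_algebraD[OF K]
  let ?m = "Suc n"
  let ?C = "C 0 ?m (\<lambda>_. undefined)"
  let ?A = "{\<omega> \<in> space (PiM {0..<Suc ?m} (\<lambda>_. S)). restrict \<omega> {0..<?m} \<in> A \<and> \<omega> ?m \<in> B}"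
  have u: "(\<lambda>_. undefined) \<in> space (PiM {0..<0::nat} (\<lambda>_. S))"
    by (simp add: space_PiM)
  have [measurable]: "(\<lambda>\<omega>. restrict \<omega> {0..<?m}) \<in> PiM {0..<Suc ?m} (\<lambda>_. S) \<rightarrow>\<^sub>M PiM {0..<?m} (\<lambda>_. S)"
    by (rule measurable_restrict_subset) auto
  have A': "?A \<in> sets (PiM {0..<Suc ?m} (\<lambda>_. S))"
    by measurable
  have sp: "space ?C = space (PiM {0..<?m} (\<lambda>_. S))"
    using space_C[OF u, of ?m] by simp
  have "emeasure (chain_law S K x)
      {\<omega> \<in> space (chain_law S K x). restrict \<omega> {0..<Suc n} \<in> A \<and> \<omega> (Suc n) \<in> B}
      = emeasure (distr (chain_law S K x) (PiM {0..<Suc ?m} (\<lambda>_. S)) (\<lambda>\<omega>. restrict \<omega> {0..<Suc ?m})) ?A"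
    using A' by (subst emeasure_distr)
      (auto intro!: arg_cong[where f="emeasure _"] simp: space_PiM PiE_iff Int_absorb1
        sets_eq_imp_space_eq[OF sets_chain_law[OF K x]] restrict_restrict)
  also have "\<dots> = emeasure (?C \<bind> eP ?m) ?A"
    unfolding distr_chain_law[OF K x] by simp
  also have "\<dots> = (\<integral>\<^sup>+\<omega>. emeasure (eP ?m \<omega>) ?A \<partial>?C)"
  proof (rule emeasure_bind[OF _ _ A'])
    show "space ?C \<noteq> {}"
      unfolding sp by (simp add: space_PiM_empty_iff)
    show "eP ?m \<in> ?C \<rightarrow>\<^sub>M subprob_algebra (PiM {0..<Suc ?m} (\<lambda>_. S))"
      using measurable_eP[of ?m] sets_C[OF u, of ?m]
      by (simp add: measurable_cong_sets[of ?C "PiM {0..<?m} (\<lambda>_. S)"] del: C.simps)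
  qed
  also have "\<dots> = (\<integral>\<^sup>+\<omega>. indicator A \<omega> * emeasure (K (\<omega> n)) B \<partial>?C)"
  proof (rule nn_integral_cong)
    fix \<omega> assume "\<omega> \<in> space ?C"
    then have \<omega>: "\<omega> \<in> space (PiM {0..<?m} (\<lambda>_. S))"
      by (simp only: sp)
    have eq: "fun_upd \<omega> ?m -` ?A \<inter> space S = (if \<omega> \<in> A then B else {})"
    proof -
      have "restrict (fun_upd \<omega> ?m y) {0..<?m} = \<omega>" for y
        using \<omega> by (auto simp: space_PiM PiE_iff extensional_def restrict_def fun_eq_iff)
      moreover have "fun_upd \<omega> ?m y \<in> space (PiM {0..<Suc ?m} (\<lambda>_. S))" if "y \<in> space S" for y
        using \<omega> that by (auto simp: space_PiM PiE_iff extensional_def)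
      ultimately show ?thesis
        using sets.sets_into_space[OF B] by (auto simp del: fun_upd_apply) (auto simp: fun_upd_same)
    qed
    show "emeasure (eP ?m \<omega>) ?A = indicator A \<omega> * emeasure (K (\<omega> n)) B"
      unfolding emeasure_eP[OF \<omega> A'] eq by (simp add: chain_kernel_def)
  qed
  also have "\<dots> = (\<integral>\<^sup>+\<omega>. indicator A (restrict \<omega> {0..<?m}) * emeasure (K (restrict \<omega> {0..<?m} n)) B
      \<partial>chain_law S K x)"
    unfolding distr_chain_law[OF K x, symmetric] by (rule nn_integral_distr) measurable
  finally show ?thesis
    by simp
qed

text \<open>\<open>\<tau>\<^sub>A\<close>; the infimum of the empty set is \<open>\<infinity>\<close>.\<close>

definition return_time :: "'a set \<Rightarrow> (nat \<Rightarrow> 'a) \<Rightarrow> enat" where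
  "return_time A \<omega> = Inf (enat ` {n. 1 \<le> n \<and> \<omega> n \<in> A})"

definition phi_irreducible :: "'a measure \<Rightarrow> ('a \<Rightarrow> 'a measure) \<Rightarrow> bool" where
  "phi_irreducible S K \<longleftrightarrow>
    (\<exists>\<psi>. sets \<psi> = sets S \<and> sigma_finite_measure \<psi> \<and> emeasure \<psi> (space S) \<noteq> 0 \<and>
      (\<forall>x\<in>space S. \<forall>A\<in>sets S. emeasure \<psi> A > 0 \<longrightarrow>
        \<P>(\<omega> in chain_law S K x. return_time A \<omega> < \<infinity>) > 0))"

definition stationary :: "'a measure \<Rightarrow> ('a \<Rightarrow> 'a measure) \<Rightarrow> 'a measure \<Rightarrow> bool" where
  "stationary S K \<pi> \<longleftrightarrow>
    prob_space \<pi> \<and> sets \<pi> = sets S \<and>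
    (\<forall>A\<in>sets S. (\<integral>\<^sup>+x. emeasure (K x) A \<partial>\<pi>) = emeasure \<pi> A)"

definition cyclic_decomposition ::
    "'a measure \<Rightarrow> ('a \<Rightarrow> 'a measure) \<Rightarrow> 'a measure \<Rightarrow> nat \<Rightarrow> (nat \<Rightarrow> 'a set) \<Rightarrow> bool" where
  "cyclic_decomposition S K \<pi> D X \<longleftrightarrow>
    disjoint_family_on X {1..D} \<and>
    (\<forall>i\<in>{1..D}. X i \<in> sets S \<and> measure \<pi> (X i) > 0) \<and>
    (\<forall>i\<in>{1..<D}. \<forall>x\<in>X i. measure (K x) (X (Suc i)) = 1) \<and>
    (\<forall>x\<in>X D. measure (K x) (X 1) = 1)"

definition is_period :: "'a measure \<Rightarrow> ('a \<Rightarrow> 'a measure) \<Rightarrow> 'a measure \<Rightarrow> nat \<Rightarrow> bool" where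
  "is_period S K \<pi> D \<longleftrightarrow>
    1 \<le> D \<and> (\<exists>X. cyclic_decomposition S K \<pi> D X) \<and>
    (\<forall>D'\<ge>1. (\<exists>X. cyclic_decomposition S K \<pi> D' X) \<longrightarrow> D' \<le> D)"

definition harris_recurrent :: "'a measure \<Rightarrow> ('a \<Rightarrow> 'a measure) \<Rightarrow> 'a measure \<Rightarrow> bool" where
  "harris_recurrent S K \<pi> \<longleftrightarrow>
    (\<forall>A\<in>sets S. measure \<pi> A > 0 \<longrightarrow>
      (\<forall>x\<in>space S. \<P>(\<omega> in chain_law S K x. return_time A \<omega> < \<infinity>) = 1))"

text \<open>Total variation distance \<open>\<parallel>\<mu> - \<nu>\<parallel> = sup\<^sub>A \<bar>\<mu>(A) - \<nu>(A)\<bar>\<close>, for real-valued set functions.\<close>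

definition tv_dist :: "'a measure \<Rightarrow> ('a set \<Rightarrow> real) \<Rightarrow> ('a set \<Rightarrow> real) \<Rightarrow> real" where
  "tv_dist S \<mu> \<nu> = (SUP A\<in>sets S. \<bar>\<mu> A - \<nu> A\<bar>)"

definition cycle_average ::
    "'a measure \<Rightarrow> ('a \<Rightarrow> 'a measure) \<Rightarrow> nat \<Rightarrow> nat \<Rightarrow> 'a \<Rightarrow> 'a set \<Rightarrow> real" where
  "cycle_average S K D n x A =
    (1 / real D) * (\<Sum>r=1..D. measure (nstep S K (n * D + r) x) A)"

text \<open>
  The set \<open>G\<close> of starting points from which the averaged chain converges. The \<open>\<sigma>\<close>-algebra is not
  assumed to be countably generated, so \<open>G\<close> is not measurable a priori. As \<^const>\<open>measure\<close> is \<open>0\<close>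
  on non-measurable sets, an equation \<open>\<P>(\<omega> in M. return_time G \<omega> < \<infinity>) = 1\<close> includes the
  measurability of the event.
\<close>

definition convergence_set ::
    "'a measure \<Rightarrow> ('a \<Rightarrow> 'a measure) \<Rightarrow> 'a measure \<Rightarrow> nat \<Rightarrow> 'a set" where
  "convergence_set S K \<pi> D =
    {x \<in> space S. (\<lambda>n. tv_dist S (cycle_average S K D n x) (measure \<pi>)) \<longlonglongrightarrow> 0}"

end

(*
  The implication from Harris recurrence to convergence is proved without small sets, so that no
  countability assumption on the sigma-algebra is needed. Write P for the transition operator on
  bounded functions, with all norms taken in L1(pi).

  The singular part of pi(dx) P^n(x,dy) with respect to pi x pi loses its mass as n grows, because
  its mass function has a P-invariant limit that irreducibility forces to vanish. Hence P^n is close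
  to an integral operator with an L1 kernel, and the images of the unit ball of bounded functions
  under P^n become totally bounded. Every orbit P^k f therefore has a limit point w in L1, and
  w is recurrent under P. As the integral of (P^k w)^2 is nonincreasing in k, it is constant, so the
  conditional variances vanish: w(X_{n+1}) is a function of X_n. Irreducibility gives the
  trajectory (P^k w(X_n))_k an atom, and the atoms visited from there form a cyclic decomposition,
  whose length divides the period D. So averaging P w, ..., P^D w gives a constant, and total
  boundedness makes the convergence of the averages uniform over the unit ball. Finally, from
  an arbitrary starting point the chain is absorbed almost surely into a set that avoids the
  singular parts of all P^n(x,.).

  The remaining implications rest on the subharmonic function x -> P_x(X_i in B for all i >= 1),
  called trapped below, which vanishes pi-almost everywhere as soon as pi(B) < 1.
*)

theory Submission
  imports Defs "HOL-Library.Diagonal_Subsequence"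
begin

section \<open>Iterated kernels and path probabilities\<close>

text \<open>When the sigma-algebra is not countably generated, the densities of the separate
  measures P^n(x,.) need not fit together to a function measurable in both variables. So the
  splitting into a regular and a singular part is done once, on the product space, for the law of
  (X_0, X_n) under the stationary chain, and what it says about P^n(x,.) holds only for
  \<open>\<pi>\<close>-almost every x. The way back from one good starting point to almost every
  point is always irreducibility: a set of positive \<open>\<pi>\<close>-measure is charged by some
  P^n(x,.).

  Convergence in L1 for each function separately would not suffice. In the total variation distance
  the supremum over the sets A stands outside the integral of the error, and it cannot be moved
  inside, since an uncountable supremum of measurable errors need not be measurable. Hence the bound
  has to be uniform over the unit ball. A finite net together with the contraction property of P in
  L1 reduces this to finitely many orbits.\<close>

lemma return_time_finite_iff: "return_time A \<omega> < \<infinity> \<longleftrightarrow> (\<exists>n\<ge>1. \<omega> n \<in> A)"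
proof
  assume "return_time A \<omega> < \<infinity>"
  moreover have "return_time A \<omega> = \<infinity>" if "{n. 1 \<le> n \<and> \<omega> n \<in> A} = {}"
    unfolding return_time_def that by (simp add: top_enat_def)
  ultimately show "\<exists>n\<ge>1. \<omega> n \<in> A" by fastforce
next
  assume "\<exists>n\<ge>1. \<omega> n \<in> A"
  then obtain n where "n \<ge> 1" "\<omega> n \<in> A" by auto
  then have "return_time A \<omega> \<le> enat n"
    unfolding return_time_def by (intro Inf_lower) auto
  then show "return_time A \<omega> < \<infinity>" by (rule le_less_trans) simp
qed

locale markov_kernel =
  fixes S :: "'a measure" and K :: "'a \<Rightarrow> 'a measure"
  assumes kernel: "K \<in> S \<rightarrow>\<^sub>M prob_algebra S"
begin

abbreviation law :: "'a \<Rightarrow> (nat \<Rightarrow> 'a) measure" where "law \<equiv> chain_law S K"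
abbreviation nst :: "nat \<Rightarrow> 'a \<Rightarrow> 'a measure" where "nst \<equiv> nstep S K"

lemma kernel_subprob[measurable]: "K \<in> S \<rightarrow>\<^sub>M subprob_algebra S"
  by (rule measurable_prob_algebraD[OF kernel])

lemma nstep_measurable_prob: "nst n \<in> S \<rightarrow>\<^sub>M prob_algebra S"
proof (induction n)
  case 0
  have "nst 0 = return S" by auto
  then show ?case by (simp add: measurable_return_prob_space)
next
  case (Suc n)
  have "nst (Suc n) = (\<lambda>x. K x \<bind> nst n)" by auto
  then show ?case
    using measurable_bind_prob_space[OF kernel Suc] by simp
qed

lemma nstep_measurable[measurable]: "nst n \<in> S \<rightarrow>\<^sub>M subprob_algebra S"
  by (rule measurable_prob_algebraD[OF nstep_measurable_prob])

lemma prob_space_nstep: "x \<in> space S \<Longrightarrow> prob_space (nst n x)"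
  using measurable_space[OF nstep_measurable_prob, of x n] by (simp add: space_prob_algebra)

lemma sets_nstep: "x \<in> space S \<Longrightarrow> sets (nst n x) = sets S"
  using measurable_space[OF nstep_measurable_prob, of x n] by (simp add: space_prob_algebra)

lemma space_nstep: "x \<in> space S \<Longrightarrow> space (nst n x) = space S"
  by (rule sets_eq_imp_space_eq[OF sets_nstep])

lemma prob_space_kernel: "x \<in> space S \<Longrightarrow> prob_space (K x)"
  using measurable_space[OF kernel, of x] by (simp add: space_prob_algebra)

lemma sets_kernel: "x \<in> space S \<Longrightarrow> sets (K x) = sets S"
  using measurable_space[OF kernel, of x] by (simp add: space_prob_algebra)

lemma space_kernel: "x \<in> space S \<Longrightarrow> space (K x) = space S"
  by (rule sets_eq_imp_space_eq[OF sets_kernel])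

lemma nstep_add:
  assumes x: "x \<in> space S"
  shows "nst (m + n) x = nst m x \<bind> nst n"
  using x
proof (induction m arbitrary: x)
  case 0
  then show ?case by (simp add: bind_return[OF nstep_measurable])
next
  case (Suc m)
  have "nst (Suc m + n) x = K x \<bind> (\<lambda>y. nst m y \<bind> nst n)"
    unfolding add_Suc nstep.simps
    by (rule bind_cong) (auto simp: Suc space_kernel)
  also have "\<dots> = (K x \<bind> nst m) \<bind> nst n"
    by (rule bind_assoc[symmetric, where N=S and R=S])
       (simp_all add: measurable_cong_sets[OF sets_kernel[OF Suc.prems] refl])
  finally show ?case by simp
qed

lemma nstep_one: "x \<in> space S \<Longrightarrow> nst (Suc 0) x = K x"
proof -
  assume x: "x \<in> space S"
  have "nst (Suc 0) x = K x \<bind> return S"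
    by (simp add: nstep.simps(1)[abs_def])
  also have "\<dots> = K x" by (rule bind_return''[OF sets_kernel[OF x]])
  finally show ?thesis .
qed

text \<open>\<open>nstep\<close> peels off the first step, while the trajectory law is built by
  adding a last coordinate; this form connects the two.\<close>

lemma nstep_Suc_right: "x \<in> space S \<Longrightarrow> nst (Suc n) x = nst n x \<bind> K"
  using nstep_add[of x n 1] nstep_one
  by (auto simp: space_nstep intro!: bind_cong)

lemma nn_integral_nstep_add:
  assumes x: "x \<in> space S" and f[measurable]: "f \<in> borel_measurable S"
  shows "(\<integral>\<^sup>+y. f y \<partial>nst (m + n) x) = (\<integral>\<^sup>+y. (\<integral>\<^sup>+z. f z \<partial>nst n y) \<partial>nst m x)"
  unfolding nstep_add[OF x]
  by (rule nn_integral_bind[where B=S]) (auto simp: measurable_cong_sets[OF sets_nstep[OF x] refl])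

section \<open>Taboo probabilities\<close>

text \<open>
  The chance, starting from \<open>x\<close>, that \<open>X\<^sub>1, \<dots>, X\<^sub>n\<close> (respectively all \<open>X\<^sub>i\<close> with
  \<open>i \<ge> 1\<close>) lie in \<open>B\<close>; the starting point itself is not constrained.
\<close>

definition stay :: "'a set \<Rightarrow> nat \<Rightarrow> 'a \<Rightarrow> ennreal" where
  "stay B n = ((\<lambda>f x. \<integral>\<^sup>+y. indicator B y * f y \<partial>K x) ^^ n) (\<lambda>_. 1)"

definition trapped :: "'a set \<Rightarrow> 'a \<Rightarrow> ennreal" where
  "trapped B x = (INF n. stay B n x)"

lemma stay_simps: "stay B 0 x = 1" "stay B (Suc n) x = (\<integral>\<^sup>+y. indicator B y * stay B n y \<partial>K x)"
  by (auto simp: stay_def)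

lemma taboo_funpow_measurable:
  assumes [measurable]: "B \<in> sets S" "f \<in> borel_measurable S"
  shows "((\<lambda>f x. \<integral>\<^sup>+y. indicator B y * f y \<partial>K x) ^^ n) f \<in> borel_measurable S"
proof (induction n)
  case (Suc n)
  note [measurable] = Suc
  show ?case by simp
qed simp

lemma stay_measurable[measurable]: "B \<in> sets S \<Longrightarrow> stay B n \<in> borel_measurable S"
  unfolding stay_def by (intro taboo_funpow_measurable) auto

lemma trapped_measurable[measurable]: "B \<in> sets S \<Longrightarrow> trapped B \<in> borel_measurable S"
  unfolding trapped_def[abs_def] by measurable

lemma stay_le_1: "x \<in> space S \<Longrightarrow> stay B n x \<le> 1"
proof (induction n arbitrary: x)
  case (Suc n)
  interpret prob_space "K x" by (rule prob_space_kernel) fact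
  have "stay B (Suc n) x \<le> (\<integral>\<^sup>+y. 1 \<partial>K x)"
    unfolding stay_simps using Suc by (intro nn_integral_mono) (auto simp: space_kernel indicator_def)
  then show ?case by (simp add: emeasure_space_1)
qed (simp add: stay_simps)

lemma decseq_stay: "x \<in> space S \<Longrightarrow> stay B (Suc n) x \<le> stay B n x"
proof (induction n arbitrary: x)
  case 0 then show ?case using stay_le_1 by (simp add: stay_simps(1))
next
  case (Suc n)
  show ?case
    unfolding stay_simps(2)[of B "Suc n" x] stay_simps(2)[of B n x]
    using Suc by (intro nn_integral_mono mult_left_mono) (auto simp: space_kernel)
qed

lemma trapped_le_1: "x \<in> space S \<Longrightarrow> trapped B x \<le> 1"
  unfolding trapped_def by (rule INF_lower2[of 0]) (auto simp: stay_simps)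

text \<open>Downward monotone convergence, started from \<open>stay B 0 = 1\<close>. The second set
  \<open>C\<close> serves two uses: \<open>C = B\<close> yields the fixed-point equation of
  \<open>trapped\<close>, a general \<open>C\<close> the event that the chain is in \<open>C\<close>
  at a given time.\<close>

lemma nn_integral_INF_stay:
  assumes [measurable]: "B \<in> sets S" "C \<in> sets S" and M: "prob_space M" "sets M = sets S"
  shows "(\<integral>\<^sup>+y. indicator C y * trapped B y \<partial>M) = (INF n. \<integral>\<^sup>+y. indicator C y * stay B n y \<partial>M)"
proof -
  interpret prob_space M by fact
  note [measurable_cong] = M(2)
  have sp: "space M = space S" by (rule sets_eq_imp_space_eq[OF M(2)])
  have eq: "indicator C y * trapped B y = (INF n. indicator C y * stay B n y)" for y
    by (auto simp: trapped_def indicator_def)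
  have "(\<integral>\<^sup>+y. indicator C y * stay B 0 y \<partial>M) \<le> (\<integral>\<^sup>+y. 1 \<partial>M)"
    by (intro nn_integral_mono) (auto simp: stay_simps indicator_def)
  then have fin: "(\<integral>\<^sup>+y. indicator C y * stay B 0 y \<partial>M) < \<infinity>"
    by (rule le_less_trans) (simp add: emeasure_space_1)
  show ?thesis unfolding eq
  proof (rule nn_integral_monotone_convergence_INF_AE[where i=0])
    show "(\<integral>\<^sup>+y. indicator C y * stay B 0 y \<partial>M) < \<infinity>" by (rule fin)
    show "AE x in M. indicator C x * stay B (Suc i) x \<le> indicator C x * stay B i x" for i
      using decseq_stay by (intro AE_I2 mult_left_mono) (auto simp: sp)
  qed measurable
qed

text \<open>Conditioning on the first step: shifting the index of the decreasing sequence
  \<open>stay B n x\<close> does not change its infimum, so the limit inherits the recursion of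
  \<open>stay\<close>.\<close>

lemma trapped_eq:
  assumes B: "B \<in> sets S" and x: "x \<in> space S"
  shows "trapped B x = (\<integral>\<^sup>+y. indicator B y * trapped B y \<partial>K x)"
proof -
  have "trapped B x = (INF n. stay B (Suc n) x)"
  proof (rule antisym)
    show "trapped B x \<le> (INF n. stay B (Suc n) x)"
      unfolding trapped_def by (rule INF_greatest) (rule INF_lower, simp)
    show "(INF n. stay B (Suc n) x) \<le> trapped B x"
      unfolding trapped_def
      by (intro INF_mono) (use decseq_stay[OF x] in auto)
  qed
  then show ?thesis
    unfolding nn_integral_INF_stay[OF B B prob_space_kernel[OF x] sets_kernel[OF x]] by (simp add: stay_simps)
qed

text \<open>Dropping the indicator in \<open>trapped_eq\<close> gives the inequality for one step,
  which is then iterated.\<close>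

lemma trapped_le_nstep:
  assumes B[measurable]: "B \<in> sets S" and x: "x \<in> space S"
  shows "trapped B x \<le> (\<integral>\<^sup>+y. trapped B y \<partial>nst n x)"
  using x
proof (induction n arbitrary: x)
  case 0
  then show ?case by (simp add: nn_integral_return)
next
  case (Suc n)
  have "trapped B x = (\<integral>\<^sup>+y. indicator B y * trapped B y \<partial>K x)"
    using trapped_eq[OF B Suc.prems] .
  also have "\<dots> \<le> (\<integral>\<^sup>+y. trapped B y \<partial>K x)"
    by (intro nn_integral_mono) (auto simp: indicator_def)
  also have "\<dots> \<le> (\<integral>\<^sup>+y. (\<integral>\<^sup>+z. trapped B z \<partial>nst n y) \<partial>K x)"
    using Suc by (intro nn_integral_mono) (auto simp: space_kernel)
  also have "\<dots> = (\<integral>\<^sup>+z. trapped B z \<partial>nst (Suc n) x)"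
    using nn_integral_nstep_add[of x "trapped B" 1 n] Suc.prems by (simp add: nstep_one del: nstep.simps)
  finally show ?case .
qed

section \<open>The law of the trajectory\<close>

lemma prob_space_law: "x \<in> space S \<Longrightarrow> prob_space (law x)"
  by (rule prob_space_chain_law[OF kernel])

lemma sets_law: "x \<in> space S \<Longrightarrow> sets (law x) = sets (PiM UNIV (\<lambda>_. S))"
  by (rule sets_chain_law[OF kernel])

lemma space_law: "x \<in> space S \<Longrightarrow> space (law x) = space (PiM UNIV (\<lambda>_. S))"
  by (rule sets_eq_imp_space_eq[OF sets_law])

lemma path_in_space: "x \<in> space S \<Longrightarrow> \<omega> \<in> space (law x) \<Longrightarrow> \<omega> n \<in> space S"
  by (auto simp: space_law space_PiM)

text \<open>The Markov property for functions instead of sets. Weighting the trajectory law by the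
  event of the past turns both sides into integrals of \<open>f\<close> against measures on
  \<open>S\<close>, so it is enough to compare these measures on sets, which is
  \<open>chain_law_step\<close>.\<close>

lemma nn_integral_chain_law_step:
  assumes x: "x \<in> space S" and A[measurable]: "A \<in> sets (PiM {0..<Suc n} (\<lambda>_. S))"
    and f[measurable]: "f \<in> borel_measurable S"
  shows "(\<integral>\<^sup>+\<omega>. indicator A (restrict \<omega> {0..<Suc n}) * f (\<omega> (Suc n)) \<partial>law x)
    = (\<integral>\<^sup>+\<omega>. indicator A (restrict \<omega> {0..<Suc n}) * (\<integral>\<^sup>+z. f z \<partial>K (\<omega> n)) \<partial>law x)"
proof -
  note [measurable_cong] = sets_law[OF x]
  define \<mu> where "\<mu> = density (law x) (\<lambda>\<omega>. indicator A (restrict \<omega> {0..<Suc n}))"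
  have sets_\<mu>[measurable_cong]: "sets \<mu> = sets (PiM UNIV (\<lambda>_. S))"
    by (simp add: \<mu>_def sets_law[OF x])
  have int: "(\<integral>\<^sup>+\<omega>. g \<omega> \<partial>\<mu>) = (\<integral>\<^sup>+\<omega>. indicator A (restrict \<omega> {0..<Suc n}) * g \<omega> \<partial>law x)"
    if [measurable]: "g \<in> borel_measurable (PiM UNIV (\<lambda>_. S))" for g
    unfolding \<mu>_def by (rule nn_integral_density) measurable
  have sp: "space (distr \<mu> S (\<lambda>\<omega>. \<omega> n)) \<noteq> {}" using x by auto
  have "distr \<mu> S (\<lambda>\<omega>. \<omega> (Suc n)) = distr \<mu> S (\<lambda>\<omega>. \<omega> n) \<bind> K"
  proof (rule measure_eqI)
    show "sets (distr \<mu> S (\<lambda>\<omega>. \<omega> (Suc n))) = sets (distr \<mu> S (\<lambda>\<omega>. \<omega> n) \<bind> K)"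
      by (subst sets_bind[OF _ sp, of _ S]) (auto simp: sets_kernel)
    fix B assume "B \<in> sets (distr \<mu> S (\<lambda>\<omega>. \<omega> (Suc n)))"
    then have B[measurable]: "B \<in> sets S" by simp
    have "emeasure (distr \<mu> S (\<lambda>\<omega>. \<omega> (Suc n))) B = (\<integral>\<^sup>+z. indicator B z \<partial>distr \<mu> S (\<lambda>\<omega>. \<omega> (Suc n)))"
      by simp
    also have "\<dots> = (\<integral>\<^sup>+\<omega>. indicator B (\<omega> (Suc n)) \<partial>\<mu>)"
      by (rule nn_integral_distr) measurable
    also have "\<dots> = (\<integral>\<^sup>+\<omega>. indicator A (restrict \<omega> {0..<Suc n}) * indicator B (\<omega> (Suc n)) \<partial>law x)"
      by (rule int) measurable
    also have "\<dots> = (\<integral>\<^sup>+\<omega>. indicator {\<omega> \<in> space (law x). restrict \<omega> {0..<Suc n} \<in> A \<and> \<omega> (Suc n) \<in> B} \<omega> \<partial>law x)"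
      by (intro nn_integral_cong) (auto simp: indicator_def)
    also have "\<dots> = emeasure (law x) {\<omega> \<in> space (law x). restrict \<omega> {0..<Suc n} \<in> A \<and> \<omega> (Suc n) \<in> B}"
      by (rule nn_integral_indicator) measurable
    also have "\<dots> = (\<integral>\<^sup>+\<omega>. emeasure (K (\<omega> n)) B \<partial>\<mu>)"
      unfolding chain_law_step[OF kernel x A B] by (rule int[symmetric]) measurable
    also have "\<dots> = (\<integral>\<^sup>+y. emeasure (K y) B \<partial>distr \<mu> S (\<lambda>\<omega>. \<omega> n))"
      by (rule nn_integral_distr[symmetric]) measurable
    also have "\<dots> = emeasure (distr \<mu> S (\<lambda>\<omega>. \<omega> n) \<bind> K) B"
      by (rule emeasure_bind[OF sp _ B, symmetric]) measurable
    finally show "emeasure (distr \<mu> S (\<lambda>\<omega>. \<omega> (Suc n))) B = emeasure (distr \<mu> S (\<lambda>\<omega>. \<omega> n) \<bind> K) B" .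
  qed
  then have "(\<integral>\<^sup>+z. f z \<partial>distr \<mu> S (\<lambda>\<omega>. \<omega> (Suc n))) = (\<integral>\<^sup>+y. (\<integral>\<^sup>+z. f z \<partial>K y) \<partial>distr \<mu> S (\<lambda>\<omega>. \<omega> n))"
    by (simp only:) (rule nn_integral_bind[OF f], measurable)
  then show ?thesis
    by (subst (asm) (1 2) nn_integral_distr) (simp_all add: int)
qed

lemma distr_law_nth:
  assumes x: "x \<in> space S"
  shows "distr (law x) S (\<lambda>\<omega>. \<omega> n) = nst n x"
proof (induction n)
  case 0
  show ?case
  proof (rule measure_eqI)
    fix A assume "A \<in> sets (distr (law x) S (\<lambda>\<omega>. \<omega> 0))"
    then have A: "A \<in> sets S" by simp
    have "{\<omega> \<in> space (law x). \<omega> 0 \<in> A} = (\<lambda>\<omega>. \<omega> 0) -` A \<inter> space (law x)" by auto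
    then show "emeasure (distr (law x) S (\<lambda>\<omega>. \<omega> 0)) A = emeasure (nst 0 x) A"
      using chain_law_initial[OF kernel x A] A
      by (simp add: emeasure_distr measurable_cong_sets[OF sets_law[OF x] refl])
  qed simp
next
  case (Suc n)
  note [measurable_cong] = sets_law[OF x]
  show ?case
  proof (rule measure_eqI)
    fix A assume "A \<in> sets (distr (law x) S (\<lambda>\<omega>. \<omega> (Suc n)))"
    then have A[measurable]: "A \<in> sets S" by simp
    have "emeasure (distr (law x) S (\<lambda>\<omega>. \<omega> (Suc n))) A = (\<integral>\<^sup>+z. indicator A z \<partial>distr (law x) S (\<lambda>\<omega>. \<omega> (Suc n)))"
      by simp
    also have "\<dots> = (\<integral>\<^sup>+\<omega>. indicator A (\<omega> (Suc n)) \<partial>law x)"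
      by (rule nn_integral_distr) measurable
    \<comment> \<open>The Markov step asks for an event of the past; the whole space of initial
      segments imposes no condition.\<close>
    also have "\<dots> = (\<integral>\<^sup>+\<omega>. indicator (space (PiM {0..<Suc n} (\<lambda>_. S))) (restrict \<omega> {0..<Suc n}) * indicator A (\<omega> (Suc n)) \<partial>law x)"
      using path_in_space[OF x] by (intro nn_integral_cong) (auto simp: space_PiM)
    also have "\<dots> = (\<integral>\<^sup>+\<omega>. indicator (space (PiM {0..<Suc n} (\<lambda>_. S))) (restrict \<omega> {0..<Suc n}) * (\<integral>\<^sup>+z. indicator A z \<partial>K (\<omega> n)) \<partial>law x)"
      by (rule nn_integral_chain_law_step[OF x]) auto
    also have "\<dots> = (\<integral>\<^sup>+\<omega>. (\<integral>\<^sup>+z. indicator A z \<partial>K (\<omega> n)) \<partial>law x)"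
      using path_in_space[OF x] by (intro nn_integral_cong) (auto simp: space_PiM)
    also have "\<dots> = (\<integral>\<^sup>+y. (\<integral>\<^sup>+z. indicator A z \<partial>K y) \<partial>nst n x)"
      unfolding Suc[symmetric] by (rule nn_integral_distr[symmetric]) measurable
    also have "\<dots> = (\<integral>\<^sup>+y. emeasure (K y) A \<partial>nst n x)"
      by (rule nn_integral_cong) (simp add: space_nstep[OF x] sets_kernel)
    also have "\<dots> = emeasure (nst (Suc n) x) A"
      unfolding nstep_Suc_right[OF x]
      by (rule emeasure_bind[symmetric, where N=S])
         (use x sets_nstep[OF x] in \<open>auto simp: measurable_cong_sets[OF sets_nstep[OF x] refl] space_nstep\<close>)
    finally show "emeasure (distr (law x) S (\<lambda>\<omega>. \<omega> (Suc n))) A = emeasure (nst (Suc n) x) A" .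
  qed (simp add: sets_nstep[OF x] del: nstep.simps)
qed

lemma emeasure_law_nth:
  assumes x: "x \<in> space S" and A: "A \<in> sets S"
  shows "emeasure (law x) {\<omega> \<in> space (law x). \<omega> n \<in> A} = emeasure (nst n x) A"
proof -
  note [measurable_cong] = sets_law[OF x]
  have "{\<omega> \<in> space (law x). \<omega> n \<in> A} = (\<lambda>\<omega>. \<omega> n) -` A \<inter> space (law x)" by auto
  then show ?thesis
    unfolding distr_law_nth[OF x, symmetric] using A by (subst emeasure_distr) auto
qed

text \<open>Induction on \<open>n\<close> with \<open>f\<close> arbitrary: the Markov property at
  time \<open>m + n\<close> absorbs the last step into a new terminal function, so the operator is
  applied from the inside.\<close>

lemma nn_integral_law_stay:
  assumes x: "x \<in> space S" and [measurable]: "B \<in> sets S" "C \<in> sets S" "f \<in> borel_measurable S"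
  shows "(\<integral>\<^sup>+\<omega>. indicator {\<omega>. \<omega> m \<in> C \<and> (\<forall>i\<in>{m<..m+n}. \<omega> i \<in> B)} \<omega> * f (\<omega> (m + n)) \<partial>law x)
    = (\<integral>\<^sup>+y. indicator C y * ((\<lambda>f x. \<integral>\<^sup>+y. indicator B y * f y \<partial>K x) ^^ n) f y \<partial>nst m x)"
  using assms(4)
proof (induction n arbitrary: f)
  case 0
  note [measurable_cong] = sets_law[OF x]
  note [measurable] = 0
  have "(\<integral>\<^sup>+\<omega>. indicator {\<omega>. \<omega> m \<in> C \<and> (\<forall>i\<in>{m<..m+0}. \<omega> i \<in> B)} \<omega> * f (\<omega> (m + 0)) \<partial>law x)
     = (\<integral>\<^sup>+\<omega>. indicator C (\<omega> m) * f (\<omega> m) \<partial>law x)"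
    by (intro nn_integral_cong) (auto simp: indicator_def)
  also have "\<dots> = (\<integral>\<^sup>+y. indicator C y * f y \<partial>nst m x)"
    unfolding distr_law_nth[OF x, symmetric] by (rule nn_integral_distr[symmetric]) measurable
  finally show ?case by simp
next
  case (Suc n)
  note [measurable] = Suc.prems
  let ?A = "{\<omega> \<in> space (PiM {0..<Suc (m+n)} (\<lambda>_. S)). \<omega> m \<in> C \<and> (\<forall>i\<in>{m<..m+n}. \<omega> i \<in> B)}"
  have A: "?A \<in> sets (PiM {0..<Suc (m+n)} (\<lambda>_. S))"
    by measurable
  have ind: "indicator ?A (restrict \<omega> {0..<Suc (m+n)})
      = (indicator {\<omega>. \<omega> m \<in> C \<and> (\<forall>i\<in>{m<..m+n}. \<omega> i \<in> B)} \<omega> :: ennreal)"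
    if "\<omega> \<in> space (law x)" for \<omega>
    using path_in_space[OF x that] by (auto simp: indicator_def space_PiM)
  have "(\<integral>\<^sup>+\<omega>. indicator {\<omega>. \<omega> m \<in> C \<and> (\<forall>i\<in>{m<..m+Suc n}. \<omega> i \<in> B)} \<omega> * f (\<omega> (m + Suc n)) \<partial>law x)
    = (\<integral>\<^sup>+\<omega>. indicator ?A (restrict \<omega> {0..<Suc (m+n)}) * (indicator B (\<omega> (Suc (m+n))) * f (\<omega> (Suc (m + n)))) \<partial>law x)"
  proof (intro nn_integral_cong)
    fix \<omega> assume "\<omega> \<in> space (law x)"
    note ind = ind[OF this]
    have "{m<..m + Suc n} = insert (Suc (m+n)) {m<..m+n}" by auto
    then show "indicator {\<omega>. \<omega> m \<in> C \<and> (\<forall>i\<in>{m<..m+Suc n}. \<omega> i \<in> B)} \<omega> * f (\<omega> (m + Suc n))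
      = indicator ?A (restrict \<omega> {0..<Suc (m+n)}) * (indicator B (\<omega> (Suc (m+n))) * f (\<omega> (Suc (m + n))))"
      unfolding ind by (auto simp: indicator_def)
  qed
  also have "\<dots> = (\<integral>\<^sup>+\<omega>. indicator ?A (restrict \<omega> {0..<Suc (m+n)}) * (\<integral>\<^sup>+z. indicator B z * f z \<partial>K (\<omega> (m+n))) \<partial>law x)"
    by (rule nn_integral_chain_law_step[OF x A, of "\<lambda>z. indicator B z * f z"]) measurable
  also have "\<dots> = (\<integral>\<^sup>+\<omega>. indicator {\<omega>. \<omega> m \<in> C \<and> (\<forall>i\<in>{m<..m+n}. \<omega> i \<in> B)} \<omega> * (\<integral>\<^sup>+z. indicator B z * f z \<partial>K (\<omega> (m+n))) \<partial>law x)"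
    by (intro nn_integral_cong) (simp only: ind)
  also have "\<dots> = (\<integral>\<^sup>+y. indicator C y * ((\<lambda>f x. \<integral>\<^sup>+y. indicator B y * f y \<partial>K x) ^^ n) (\<lambda>x. \<integral>\<^sup>+y. indicator B y * f y \<partial>K x) y \<partial>nst m x)"
    by (rule Suc.IH) measurable
  finally show ?case by (simp add: funpow_Suc_right del: funpow.simps)
qed

text \<open>Continuity from above along the events of remaining in \<open>B\<close> for
  \<open>n\<close> steps after time \<open>m\<close>.\<close>

lemma emeasure_law_trapped:
  assumes x: "x \<in> space S" and [measurable]: "B \<in> sets S" "C \<in> sets S"
  shows "emeasure (law x) {\<omega> \<in> space (law x). \<omega> m \<in> C \<and> (\<forall>i>m. \<omega> i \<in> B)}
    = (\<integral>\<^sup>+y. indicator C y * trapped B y \<partial>nst m x)"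
proof -
  interpret prob_space "law x" by (rule prob_space_law[OF x])
  note [measurable_cong] = sets_law[OF x]
  let ?E = "\<lambda>n. {\<omega> \<in> space (law x). \<omega> m \<in> C \<and> (\<forall>i\<in>{m<..m+n}. \<omega> i \<in> B)}"
  have "emeasure (law x) (?E n) = (\<integral>\<^sup>+y. indicator C y * stay B n y \<partial>nst m x)" for n
  proof -
    have "emeasure (law x) (?E n) = (\<integral>\<^sup>+\<omega>. indicator (?E n) \<omega> \<partial>law x)"
      by (rule nn_integral_indicator[symmetric]) measurable
    also have "\<dots> = (\<integral>\<^sup>+\<omega>. indicator {\<omega>. \<omega> m \<in> C \<and> (\<forall>i\<in>{m<..m+n}. \<omega> i \<in> B)} \<omega> * 1 \<partial>law x)"
      by (intro nn_integral_cong) (auto simp: indicator_def)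
    also have "\<dots> = (\<integral>\<^sup>+y. indicator C y * stay B n y \<partial>nst m x)"
      unfolding stay_def by (rule nn_integral_law_stay[OF x, where f="\<lambda>_. 1"]) auto
    finally show ?thesis .
  qed
  moreover have "(INF n. emeasure (law x) (?E n)) = emeasure (law x) (\<Inter>n. ?E n)"
    by (rule INF_emeasure_decseq) (auto simp: decseq_def)
  moreover have "(\<Inter>n. ?E n) = {\<omega> \<in> space (law x). \<omega> m \<in> C \<and> (\<forall>i>m. \<omega> i \<in> B)}"
  proof (intro set_eqI iffI)
    fix \<omega> assume \<omega>: "\<omega> \<in> (\<Inter>n. ?E n)"
    have "\<omega> i \<in> B" if "i > m" for i
    proof -
      have "\<omega> \<in> ?E i" using \<omega> by blast
      then show ?thesis using that by auto
    qed
    then show "\<omega> \<in> {\<omega> \<in> space (law x). \<omega> m \<in> C \<and> (\<forall>i>m. \<omega> i \<in> B)}" using \<omega> by auto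
  qed auto
  ultimately show ?thesis
    using nn_integral_INF_stay[OF assms(2,3) prob_space_nstep[OF x] sets_nstep[OF x]] by simp
qed

lemma emeasure_law_trapped_0:
  assumes x: "x \<in> space S" and B[measurable]: "B \<in> sets S"
  shows "emeasure (law x) {\<omega> \<in> space (law x). \<forall>i\<ge>1. \<omega> i \<in> B} = trapped B x"
proof -
  have "{\<omega> \<in> space (law x). \<forall>i\<ge>1. \<omega> i \<in> B} = {\<omega> \<in> space (law x). \<omega> 0 \<in> space S \<and> (\<forall>i>0. \<omega> i \<in> B)}"
    using path_in_space[OF x] by (auto simp: Suc_le_eq)
  then have "emeasure (law x) {\<omega> \<in> space (law x). \<forall>i\<ge>1. \<omega> i \<in> B} = (\<integral>\<^sup>+y. indicator (space S) y * trapped B y \<partial>nst 0 x)"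
    using emeasure_law_trapped[OF x B sets.top, of 0] by simp
  also have "\<dots> = trapped B x"
    using x by (simp add: nn_integral_return)
  finally show ?thesis .
qed

text \<open>Never returning to \<open>A\<close> means staying in the complement from time 1 on. With
  this equivalence, hitting conditions become statements about a single function on the state
  space.\<close>

lemma prob_return_eq_1_iff:
  assumes x: "x \<in> space S" and [measurable]: "A \<in> sets S"
  shows "\<P>(\<omega> in law x. return_time A \<omega> < \<infinity>) = 1 \<longleftrightarrow> trapped (space S - A) x = 0"
proof -
  interpret prob_space "law x" by (rule prob_space_law[OF x])
  note [measurable_cong] = sets_law[OF x]
  have "{\<omega> \<in> space (law x). \<forall>i\<ge>1. \<omega> i \<in> space S - A} = {\<omega> \<in> space (law x). \<not> return_time A \<omega> < \<infinity>}"
    using path_in_space[OF x] by (auto simp only: return_time_finite_iff) 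
  then have "emeasure (law x) {\<omega> \<in> space (law x). \<not> return_time A \<omega> < \<infinity>} = trapped (space S - A) x"
    using emeasure_law_trapped_0[OF x, of "space S - A"] by simp
  moreover have "\<P>(\<omega> in law x. \<not> return_time A \<omega> < \<infinity>) = 1 - \<P>(\<omega> in law x. return_time A \<omega> < \<infinity>)"
    unfolding return_time_finite_iff by (intro prob_neg) measurable
  ultimately show ?thesis
    by (auto simp: emeasure_eq_measure)
qed

text \<open>A countable union of events is null exactly if every event is, so irreducibility becomes
  a statement about the iterated kernels alone.\<close>

lemma prob_return_pos_iff:
  assumes x: "x \<in> space S" and A[measurable]: "A \<in> sets S"
  shows "\<P>(\<omega> in law x. return_time A \<omega> < \<infinity>) > 0 \<longleftrightarrow> (\<exists>n\<ge>1. emeasure (nst n x) A > 0)"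
proof -
  interpret prob_space "law x" by (rule prob_space_law[OF x])
  note [measurable_cong] = sets_law[OF x]
  have eq: "{\<omega> \<in> space (law x). return_time A \<omega> < \<infinity>} = (\<Union>n\<in>{1..}. {\<omega> \<in> space (law x). \<omega> n \<in> A})"
    by (auto simp only: return_time_finite_iff)
  have m: "{\<omega> \<in> space (law x). \<omega> n \<in> A} \<in> sets (law x)" for n by measurable
  have "\<not> \<P>(\<omega> in law x. return_time A \<omega> < \<infinity>) > 0 \<longleftrightarrow> emeasure (law x) {\<omega> \<in> space (law x). return_time A \<omega> < \<infinity>} = 0"
    by (simp only: emeasure_eq_measure not_less measure_le_0_iff ennreal_eq_0_iff)
  also have "\<dots> \<longleftrightarrow> {\<omega> \<in> space (law x). return_time A \<omega> < \<infinity>} \<in> null_sets (law x)"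
    unfolding eq null_sets_def using m by auto
  also have "\<dots> \<longleftrightarrow> (\<forall>n\<in>{1..}. {\<omega> \<in> space (law x). \<omega> n \<in> A} \<in> null_sets (law x))"
  proof
    assume n: "{\<omega> \<in> space (law x). return_time A \<omega> < \<infinity>} \<in> null_sets (law x)"
    show "\<forall>n\<in>{1..}. {\<omega> \<in> space (law x). \<omega> n \<in> A} \<in> null_sets (law x)"
      by (intro ballI null_sets_subset[OF n m]) (unfold eq, blast)
  next
    assume "\<forall>n\<in>{1..}. {\<omega> \<in> space (law x). \<omega> n \<in> A} \<in> null_sets (law x)"
    then show "{\<omega> \<in> space (law x). return_time A \<omega> < \<infinity>} \<in> null_sets (law x)"
      unfolding eq by (intro null_sets_UN') auto
  qed
  also have "\<dots> \<longleftrightarrow> (\<forall>n\<ge>1. emeasure (nst n x) A = 0)"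
    using m by (auto simp: null_sets_def emeasure_law_nth[OF x A])
  finally show ?thesis by (auto simp: zero_less_iff_neq_zero)
qed

end

section \<open>Irreducibility and recurrence with respect to the stationary distribution\<close>

lemma AE_mono_space:
  "AE x in M. P x \<Longrightarrow> (\<And>x. x \<in> space M \<Longrightarrow> P x \<Longrightarrow> Q x) \<Longrightarrow> AE x in M. Q x"
  by (rule AE_mp) auto

locale stationary_irreducible_chain = markov_kernel S K for S :: "'a measure" and K +
  fixes \<pi> :: "'a measure"
  assumes irreducible: "phi_irreducible S K" and stationary: "stationary S K \<pi>"
begin

sublocale pi: prob_space \<pi>
  using stationary by (simp add: stationary_def)

lemma sets_pi[measurable_cong]: "sets \<pi> = sets S"
  using stationary by (simp add: stationary_def)

lemma space_pi: "space \<pi> = space S"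
  by (rule sets_eq_imp_space_eq[OF sets_pi])

lemma space_S_not_empty: "space S \<noteq> {}"
  using pi.not_empty by (simp add: space_pi)

lemma pi_bind_kernel: "\<pi> \<bind> K = \<pi>"
proof (rule measure_eqI)
  have s: "sets (\<pi> \<bind> K) = sets S"
    by (rule sets_bind) (auto simp: space_pi sets_kernel space_S_not_empty)
  then show "sets (\<pi> \<bind> K) = sets \<pi>" by (simp add: sets_pi)
  fix A assume "A \<in> sets (\<pi> \<bind> K)"
  then have A: "A \<in> sets S" by (simp add: s)
  then have "emeasure (\<pi> \<bind> K) A = (\<integral>\<^sup>+x. emeasure (K x) A \<partial>\<pi>)"
    by (intro emeasure_bind[where N=S]) (auto simp: space_pi space_S_not_empty)
  then show "emeasure (\<pi> \<bind> K) A = emeasure \<pi> A"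
    using stationary A by (simp add: stationary_def)
qed

lemma pi_bind_nstep: "\<pi> \<bind> nst n = \<pi>"
proof (induction n)
  case 0
  have "nst 0 = return S" by auto
  then show ?case by (simp add: bind_return'' sets_pi)
next
  case (Suc n)
  have "nst (Suc n) = (\<lambda>x. K x \<bind> nst n)" by auto
  then have "\<pi> \<bind> nst (Suc n) = \<pi> \<bind> (\<lambda>x. K x \<bind> nst n)" by (simp only:)
  also have "\<dots> = (\<pi> \<bind> K) \<bind> nst n"
    by (rule bind_assoc[symmetric, where N=S and R=S]) measurable
  finally show ?case by (simp only: pi_bind_kernel Suc)
qed

lemma nn_integral_pi_nstep:
  assumes [measurable]: "f \<in> borel_measurable S"
  shows "(\<integral>\<^sup>+x. (\<integral>\<^sup>+y. f y \<partial>nst n x) \<partial>\<pi>) = (\<integral>\<^sup>+x. f x \<partial>\<pi>)"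
  using nn_integral_bind[of f S "nst n" \<pi>] by (simp add: pi_bind_nstep)

text \<open>By stationarity a \<open>\<pi>\<close>-null set is charged by P^n(x,.) only for x in a
  null set. Passing to a measurable null cover \<open>N\<close> allows a predicate \<open>P\<close>
  that is not measurable.\<close>

lemma AE_pi_nstep:
  assumes "AE x in \<pi>. P x"
  shows "AE x in \<pi>. AE y in nst n x. P y"
proof -
  obtain N where N: "{x \<in> space \<pi>. \<not> P x} \<subseteq> N" "emeasure \<pi> N = 0" "N \<in> sets S"
    using assms by (auto elim!: AE_E simp: sets_pi)
  note [measurable] = N(3)
  have "AE x in \<pi> \<bind> nst n. x \<notin> N"
    unfolding pi_bind_nstep by (rule AE_not_in) (use N in \<open>auto simp: null_sets_def sets_pi\<close>)
  then have "AE x in \<pi>. AE y in nst n x. y \<notin> N"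
    by (subst (asm) AE_bind[where B=S]) measurable
  then show ?thesis
  proof (rule AE_mono_space)
    fix x assume x: "x \<in> space \<pi>" and "AE y in nst n x. y \<notin> N"
    from this(2) show "AE y in nst n x. P y"
      by (rule AE_mono_space) (use N(1) x in \<open>auto simp: space_pi space_nstep\<close>)
  qed
qed

lemma AE_nstep_add:
  assumes x: "x \<in> space S" and [measurable]: "Measurable.pred S P"
  shows "(AE y in nst (m + n) x. P y) \<longleftrightarrow> (AE y in nst m x. AE z in nst n y. P z)"
  unfolding nstep_add[OF x]
  by (rule AE_bind[where B=S]) (auto simp: measurable_cong_sets[OF sets_nstep[OF x] refl])

lemma AE_nstep_not_in:
  assumes "x \<in> space S" "A \<in> sets S"
  shows "(AE y in nst n x. y \<notin> A) \<longleftrightarrow> emeasure (nst n x) A = 0"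
  using assms by (subst AE_iff_measurable[of A]) (auto simp: sets_nstep space_nstep dest: sets.sets_into_space)

lemma AE_nstep_1: "x \<in> space S \<Longrightarrow> (AE y in nst (Suc 0) x. P y) \<longleftrightarrow> (AE y in K x. P y)"
  by (simp only: nstep_one)

lemma AE_K_nstep:
  assumes x: "x \<in> space S" and P: "Measurable.pred S P"
  shows "(AE y in nst (Suc n) x. P y) \<longleftrightarrow> (AE y in K x. AE z in nst n y. P z)"
  using AE_nstep_add[OF x P, of "Suc 0" n] unfolding AE_nstep_1[OF x] by (simp only: add_Suc add_0)

text \<open>If \<open>A\<close> were out of reach of \<open>x\<close>, let \<open>V\<close> be the
  set of all points from which it is out of reach. \<open>V\<close> is absorbing and contains
  \<open>x\<close>, so \<open>x\<close> cannot reach the complement \<open>U\<close>; hence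
  \<open>\<psi>\<close> vanishes on \<open>U\<close>, charges \<open>V\<close>, and \<open>V\<close>
  is reachable from everywhere. Stationarity forbids a flow of mass from \<open>U\<close> into the
  absorbing set \<open>V\<close>, so \<open>\<pi>\<close> lives on \<open>V\<close>, and then
  \<open>\<pi>\<close> of \<open>A\<close>, the integral of one-step chances of entering
  \<open>A\<close>, is 0.\<close>

lemma pi_irreducible:
  assumes A[measurable]: "A \<in> sets S" and pos: "emeasure \<pi> A > 0" and x: "x \<in> space S"
  shows "\<exists>n\<ge>1. emeasure (nst n x) A > 0"
proof (rule ccontr)
  assume contra: "\<not> (\<exists>n\<ge>1. emeasure (nst n x) A > 0)"
  obtain \<psi> where \<psi>: "sets \<psi> = sets S" "emeasure \<psi> (space S) \<noteq> 0"
    and irr: "\<And>x A. x \<in> space S \<Longrightarrow> A \<in> sets S \<Longrightarrow> emeasure \<psi> A > 0 \<Longrightarrow> \<exists>n\<ge>1. emeasure (nst n x) A > 0"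
  proof -
    obtain \<psi> where \<psi>: "sets \<psi> = sets S" "emeasure \<psi> (space S) \<noteq> 0"
      and irr: "\<forall>x\<in>space S. \<forall>A\<in>sets S. emeasure \<psi> A > 0 \<longrightarrow> \<P>(\<omega> in law x. return_time A \<omega> < \<infinity>) > 0"
      using irreducible unfolding phi_irreducible_def by blast
    show thesis
    proof (rule that[OF \<psi>])
      fix x A assume "x \<in> space S" "A \<in> sets S" "emeasure \<psi> A > 0"
      then show "\<exists>n\<ge>1. emeasure (nst n x) A > 0"
        using irr prob_return_pos_iff[of x A] by blast
    qed
  qed
  define V where "V = {x \<in> space S. \<forall>n\<ge>1. emeasure (nst n x) A = 0}"
  have V[measurable]: "V \<in> sets S" unfolding V_def by measurable
  define U where "U = space S - V"
  have U[measurable]: "U \<in> sets S" unfolding U_def by measurable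
  have absorb: "AE z in nst m y. z \<in> V" if y: "y \<in> V" and m: "m \<ge> 1" for y m
  proof -
    have ys: "y \<in> space S" using y by (simp add: V_def)
    have "AE z in nst m y. emeasure (nst n z) A = 0" if n: "n \<ge> 1" for n
    proof -
      have "emeasure (nst (m + n) y) A = 0" using y m by (simp add: V_def)
      then have "AE z in nst (m + n) y. z \<notin> A" by (simp add: AE_nstep_not_in ys)
      then have "AE z in nst m y. AE w in nst n z. w \<notin> A" by (subst (asm) AE_nstep_add[OF ys]) auto
      then show ?thesis
        by (rule AE_mp) (auto intro!: AE_I2 simp: AE_nstep_not_in space_nstep[OF ys])
    qed
    then have "AE z in nst m y. \<forall>n\<in>{1..}. emeasure (nst n z) A = 0"
      by (subst AE_ball_countable) auto
    then show ?thesis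
      by (rule AE_mp) (auto intro!: AE_I2 simp: V_def space_nstep[OF ys])
  qed
  have xV: "x \<in> V" using contra x by (auto simp: V_def zero_less_iff_neq_zero)
  have "emeasure (nst m x) U = 0" if "m \<ge> 1" for m
    using absorb[OF xV that] x
    by (subst AE_nstep_not_in[symmetric]) (auto simp: U_def elim!: AE_mp)
  then have "emeasure \<psi> U = 0"
    using irr[OF x U] by (auto simp: zero_less_iff_neq_zero)
  have "emeasure \<psi> V > 0"
  proof (rule ccontr)
    assume "\<not> ?thesis"
    then have "emeasure \<psi> (U \<union> V) \<le> 0 + 0"
      using \<open>emeasure \<psi> U = 0\<close> emeasure_subadditive[of U \<psi> V] by (simp add: \<psi>(1))
    moreover have "U \<union> V = space S" using sets.sets_into_space[OF V] by (auto simp: U_def)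
    ultimately show False using \<psi>(2) by simp
  qed
  note reach = irr[OF _ V this]
  \<comment> \<open>The mass of \<open>V\<close> after \<open>m\<close> steps is the old mass of
    \<open>V\<close>, which stays put, plus what enters from \<open>U\<close>; stationarity makes
    the second part 0.\<close>
  have "AE y in \<pi>. y \<in> U \<longrightarrow> emeasure (nst m y) V = 0" if m: "m \<ge> 1" for m
  proof -
    have "emeasure \<pi> V + (\<integral>\<^sup>+y. indicator U y * emeasure (nst m y) V \<partial>\<pi>)
        = (\<integral>\<^sup>+y. indicator V y + indicator U y * emeasure (nst m y) V \<partial>\<pi>)"
      by (subst nn_integral_add) (auto simp: sets_pi)
    also have "\<dots> = (\<integral>\<^sup>+y. (\<integral>\<^sup>+z. indicator V z \<partial>nst m y) \<partial>\<pi>)"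
    proof (rule nn_integral_cong)
      fix y assume "y \<in> space \<pi>"
      then have y: "y \<in> space S" by (simp add: space_pi)
      interpret n: prob_space "nst m y" by (rule prob_space_nstep[OF y])
      have "(\<integral>\<^sup>+z. indicator V z \<partial>nst m y) = emeasure (nst m y) V"
        by (rule nn_integral_indicator) (simp add: sets_nstep[OF y])
      moreover have "emeasure (nst m y) V = 1" if "y \<in> V"
        by (rule n.emeasure_eq_1_AE[OF _ absorb[OF that m]]) (simp add: sets_nstep[OF y])
      ultimately show "indicator V y + indicator U y * emeasure (nst m y) V = (\<integral>\<^sup>+z. indicator V z \<partial>nst m y)"
        using y by (auto simp: U_def indicator_def)
    qed
    also have "\<dots> = (\<integral>\<^sup>+y. indicator V y \<partial>\<pi>)"
      by (rule nn_integral_pi_nstep) simp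
    also have "\<dots> = emeasure \<pi> V + 0" by (simp add: sets_pi)
    finally have "(\<integral>\<^sup>+y. indicator U y * emeasure (nst m y) V \<partial>\<pi>) = 0"
      by (subst (asm) ennreal_add_left_cancel) simp
    then have "AE y in \<pi>. indicator U y * emeasure (nst m y) V = 0"
      by (subst (asm) nn_integral_0_iff_AE) auto
    then show ?thesis by (rule AE_mp) (auto intro!: AE_I2 split: split_indicator_asm)
  qed
  then have "AE y in \<pi>. \<forall>m\<in>{1..}. y \<in> U \<longrightarrow> emeasure (nst m y) V = 0"
    by (subst AE_ball_countable) auto
  then have "AE y in \<pi>. y \<in> V"
  proof (rule AE_mono_space)
    fix y assume y: "y \<in> space \<pi>" and *: "\<forall>m\<in>{1..}. y \<in> U \<longrightarrow> emeasure (nst m y) V = 0"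
    show "y \<in> V"
      using reach[of y] y * by (auto simp: U_def space_pi)
  qed
  then have "AE y in \<pi>. emeasure (K y) A = 0"
    by (rule AE_mp) (auto intro!: AE_I2 simp: V_def nstep_one[symmetric] simp del: nstep.simps)
  then have "(\<integral>\<^sup>+y. emeasure (K y) A \<partial>\<pi>) = 0"
    by (subst nn_integral_0_iff_AE) auto
  then show False using stationary pos A by (simp add: stationary_def)
qed

text \<open>The exceptional set has probability 0 at every time from \<open>x\<close>, so
  \<open>pi_irreducible\<close> makes it null. This is the device that turns knowledge about one
  starting point into knowledge about almost every point.\<close>

lemma AE_pi_of_AE_nstep:
  assumes x: "x \<in> space S" and [measurable]: "Measurable.pred S P"
    and "\<And>n. n \<ge> 1 \<Longrightarrow> AE y in nst n x. P y"
  shows "AE y in \<pi>. P y"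
proof (rule ccontr)
  let ?A = "{y \<in> space S. \<not> P y}"
  assume "\<not> ?thesis"
  then have "emeasure \<pi> ?A > 0"
    by (subst (asm) AE_iff_measurable[OF _ refl]) (auto simp: space_pi sets_pi zero_less_iff_neq_zero)
  from pi_irreducible[OF _ this x] obtain n where n: "n \<ge> 1" "emeasure (nst n x) ?A > 0"
    by auto
  have "AE y in nst n x. y \<notin> ?A"
    using assms(3)[OF n(1)] by (rule AE_mp) (auto intro!: AE_I2)
  then show False using n(2) by (subst (asm) AE_nstep_not_in[OF x]) auto
qed

text \<open>It suffices to find one point of \<open>V\<close> from which the chain is almost surely
  in \<open>V\<close> at each time. Iterating the hypothesis, almost every point of \<open>V\<close>
  is of this kind, and positive mass guarantees that there is one.\<close>

lemma AE_pi_absorbing: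
  assumes [measurable]: "V \<in> sets S" and pos: "emeasure \<pi> V > 0"
    and abs: "AE x in \<pi>. x \<in> V \<longrightarrow> (AE y in K x. y \<in> V)"
  shows "AE x in \<pi>. x \<in> V"
proof -
  have "AE x in \<pi>. x \<in> V \<longrightarrow> (AE y in nst n x. y \<in> V)" for n
  proof (induction n)
    case 0
    show ?case
    proof (rule AE_I2, rule impI)
      fix x assume "x \<in> space \<pi>" "x \<in> V"
      then have "AE y in return S x. y \<in> V" by (subst AE_return) (auto simp: space_pi)
      then show "AE y in nst 0 x. y \<in> V" by (simp only: nstep.simps)
    qed
  next
    case (Suc n)
    have "AE x in \<pi>. AE y in nst (Suc 0) x. y \<in> V \<longrightarrow> (AE z in nst n y. z \<in> V)"
      by (rule AE_pi_nstep[OF Suc])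
    with abs have "AE x in \<pi>. (x \<in> V \<longrightarrow> (AE y in K x. y \<in> V))
        \<and> (AE y in nst (Suc 0) x. y \<in> V \<longrightarrow> (AE z in nst n y. z \<in> V))"
      by (rule AE_conjI)
    then show ?case
    proof (rule AE_mono_space, intro impI)
      fix x assume elim: "x \<in> V" "(x \<in> V \<longrightarrow> (AE y in K x. y \<in> V))
        \<and> (AE y in nst (Suc 0) x. y \<in> V \<longrightarrow> (AE z in nst n y. z \<in> V))"
      then have x: "x \<in> space S" using sets.sets_into_space[OF assms(1)] by auto
      have "AE y in K x. AE z in nst n y. z \<in> V"
        using elim x by (auto simp only: AE_nstep_1)
      then show "AE y in nst (Suc n) x. y \<in> V" by (subst AE_K_nstep[OF x]) auto
    qed
  qed
  then have ae: "AE x in \<pi>. \<forall>n. x \<in> V \<longrightarrow> (AE y in nst n x. y \<in> V)"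
    by (subst AE_all_countable) auto
  have "\<exists>x\<in>V. \<forall>n. AE y in nst n x. y \<in> V"
  proof (rule ccontr)
    assume *: "\<not> ?thesis"
    have "AE x in \<pi>. x \<notin> V" using ae by (rule AE_mono_space) (use * in blast)
    then have "emeasure \<pi> V = 0"
      using sets.sets_into_space[OF assms(1)]
      by (subst (asm) AE_iff_measurable[of V]) (auto simp: sets_pi space_pi)
    then show False using pos by simp
  qed
  then obtain x where "x \<in> V" "\<And>n. AE y in nst n x. y \<in> V" by auto
  then show ?thesis
    using sets.sets_into_space[OF assms(1)] by (intro AE_pi_of_AE_nstep[of x]) auto
qed

text \<open>\<open>H\<close> consists of the points from which \<open>N\<close> has probability 0 at
  every time. Stationarity gives it full measure, and a step from such a point leads almost surely
  to another one.\<close>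

lemma absorbing_avoiding_null_set:
  assumes N: "N \<in> null_sets \<pi>"
  obtains H where "H \<in> sets S" "H \<inter> N = {}" "AE x in \<pi>. x \<in> H" "\<And>x. x \<in> H \<Longrightarrow> AE y in K x. y \<in> H"
proof
  \<comment> \<open>Time \<open>k = 0\<close> is included, which makes \<open>H\<close> disjoint
    from \<open>N\<close>.\<close>
  define H where "H = {x \<in> space S. \<forall>k. emeasure (nst k x) N = 0}"
  have [measurable]: "N \<in> sets S" using N by (auto simp: sets_pi)
  show "H \<in> sets S" unfolding H_def by measurable
  show "H \<inter> N = {}"
  proof -
    have "x \<notin> N" if "x \<in> H" for x
    proof -
      have "emeasure (nst 0 x) N = 0" using that unfolding H_def by blast
      then show ?thesis by (auto simp: indicator_def split: if_splits)
    qed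
    then show ?thesis by auto
  qed
  have "AE x in \<pi>. x \<notin> N" by (rule AE_not_in[OF N])
  then have "AE x in \<pi>. AE y in nst k x. y \<notin> N" for k
    by (rule AE_pi_nstep)
  then have "AE x in \<pi>. \<forall>k. AE y in nst k x. y \<notin> N" by (subst AE_all_countable) auto
  then show "AE x in \<pi>. x \<in> H"
    by (rule AE_mp) (auto intro!: AE_I2 simp: H_def space_pi AE_nstep_not_in)
  fix x assume x: "x \<in> H"
  then have xs: "x \<in> space S" by (simp add: H_def)
  have "AE y in K x. AE z in nst k y. z \<notin> N" for k
    using x by (subst AE_K_nstep[symmetric]) (auto simp: H_def AE_nstep_not_in simp del: nstep.simps)
  then have "AE y in K x. \<forall>k. AE z in nst k y. z \<notin> N" by (subst AE_all_countable) auto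
  then show "AE y in K x. y \<in> H"
    by (rule AE_mp) (auto intro!: AE_I2 simp: H_def space_kernel[OF xs] AE_nstep_not_in)
qed

text \<open>Integrating \<open>trapped_eq\<close> against \<open>\<pi>\<close> shows that the
  integral of \<open>trapped B\<close> is carried by \<open>B\<close> alone, so
  \<open>trapped B\<close> vanishes almost everywhere on \<open>A\<close>. The zero set
  \<open>Z\<close> thus has positive mass. It is absorbing: from a zero, the fixed-point equation
  gives zeros in \<open>B\<close>, and the points of \<open>A\<close> are almost surely zeros
  anyway. Hence \<open>Z\<close> has full measure.\<close>

lemma AE_trapped_eq_0:
  assumes [measurable]: "A \<in> sets S" and pos: "emeasure \<pi> A > 0"
  shows "AE x in \<pi>. trapped (space S - A) x = 0"
proof -
  define B where "B = space S - A"
  have B[measurable]: "B \<in> sets S" by (simp add: B_def)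
  have "(\<integral>\<^sup>+x. trapped B x \<partial>\<pi>) \<le> (\<integral>\<^sup>+x. 1 \<partial>\<pi>)"
    by (intro nn_integral_mono trapped_le_1) (simp add: space_pi)
  then have fin: "(\<integral>\<^sup>+x. trapped B x \<partial>\<pi>) \<noteq> \<infinity>" by (auto simp: pi.emeasure_space_1 top_unique)
  have "(\<integral>\<^sup>+x. trapped B x \<partial>\<pi>) = (\<integral>\<^sup>+x. (\<integral>\<^sup>+y. indicator B y * trapped B y \<partial>nst 1 x) \<partial>\<pi>)"
    by (intro nn_integral_cong) (simp add: trapped_eq[OF B] space_pi nstep_one del: nstep.simps)
  also have "\<dots> = (\<integral>\<^sup>+x. indicator B x * trapped B x \<partial>\<pi>)"
    by (rule nn_integral_pi_nstep) measurable
  finally have eq: "(\<integral>\<^sup>+x. trapped B x \<partial>\<pi>) = (\<integral>\<^sup>+x. indicator B x * trapped B x \<partial>\<pi>)" .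
  have "(\<integral>\<^sup>+x. trapped B x \<partial>\<pi>) + 0 = (\<integral>\<^sup>+x. indicator B x * trapped B x + indicator A x * trapped B x \<partial>\<pi>)"
    by (subst add_0_right, intro nn_integral_cong) (auto simp: B_def indicator_def space_pi)
  also have "\<dots> = (\<integral>\<^sup>+x. trapped B x \<partial>\<pi>) + (\<integral>\<^sup>+x. indicator A x * trapped B x \<partial>\<pi>)"
    unfolding eq by (rule nn_integral_add) measurable
  finally have "(\<integral>\<^sup>+x. indicator A x * trapped B x \<partial>\<pi>) = 0"
    using fin by (subst (asm) ennreal_add_left_cancel) auto
  then have "AE x in \<pi>. indicator A x * trapped B x = 0"
    by (subst (asm) nn_integral_0_iff_AE) auto
  then have ae: "AE x in \<pi>. x \<in> A \<longrightarrow> trapped B x = 0"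
    by (rule AE_mp) (auto intro!: AE_I2 split: split_indicator_asm)
  define Z where "Z = {x \<in> space S. trapped B x = 0}"
  have Z[measurable]: "Z \<in> sets S" by (simp add: Z_def)
  have "emeasure \<pi> A \<le> emeasure \<pi> Z"
    using ae by (intro emeasure_mono_AE) (auto simp: Z_def sets_pi dest: sets.sets_into_space[OF assms(1), THEN subsetD])
  then have "emeasure \<pi> Z > 0" using pos by simp
  moreover have "AE x in \<pi>. x \<in> Z \<longrightarrow> (AE y in K x. y \<in> Z)"
    using AE_pi_nstep[OF ae, of "Suc 0"]
  proof (rule AE_mono_space, intro impI)
    fix x assume elim: "AE y in nst (Suc 0) x. y \<in> A \<longrightarrow> trapped B y = 0" "x \<in> Z"
    then have x: "x \<in> space S" by (simp add: Z_def)
    have "(\<integral>\<^sup>+y. indicator B y * trapped B y \<partial>K x) = 0"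
      using elim(2) trapped_eq[OF B x] by (simp add: Z_def)
    then have "AE y in K x. indicator B y * trapped B y = 0"
      by (subst (asm) nn_integral_0_iff_AE) (auto simp: measurable_cong_sets[OF sets_kernel[OF x] refl])
    moreover have "AE y in K x. y \<in> A \<longrightarrow> trapped B y = 0"
      using elim(1) x by (simp only: AE_nstep_1)
    ultimately show "AE y in K x. y \<in> Z"
      using AE_space by eventually_elim (auto simp: Z_def B_def space_kernel[OF x] indicator_def split: if_splits)
  qed
  ultimately have "AE x in \<pi>. x \<in> Z" by (intro AE_pi_absorbing) auto
  then show ?thesis by (rule AE_mp) (auto intro!: AE_I2 simp: Z_def B_def)
qed

end

section \<open>The singular part of the two-time distributions\<close>

lemma (in prob_space) AE_obtain:
  assumes "AE x in M. P x"
  obtains x where "x \<in> space M" "P x"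
proof (rule ccontr)
  assume no: "\<not> thesis"
  from assms have "AE x in M. False"
    by (rule AE_mono_space) (use no that in auto)
  then show False by simp
qed

text \<open>For each \<open>n\<close>, the union of a maximizing sequence is a null set of largest
  \<open>M n\<close>-measure; a further null set of positive measure outside it would contradict the
  maximum. The union over \<open>n\<close> serves all the measures at once.\<close>

lemma maximal_null_set:
  fixes M :: "nat \<Rightarrow> 'b measure"
  assumes fin: "\<And>n. finite_measure (M n)" and sets: "\<And>n. sets (M n) = sets N"
  obtains E where "E \<in> null_sets N" "\<And>n A. A \<in> null_sets N \<Longrightarrow> emeasure (M n) (A - E) = 0"
proof -
  have "\<exists>E\<in>null_sets N. \<forall>A\<in>null_sets N. emeasure (M n) (A - E) = 0" for n
  proof -
    interpret finite_measure "M n" by (rule fin)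
    have ne: "null_sets N \<noteq> {}" by blast
    obtain f :: "nat \<Rightarrow> ennreal" where f: "range f \<subseteq> emeasure (M n) ` null_sets N"
      "Sup (emeasure (M n) ` null_sets N) = Sup (range f)"
      using ennreal_Sup_countable_SUP[of "emeasure (M n) ` null_sets N"] ne by auto
    have "\<exists>A. \<forall>i. A i \<in> null_sets N \<and> f i = emeasure (M n) (A i)"
      using f(1) by (intro choice) (auto simp: image_iff subset_iff)
    then obtain A where A: "\<And>i. A i \<in> null_sets N" "\<And>i. f i = emeasure (M n) (A i)" by auto
    define E where "E = (\<Union>i. A i)"
    have E: "E \<in> null_sets N" unfolding E_def using A(1) by (rule null_sets_UN)
    have le: "emeasure (M n) B \<le> emeasure (M n) E" if "B \<in> null_sets N" for B
    proof -
      have "emeasure (M n) B \<le> Sup (range f)" unfolding f(2)[symmetric] using that by (rule SUP_upper)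
      also have "\<dots> \<le> emeasure (M n) E"
        using A E by (intro SUP_least) (auto simp: sets E_def intro!: emeasure_mono)
      finally show ?thesis .
    qed
    have "emeasure (M n) (B - E) = 0" if B: "B \<in> null_sets N" for B
    proof -
      have "emeasure (M n) E + emeasure (M n) (B - E) = emeasure (M n) (E \<union> (B - E))"
        using B E by (intro plus_emeasure) (auto simp: sets null_setsD2)
      also have "\<dots> \<le> emeasure (M n) E + 0"
        using le[of "E \<union> B"] B E by (simp add: null_sets.Un)
      finally show ?thesis 
        by (simp add: emeasure_eq_measure ennreal_plus[symmetric] measure_le_0_iff del: ennreal_plus)
    qed
    with E show ?thesis by auto
  qed
  then have "\<exists>E. \<forall>n. E n \<in> null_sets N \<and> (\<forall>A\<in>null_sets N. emeasure (M n) (A - E n) = 0)"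
    by (intro choice) auto
  then obtain E where E: "\<And>n. E n \<in> null_sets N" "\<And>n A. A \<in> null_sets N \<Longrightarrow> emeasure (M n) (A - E n) = 0"
    by auto
  show thesis
  proof
    show "(\<Union>n. E n) \<in> null_sets N" using E(1) by (rule null_sets_UN)
    fix n A assume A: "A \<in> null_sets N"
    have "emeasure (M n) (A - (\<Union>n. E n)) \<le> emeasure (M n) (A - E n)"
      using A E(1)[of n] by (intro emeasure_mono) (auto simp: sets null_setsD2)
    then show "emeasure (M n) (A - (\<Union>n. E n)) = 0" using E(2)[OF A, of n] by simp
  qed
qed

context stationary_irreducible_chain
begin

sublocale pp: pair_prob_space \<pi> \<pi> by standard

text \<open>The law of (X_0, X_n) for the chain started from \<open>\<pi>\<close>.\<close>

definition joint :: "nat \<Rightarrow> ('a \<times> 'a) measure" where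
  "joint n = \<pi> \<bind> (\<lambda>x. distr (nst n x) (S \<Otimes>\<^sub>M S) (Pair x))"

lemma joint_kernel[measurable]: "(\<lambda>x. distr (nst n x) (S \<Otimes>\<^sub>M S) (Pair x)) \<in> S \<rightarrow>\<^sub>M subprob_algebra (S \<Otimes>\<^sub>M S)"
  by (rule measurable_distr2[where M=S]) measurable

lemma sets_joint[measurable_cong]: "sets (joint n) = sets (S \<Otimes>\<^sub>M S)"
  unfolding joint_def by (rule sets_bind) (auto simp: space_pi space_S_not_empty)

lemma space_joint: "space (joint n) = space S \<times> space S"
  using sets_eq_imp_space_eq[OF sets_joint] by (simp add: space_pair_measure)

lemma nn_integral_joint:
  assumes [measurable]: "f \<in> borel_measurable (S \<Otimes>\<^sub>M S)"
  shows "(\<integral>\<^sup>+z. f z \<partial>joint n) = (\<integral>\<^sup>+x. (\<integral>\<^sup>+y. f (x, y) \<partial>nst n x) \<partial>\<pi>)"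
proof -
  have "(\<integral>\<^sup>+z. f z \<partial>joint n) = (\<integral>\<^sup>+x. (\<integral>\<^sup>+z. f z \<partial>distr (nst n x) (S \<Otimes>\<^sub>M S) (Pair x)) \<partial>\<pi>)"
    unfolding joint_def by (rule nn_integral_bind[where B="S \<Otimes>\<^sub>M S"]) measurable
  also have "\<dots> = (\<integral>\<^sup>+x. (\<integral>\<^sup>+y. f (x, y) \<partial>nst n x) \<partial>\<pi>)"
  proof (rule nn_integral_cong)
    fix x assume x: "x \<in> space \<pi>"
    then have x': "x \<in> space S" by (simp add: space_pi)
    note [measurable_cong] = sets_nstep[OF x']
    show "(\<integral>\<^sup>+z. f z \<partial>distr (nst n x) (S \<Otimes>\<^sub>M S) (Pair x)) = (\<integral>\<^sup>+y. f (x, y) \<partial>nst n x)"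
      using x' by (intro nn_integral_distr) measurable
  qed
  finally show ?thesis .
qed

lemma section_measurable[measurable]:
  assumes f[measurable]: "f \<in> borel_measurable (S \<Otimes>\<^sub>M S)" and x: "x \<in> space S"
  shows "(\<lambda>y. f (x, y)) \<in> borel_measurable S"
  using measurable_compose[OF measurable_Pair1'[OF x] f] .

lemma AE_joint:
  assumes [measurable]: "Measurable.pred (S \<Otimes>\<^sub>M S) P"
  shows "(AE z in joint n. P z) \<longleftrightarrow> (AE x in \<pi>. AE y in nst n x. P (x, y))"
proof -
  have "(AE z in joint n. P z) \<longleftrightarrow> (AE x in \<pi>. AE z in distr (nst n x) (S \<Otimes>\<^sub>M S) (Pair x). P z)"
    unfolding joint_def by (rule AE_bind[where B="S \<Otimes>\<^sub>M S"]) measurable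
  also have "\<dots> \<longleftrightarrow> (AE x in \<pi>. AE y in nst n x. P (x, y))"
  proof (rule AE_cong)
    fix x assume "x \<in> space \<pi>"
    then have x: "x \<in> space S" by (simp add: space_pi)
    note [measurable_cong] = sets_nstep[OF x]
    show "(AE z in distr (nst n x) (S \<Otimes>\<^sub>M S) (Pair x). P z) \<longleftrightarrow> (AE y in nst n x. P (x, y))"
      using x by (intro AE_distr_iff) measurable
  qed
  finally show ?thesis .
qed

lemma prob_space_joint: "prob_space (joint n)"
proof
  have "emeasure (joint n) (space (joint n)) = (\<integral>\<^sup>+z. 1 \<partial>joint n)" by simp
  also have "\<dots> = (\<integral>\<^sup>+x. (\<integral>\<^sup>+y. 1 \<partial>nst n x) \<partial>\<pi>)" by (rule nn_integral_joint) simp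
  also have "\<dots> = (\<integral>\<^sup>+x. 1 \<partial>\<pi>)"
    by (intro nn_integral_cong) (simp add: prob_space.emeasure_space_1[OF prob_space_nstep] space_pi)
  finally show "emeasure (joint n) (space (joint n)) = 1" by (simp add: pi.emeasure_space_1)
qed

lemma sets_pi_pair: "sets (\<pi> \<Otimes>\<^sub>M \<pi>) = sets (S \<Otimes>\<^sub>M S)"
  by (intro sets_pair_measure_cong sets_pi)

text \<open>
  One set that carries, for every \<open>n\<close>, the part of \<open>joint n\<close> that is singular to \<open>\<pi> \<Otimes> \<pi>\<close>.
\<close>

definition sing :: "('a \<times> 'a) set" where
  "sing = (SOME E. E \<in> null_sets (\<pi> \<Otimes>\<^sub>M \<pi>) \<and>
    (\<forall>n. \<forall>A\<in>null_sets (\<pi> \<Otimes>\<^sub>M \<pi>). emeasure (joint n) (A - E) = 0))"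

lemma sing_null: "sing \<in> null_sets (\<pi> \<Otimes>\<^sub>M \<pi>)"
  and sing_maximal: "A \<in> null_sets (\<pi> \<Otimes>\<^sub>M \<pi>) \<Longrightarrow> emeasure (joint n) (A - sing) = 0"
proof -
  obtain E where "E \<in> null_sets (\<pi> \<Otimes>\<^sub>M \<pi>)"
    "\<And>n A. A \<in> null_sets (\<pi> \<Otimes>\<^sub>M \<pi>) \<Longrightarrow> emeasure (joint n) (A - E) = 0"
    by (rule maximal_null_set[of joint "\<pi> \<Otimes>\<^sub>M \<pi>"])
       (auto simp: sets_joint sets_pi_pair prob_space_joint intro: prob_space.finite_measure)
  then have "\<exists>E. E \<in> null_sets (\<pi> \<Otimes>\<^sub>M \<pi>) \<and>
    (\<forall>n. \<forall>A\<in>null_sets (\<pi> \<Otimes>\<^sub>M \<pi>). emeasure (joint n) (A - E) = 0)" by blast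
  from someI_ex[OF this]
  show "sing \<in> null_sets (\<pi> \<Otimes>\<^sub>M \<pi>)"
    "A \<in> null_sets (\<pi> \<Otimes>\<^sub>M \<pi>) \<Longrightarrow> emeasure (joint n) (A - sing) = 0"
    unfolding sing_def[symmetric] by auto
qed

lemma sing_measurable[measurable]: "sing \<in> sets (S \<Otimes>\<^sub>M S)"
  using sing_null by (simp add: null_sets_def sets_pi_pair)

lemma AE_section_sing: "AE x in \<pi>. AE y in \<pi>. (x, y) \<notin> sing"
  using pp.AE_pair[OF AE_not_in[OF sing_null]] .

text \<open>By maximality of \<open>sing\<close>, \<open>joint n\<close> restricted to the
  complement of \<open>sing\<close> is absolutely continuous with respect to the product
  measure.\<close>

lemma AE_joint_of_AE_pair:
  assumes "AE z in \<pi> \<Otimes>\<^sub>M \<pi>. P z"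
  shows "AE z in joint n. z \<notin> sing \<longrightarrow> P z"
proof -
  obtain N where N: "{z \<in> space (\<pi> \<Otimes>\<^sub>M \<pi>). \<not> P z} \<subseteq> N" "emeasure (\<pi> \<Otimes>\<^sub>M \<pi>) N = 0" "N \<in> sets (\<pi> \<Otimes>\<^sub>M \<pi>)"
    using assms by (auto elim!: AE_E)
  then have "emeasure (joint n) (N - sing) = 0" by (intro sing_maximal) auto
  then have "N - sing \<in> null_sets (joint n)" using N(3) by (auto simp: null_sets_def sets_joint sets_pi_pair)
  from AE_not_in[OF this] show ?thesis
    by (rule AE_mono_space) (use N(1) in \<open>auto simp: space_joint space_pair_measure space_pi\<close>)
qed

lemma kernel_section_measurable[measurable]:
  assumes [measurable]: "f \<in> borel_measurable ((S \<Otimes>\<^sub>M S) \<Otimes>\<^sub>M S)"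
  shows "(\<lambda>z. \<integral>\<^sup>+w. f (z, w) \<partial>nst k (snd z)) \<in> borel_measurable (S \<Otimes>\<^sub>M S)"
  by (rule nn_integral_measurable_subprob_algebra2[where N=S]) measurable

text \<open>A chain that is off the singular part does not come back to it. For almost every
  \<open>x\<close> the section of \<open>sing\<close> is \<open>\<pi>\<close>-null, so by
  stationarity almost every \<open>y\<close> has no chance of being in it after \<open>k\<close>
  steps; off \<open>sing\<close>, almost every pair for the product measure is almost every pair for
  \<open>joint n\<close>.\<close>

lemma AE_return_to_sing:
  "AE z in joint n. z \<notin> sing \<longrightarrow> (\<integral>\<^sup>+w. indicator sing (fst z, w) \<partial>nst k (snd z)) = 0"
proof (rule AE_joint_of_AE_pair, rule pp.AE_pair_measure)
  have [measurable]: "(\<lambda>z. \<integral>\<^sup>+w. indicator sing (fst z, w) \<partial>nst k (snd z)) \<in> borel_measurable (S \<Otimes>\<^sub>M S)"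
    using kernel_section_measurable[of "\<lambda>(z, w). indicator sing (fst z, w)"] by simp
  show "{z \<in> space (\<pi> \<Otimes>\<^sub>M \<pi>). (\<integral>\<^sup>+w. indicator sing (fst z, w) \<partial>nst k (snd z)) = 0} \<in> sets (\<pi> \<Otimes>\<^sub>M \<pi>)"
    by measurable
  show "AE x in \<pi>. AE y in \<pi>. (\<integral>\<^sup>+w. indicator sing (fst (x, y), w) \<partial>nst k (snd (x, y))) = 0"
    using AE_section_sing
  proof (rule AE_mono_space)
    fix x assume x: "x \<in> space \<pi>" and ae: "AE y in \<pi>. (x, y) \<notin> sing"
    from x have [measurable]: "x \<in> space S" by (simp add: space_pi)
    have "(\<integral>\<^sup>+y. (\<integral>\<^sup>+w. indicator sing (x, w) \<partial>nst k y) \<partial>\<pi>) = (\<integral>\<^sup>+w. indicator sing (x, w) \<partial>\<pi>)"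
      by (rule nn_integral_pi_nstep) measurable
    also have "\<dots> = 0"
      using ae by (subst nn_integral_0_iff_AE) auto
    finally show "AE y in \<pi>. (\<integral>\<^sup>+w. indicator sing (fst (x, y), w) \<partial>nst k (snd (x, y))) = 0"
      by (subst (asm) nn_integral_0_iff_AE) auto
  qed
qed

lemma joint_density:
  obtains f :: "'a \<times> 'a \<Rightarrow> ennreal" where "f \<in> borel_measurable (S \<Otimes>\<^sub>M S)"
    "density (\<pi> \<Otimes>\<^sub>M \<pi>) f = density (joint n) (indicator (- sing))"
proof -
  interpret j: prob_space "joint n" by (rule prob_space_joint)
  have "absolutely_continuous (\<pi> \<Otimes>\<^sub>M \<pi>) (density (joint n) (indicator (- sing)))"
    unfolding absolutely_continuous_def
  proof
    fix A assume A: "A \<in> null_sets (\<pi> \<Otimes>\<^sub>M \<pi>)"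
    then have [measurable]: "A \<in> sets (S \<Otimes>\<^sub>M S)" by (simp add: null_sets_def sets_pi_pair)
    have "emeasure (density (joint n) (indicator (- sing))) A = (\<integral>\<^sup>+z. indicator (- sing) z * indicator A z \<partial>joint n)"
      by (rule emeasure_density) (auto simp: sets_joint)
    also have "\<dots> = (\<integral>\<^sup>+z. indicator (A - sing) z \<partial>joint n)"
      by (intro nn_integral_cong) (auto simp: indicator_def)
    also have "\<dots> = emeasure (joint n) (A - sing)"
      by (rule nn_integral_indicator) (simp add: sets_joint)
    also have "\<dots> = 0" by (rule sing_maximal[OF A])
    finally show "A \<in> null_sets (density (joint n) (indicator (- sing)))"
      by (auto simp: null_sets_def sets_joint)
  qed
  from pp.Radon_Nikodym[OF this]
  obtain f where "f \<in> borel_measurable (\<pi> \<Otimes>\<^sub>M \<pi>)" "density (\<pi> \<Otimes>\<^sub>M \<pi>) f = density (joint n) (indicator (- sing))"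
    by (auto simp: sets_joint sets_pi_pair)
  then show thesis by (intro that[of f]) (simp_all add: measurable_cong_sets[OF sets_pi_pair refl])
qed

text \<open>
  Off \<open>sing\<close> the law of \<open>(X\<^sub>n, X\<^sub>n\<^sub>+\<^sub>k)\<close> has a density \<open>f\<close>, so \<open>X\<^sub>n\<^sub>+\<^sub>k\<close> may be integrated against \<open>\<pi>\<close>
  independently of \<open>X\<^sub>0\<close>. The exceptional null set in \<open>f\<close> depends on the set it is tested on, hence
  the comparison on rectangles and the extension to \<open>sing\<close> by a Dynkin argument.
\<close>

lemma AE_sing_compose:
  "AE z in joint n. (\<integral>\<^sup>+w. indicator sing (fst z, w) * indicator (- sing) (snd z, w) \<partial>nst k (snd z)) = 0"
proof -
  obtain f :: "'a \<times> 'a \<Rightarrow> ennreal" where f[measurable]: "f \<in> borel_measurable (S \<Otimes>\<^sub>M S)"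
    and dens: "density (\<pi> \<Otimes>\<^sub>M \<pi>) f = density (joint k) (indicator (- sing))"
    by (rule joint_density)
  interpret j: prob_space "joint n" by (rule prob_space_joint)
  interpret jk: prob_space "joint k" by (rule prob_space_joint)
  \<comment> \<open>\<open>g\<close> and \<open>h\<close> integrate over the position after
    \<open>k\<close> further steps, \<open>g\<close> with the kernel off \<open>sing\<close> and
    \<open>h\<close> with the density; the aim is equality of their integrals for
    \<open>B = sing\<close>.\<close>
  define g :: "('a \<times> 'a) set \<Rightarrow> 'a \<times> 'a \<Rightarrow> ennreal" where "g B z = (\<integral>\<^sup>+w. indicator B (fst z, w) * indicator (- sing) (snd z, w) \<partial>nst k (snd z))" for B z
  define h :: "('a \<times> 'a) set \<Rightarrow> 'a \<times> 'a \<Rightarrow> ennreal" where "h B z = (\<integral>\<^sup>+w. indicator B (fst z, w) * f (snd z, w) \<partial>\<pi>)" for B z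
  have gm[measurable]: "g B \<in> borel_measurable (S \<Otimes>\<^sub>M S)" if [measurable]: "B \<in> sets (S \<Otimes>\<^sub>M S)" for B
    unfolding g_def[abs_def]
    using kernel_section_measurable[of "\<lambda>(z, w). indicator B (fst z, w) * indicator (- sing) (snd z, w)"] by simp
  have hm[measurable]: "h B \<in> borel_measurable (S \<Otimes>\<^sub>M S)" if [measurable]: "B \<in> sets (S \<Otimes>\<^sub>M S)" for B
    unfolding h_def[abs_def] by measurable
  \<comment> \<open>Integrating over \<open>y\<close> in an arbitrary set \<open>A\<close> turns
    both sides into the measure of \<open>A \<times> C\<close> under the two descriptions in
    \<open>dens\<close>; uniqueness of densities then gives equality for almost every
    \<open>y\<close>, with a null set that depends on \<open>C\<close>.\<close>
  have eq: "AE y in \<pi>. (\<integral>\<^sup>+w. indicator C w * indicator (- sing) (y, w) \<partial>nst k y) = (\<integral>\<^sup>+w. indicator C w * f (y, w) \<partial>\<pi>)"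
    if [measurable]: "C \<in> sets S" for C
  proof -
    have [measurable]: "(\<lambda>y. \<integral>\<^sup>+w. indicator C w * indicator (- sing) (y, w) \<partial>nst k y) \<in> borel_measurable S"
      by (rule nn_integral_measurable_subprob_algebra2[where N=S]) measurable
    have "density \<pi> (\<lambda>y. \<integral>\<^sup>+w. indicator C w * indicator (- sing) (y, w) \<partial>nst k y)
        = density \<pi> (\<lambda>y. \<integral>\<^sup>+w. indicator C w * f (y, w) \<partial>\<pi>)"
    proof (rule measure_eqI)
      fix A assume "A \<in> sets (density \<pi> (\<lambda>y. \<integral>\<^sup>+w. indicator C w * indicator (- sing) (y, w) \<partial>nst k y))"
      then have [measurable]: "A \<in> sets S" by (simp add: sets_pi)
      have "(\<integral>\<^sup>+y. (\<integral>\<^sup>+w. indicator C w * indicator (- sing) (y, w) \<partial>nst k y) * indicator A y \<partial>\<pi>)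
        = (\<integral>\<^sup>+y. (\<integral>\<^sup>+w. indicator (- sing) (y, w) * indicator (A \<times> C) (y, w) \<partial>nst k y) \<partial>\<pi>)"
      proof (intro nn_integral_cong)
        fix y assume "y \<in> space \<pi>"
        then have y[measurable]: "y \<in> space S" by (simp add: space_pi)
        note [measurable_cong] = sets_nstep[OF y]
        show "(\<integral>\<^sup>+w. indicator C w * indicator (- sing) (y, w) \<partial>nst k y) * indicator A y
          = (\<integral>\<^sup>+w. indicator (- sing) (y, w) * indicator (A \<times> C) (y, w) \<partial>nst k y)"
          by (auto simp: indicator_def intro!: nn_integral_cong)
      qed
      also have "\<dots> = (\<integral>\<^sup>+z. indicator (- sing) z * indicator (A \<times> C) z \<partial>joint k)"
        by (rule nn_integral_joint[symmetric]) measurable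
      also have "\<dots> = emeasure (density (joint k) (indicator (- sing))) (A \<times> C)"
        by (rule emeasure_density[symmetric]) (auto simp: sets_joint)
      also have "\<dots> = (\<integral>\<^sup>+z. f z * indicator (A \<times> C) z \<partial>(\<pi> \<Otimes>\<^sub>M \<pi>))"
        unfolding dens[symmetric]
        by (rule emeasure_density) (auto simp: sets_pi_pair measurable_cong_sets[OF sets_pi_pair refl])
      also have "\<dots> = (\<integral>\<^sup>+y. (\<integral>\<^sup>+w. f (y, w) * indicator (A \<times> C) (y, w) \<partial>\<pi>) \<partial>\<pi>)"
        by (rule pi.nn_integral_fst[symmetric]) measurable
      also have "\<dots> = (\<integral>\<^sup>+y. (\<integral>\<^sup>+w. indicator C w * f (y, w) \<partial>\<pi>) * indicator A y \<partial>\<pi>)"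
        by (intro nn_integral_cong) (auto simp: indicator_def intro!: nn_integral_cong)
      finally show "emeasure (density \<pi> (\<lambda>y. \<integral>\<^sup>+w. indicator C w * indicator (- sing) (y, w) \<partial>nst k y)) A
        = emeasure (density \<pi> (\<lambda>y. \<integral>\<^sup>+w. indicator C w * f (y, w) \<partial>\<pi>)) A"
        by (subst (1 2) emeasure_density) (auto simp: sets_pi)
    qed simp
    then show ?thesis
      by (subst (asm) pi.density_unique_iff) auto
  qed
  have g_le: "g B z \<le> 1" if "z \<in> space S \<times> space S" for B z
  proof -
    interpret prob_space "nst k (snd z)" using that by (intro prob_space_nstep) auto
    have "g B z \<le> (\<integral>\<^sup>+w. 1 \<partial>nst k (snd z))"
      unfolding g_def by (intro nn_integral_mono) (auto simp: indicator_def)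
    then show ?thesis by (simp add: emeasure_space_1)
  qed
  \<comment> \<open>Finiteness allows cancellation in the complement case below.\<close>
  have g_fin: "(\<integral>\<^sup>+z. g B z \<partial>joint n) \<noteq> \<infinity>" for B
  proof -
    have "(\<integral>\<^sup>+z. g B z \<partial>joint n) \<le> (\<integral>\<^sup>+z. 1 \<partial>joint n)"
      by (intro nn_integral_mono g_le) (auto simp: space_joint)
    then show ?thesis by (auto simp: j.emeasure_space_1 top_unique)
  qed
  have g_add: "(\<integral>\<^sup>+z. g (\<Union>i. B i) z \<partial>joint n) = (\<Sum>i. \<integral>\<^sup>+z. g (B i) z \<partial>joint n)"
    if B[measurable]: "\<And>i. B i \<in> sets (S \<Otimes>\<^sub>M S)" and d: "disjoint_family B" for B :: "nat \<Rightarrow> _"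
  proof -
    have "(\<integral>\<^sup>+z. g (\<Union>i. B i) z \<partial>joint n) = (\<integral>\<^sup>+z. (\<Sum>i. g (B i) z) \<partial>joint n)"
    proof (rule nn_integral_cong)
      fix z assume "z \<in> space (joint n)"
      then have [measurable]: "fst z \<in> space S" and z: "snd z \<in> space S" by (auto simp: space_joint)
      note [measurable] = z and [measurable_cong] = sets_nstep[OF z]
      show "g (\<Union>i. B i) z = (\<Sum>i. g (B i) z)"
        unfolding g_def suminf_indicator[OF d, symmetric] ennreal_suminf_multc[symmetric]
        by (rule nn_integral_suminf) measurable
    qed
    also have "\<dots> = (\<Sum>i. \<integral>\<^sup>+z. g (B i) z \<partial>joint n)"
      by (rule nn_integral_suminf) measurable
    finally show ?thesis .
  qed
  have h_add: "(\<integral>\<^sup>+z. h (\<Union>i. B i) z \<partial>joint n) = (\<Sum>i. \<integral>\<^sup>+z. h (B i) z \<partial>joint n)"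
    if B[measurable]: "\<And>i. B i \<in> sets (S \<Otimes>\<^sub>M S)" and d: "disjoint_family B" for B :: "nat \<Rightarrow> _"
  proof -
    have "(\<integral>\<^sup>+z. h (\<Union>i. B i) z \<partial>joint n) = (\<integral>\<^sup>+z. (\<Sum>i. h (B i) z) \<partial>joint n)"
    proof (rule nn_integral_cong)
      fix z assume "z \<in> space (joint n)"
      then have [measurable]: "fst z \<in> space S" "snd z \<in> space S" by (auto simp: space_joint)
      show "h (\<Union>i. B i) z = (\<Sum>i. h (B i) z)"
        unfolding h_def suminf_indicator[OF d, symmetric] ennreal_suminf_multc[symmetric]
        by (rule nn_integral_suminf) measurable
    qed
    also have "\<dots> = (\<Sum>i. \<integral>\<^sup>+z. h (B i) z \<partial>joint n)"
      by (rule nn_integral_suminf) measurable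
    finally show ?thesis .
  qed
  have rect: "(\<integral>\<^sup>+z. g (A \<times> C) z \<partial>joint n) = (\<integral>\<^sup>+z. h (A \<times> C) z \<partial>joint n)"
    if [measurable]: "A \<in> sets S" "C \<in> sets S" for A C
  proof (rule nn_integral_cong_AE, subst AE_joint)
    show "Measurable.pred (S \<Otimes>\<^sub>M S) (\<lambda>z. g (A \<times> C) z = h (A \<times> C) z)" by measurable
    have "g (A \<times> C) (x, y) = indicator A x * (\<integral>\<^sup>+w. indicator C w * indicator (- sing) (y, w) \<partial>nst k y)" for x y
      unfolding g_def by (auto simp: indicator_def intro!: nn_integral_cong)
    moreover have "h (A \<times> C) (x, y) = indicator A x * (\<integral>\<^sup>+w. indicator C w * f (y, w) \<partial>\<pi>)" for x y
      unfolding h_def by (auto simp: indicator_def intro!: nn_integral_cong)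
    moreover have "AE x in \<pi>. AE y in nst n x. (\<integral>\<^sup>+w. indicator C w * indicator (- sing) (y, w) \<partial>nst k y) = (\<integral>\<^sup>+w. indicator C w * f (y, w) \<partial>\<pi>)"
      by (rule AE_pi_nstep[OF eq]) simp
    ultimately show "AE x in \<pi>. AE y in nst n x. g (A \<times> C) (x, y) = h (A \<times> C) (x, y)"
      by (simp only:) (auto elim!: AE_mono_space)
  qed
  have "(\<integral>\<^sup>+z. g B z \<partial>joint n) = (\<integral>\<^sup>+z. h B z \<partial>joint n)" if B: "B \<in> sets (S \<Otimes>\<^sub>M S)" for B
  proof -
    let ?G = "{a \<times> b |a b. a \<in> sets S \<and> b \<in> sets S}"
    have G: "?G \<subseteq> Pow (space S \<times> space S)" using sets.space_closed[of S] by auto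
    have "B \<in> sigma_sets (space S \<times> space S) ?G"
      using B by (simp add: sets_pair_measure)
    with Int_stable_pair_measure_generator[of S S] G show ?thesis
    proof (induction rule: sigma_sets_induct_disjoint)
      case (basic A) then show ?case using rect by auto
    next
      case empty then show ?case by (simp add: g_def h_def)
    next
      case (compl A)
      have [measurable]: "A \<in> sets (S \<Otimes>\<^sub>M S)" using compl by (simp add: sets_pair_measure)
      \<comment> \<open>Countable additivity also yields the complement, applied to
        \<open>A\<close>, its complement and then empty sets.\<close>
      define F where "F i = (if i = 0 then A else if i = Suc 0 then space S \<times> space S - A else {})" for i :: nat
      have F[measurable]: "F i \<in> sets (S \<Otimes>\<^sub>M S)" for i
        unfolding F_def by (auto simp: space_pair_measure[symmetric])
      have "A \<subseteq> space S \<times> space S" using sets.sets_into_space[of A "S \<Otimes>\<^sub>M S"] by (simp add: space_pair_measure)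
      then have UF: "(\<Union>i. F i) = space S \<times> space S"
        by (auto simp: F_def split: if_splits)
      have d: "disjoint_family F" by (auto simp: disjoint_family_on_def F_def)
      have z: "(\<integral>\<^sup>+z. g (F i) z \<partial>joint n) = 0" "(\<integral>\<^sup>+z. h (F i) z \<partial>joint n) = 0" if "i \<notin> {0, Suc 0}" for i
        using that by (auto simp: F_def g_def h_def)
      have "(\<integral>\<^sup>+z. g (space S \<times> space S) z \<partial>joint n) = (\<Sum>i\<in>{0, Suc 0}. \<integral>\<^sup>+z. g (F i) z \<partial>joint n)"
        unfolding UF[symmetric] g_add[OF F d] by (rule suminf_finite) (use z in auto)
      moreover have "(\<integral>\<^sup>+z. h (space S \<times> space S) z \<partial>joint n) = (\<Sum>i\<in>{0, Suc 0}. \<integral>\<^sup>+z. h (F i) z \<partial>joint n)"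
        unfolding UF[symmetric] h_add[OF F d] by (rule suminf_finite) (use z in auto)
      ultimately have sum: "(\<integral>\<^sup>+z. g A z \<partial>joint n) + (\<integral>\<^sup>+z. g (space S \<times> space S - A) z \<partial>joint n)
         = (\<integral>\<^sup>+z. g A z \<partial>joint n) + (\<integral>\<^sup>+z. h (space S \<times> space S - A) z \<partial>joint n)"
        using rect[of "space S" "space S"] compl by (auto simp: F_def)
      show ?case
        using sum[unfolded ennreal_add_left_cancel] g_fin[of A] unfolding infinity_ennreal_def by argo
    next
      case (union A)
      have "A i \<in> sets (S \<Otimes>\<^sub>M S)" for i using union by (auto simp: sets_pair_measure)
      then show ?case using union g_add[of A] h_add[of A] by simp
    qed
  qed
  from this[of sing] have "(\<integral>\<^sup>+z. g sing z \<partial>joint n) = (\<integral>\<^sup>+z. h sing z \<partial>joint n)" by simp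
  \<comment> \<open>For almost every \<open>x\<close> the section of \<open>sing\<close> is
    \<open>\<pi>\<close>-null, so an integral over it with a density against \<open>\<pi>\<close>
    vanishes whatever \<open>y\<close> is.\<close>
  also have "\<dots> = 0"
  proof (subst nn_integral_0_iff_AE)
    show "h sing \<in> borel_measurable (joint n)" by measurable
    show "AE z in joint n. h sing z = 0"
    proof (subst AE_joint)
      show "AE x in \<pi>. AE y in nst n x. h sing (x, y) = 0"
        using AE_section_sing
      proof (rule AE_mono_space, intro AE_I2)
        fix x y assume "AE y in \<pi>. (x, y) \<notin> sing"
        then have "h sing (x, y) = (\<integral>\<^sup>+w. 0 \<partial>\<pi>)"
          unfolding h_def by (intro nn_integral_cong_AE) (auto elim!: AE_mono_space)
        then show "h sing (x, y) = 0" by simp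
      qed
    qed measurable
  qed
  finally show ?thesis
    by (subst (asm) nn_integral_0_iff_AE) (auto simp: g_def)
qed

section \<open>Decay of the singular mass\<close>

definition sing_mass :: "nat \<Rightarrow> 'a \<Rightarrow> ennreal" where
  "sing_mass n x = (\<integral>\<^sup>+y. indicator sing (x, y) \<partial>nst n x)"

lemma sing_mass_measurable[measurable]: "sing_mass n \<in> borel_measurable S"
  unfolding sing_mass_def[abs_def]
  by (rule nn_integral_measurable_subprob_algebra2[where N=S]) measurable

lemma sing_mass_le_1: "x \<in> space S \<Longrightarrow> sing_mass n x \<le> 1"
proof -
  assume x: "x \<in> space S"
  interpret prob_space "nst n x" by (rule prob_space_nstep[OF x])
  have "sing_mass n x \<le> (\<integral>\<^sup>+y. 1 \<partial>nst n x)"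
    unfolding sing_mass_def by (intro nn_integral_mono) (auto simp: indicator_def)
  then show ?thesis by (simp add: emeasure_space_1)
qed

text \<open>A path from x through y to w whose endpoints form a singular pair almost surely has two
  singular legs: (x, y) by \<open>AE_return_to_sing\<close> and (y, w) by
  \<open>AE_sing_compose\<close>.\<close>

lemma sing_mass_add:
  "AE x in \<pi>. sing_mass (n + k) x \<le> (\<integral>\<^sup>+y. indicator sing (x, y) * sing_mass k y \<partial>nst n x)"
proof -
  have "AE z in joint n.
     (z \<notin> sing \<longrightarrow> (\<integral>\<^sup>+w. indicator sing (fst z, w) \<partial>nst k (snd z)) = 0) \<and>
     (\<integral>\<^sup>+w. indicator sing (fst z, w) * indicator (- sing) (snd z, w) \<partial>nst k (snd z)) = 0"
    using AE_return_to_sing AE_sing_compose by (rule AE_conjI)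
  then have "AE z in joint n. (\<integral>\<^sup>+w. indicator sing (fst z, w) \<partial>nst k (snd z)) \<le> indicator sing z * sing_mass k (snd z)"
  proof (rule AE_mono_space)
    fix z assume z: "z \<in> space (joint n)" and *: "(z \<notin> sing \<longrightarrow> (\<integral>\<^sup>+w. indicator sing (fst z, w) \<partial>nst k (snd z)) = 0) \<and>
     (\<integral>\<^sup>+w. indicator sing (fst z, w) * indicator (- sing) (snd z, w) \<partial>nst k (snd z)) = 0"
    from z have [measurable]: "fst z \<in> space S" and z': "snd z \<in> space S" by (auto simp: space_joint)
    note [measurable] = z' and [measurable_cong] = sets_nstep[OF z']
    have "(\<integral>\<^sup>+w. indicator sing (fst z, w) \<partial>nst k (snd z)) \<le>
      (\<integral>\<^sup>+w. indicator sing (fst z, w) * indicator (- sing) (snd z, w) + indicator sing (snd z, w) \<partial>nst k (snd z))"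
      by (intro nn_integral_mono) (auto simp: indicator_def)
    also have "\<dots> = sing_mass k (snd z)"
      unfolding sing_mass_def using * by (subst nn_integral_add) measurable
    finally show "(\<integral>\<^sup>+w. indicator sing (fst z, w) \<partial>nst k (snd z)) \<le> indicator sing z * sing_mass k (snd z)"
      using * by (cases "z \<in> sing") auto
  qed
  moreover have [measurable]: "(\<lambda>z. \<integral>\<^sup>+w. indicator sing (fst z, w) \<partial>nst k (snd z)) \<in> borel_measurable (S \<Otimes>\<^sub>M S)"
    using kernel_section_measurable[of "\<lambda>(z, w). indicator sing (fst z, w)"] by simp
  ultimately have "AE x in \<pi>. AE y in nst n x.
      (\<integral>\<^sup>+w. indicator sing (x, w) \<partial>nst k y) \<le> indicator sing (x, y) * sing_mass k y"
    by (subst (asm) AE_joint) auto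
  then show ?thesis
  proof (rule AE_mono_space)
    fix x assume x: "x \<in> space \<pi>" and ae: "AE y in nst n x.
      (\<integral>\<^sup>+w. indicator sing (x, w) \<partial>nst k y) \<le> indicator sing (x, y) * sing_mass k y"
    from x have x'[measurable]: "x \<in> space S" by (simp add: space_pi)
    have "sing_mass (n + k) x = (\<integral>\<^sup>+y. (\<integral>\<^sup>+w. indicator sing (x, w) \<partial>nst k y) \<partial>nst n x)"
      unfolding sing_mass_def by (rule nn_integral_nstep_add[OF x']) measurable
    also have "\<dots> \<le> (\<integral>\<^sup>+y. indicator sing (x, y) * sing_mass k y \<partial>nst n x)"
      by (rule nn_integral_mono_AE[OF ae])
    finally show "sing_mass (n + k) x \<le> (\<integral>\<^sup>+y. indicator sing (x, y) * sing_mass k y \<partial>nst n x)" .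
  qed
qed

lemma AE_sing_mass_decreasing: "AE x in \<pi>. \<forall>n. sing_mass (Suc n) x \<le> sing_mass n x"
proof (subst AE_all_countable, intro allI)
  fix n
  show "AE x in \<pi>. sing_mass (Suc n) x \<le> sing_mass n x"
    using sing_mass_add[of n 1]
  proof (rule AE_mono_space)
    fix x assume x: "x \<in> space \<pi>" and le: "sing_mass (n + 1) x \<le> (\<integral>\<^sup>+y. indicator sing (x, y) * sing_mass 1 y \<partial>nst n x)"
    note le
    also have "(\<integral>\<^sup>+y. indicator sing (x, y) * sing_mass 1 y \<partial>nst n x) \<le> sing_mass n x"
      unfolding sing_mass_def[of n x] using sing_mass_le_1 x
      by (intro nn_integral_mono) (auto simp: indicator_def space_pi space_nstep)
    finally show "sing_mass (Suc n) x \<le> sing_mass n x" by simp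
  qed
qed

text \<open>By monotone convergence the limit \<open>s\<close> inherits the inequality of
  \<open>sing_mass_add\<close>: \<open>s x\<close> is at most the integral of \<open>s\<close> over
  the singular part of the \<open>n\<close>-step distribution. Integrated against
  \<open>\<pi>\<close>, stationarity leaves nothing for the regular part, so \<open>s\<close>
  vanishes there. The singular parts seen from one good \<open>x\<close> all lie in a single
  \<open>\<pi>\<close>-null section, and irreducibility extends the vanishing of \<open>s\<close> to
  almost every point.\<close>

lemma AE_INF_sing_mass: "AE x in \<pi>. (INF n. sing_mass n x) = 0"
proof -
  define s where "s x = (INF n. sing_mass n x)" for x
  have [measurable]: "s \<in> borel_measurable S" unfolding s_def[abs_def] by measurable
  have s1: "s x \<le> 1" if "x \<in> space S" for x
    unfolding s_def by (rule INF_lower2[of 0]) (auto simp: sing_mass_le_1 that)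
  have outside: "AE x in \<pi>. AE y in nst n x. (x, y) \<notin> sing \<longrightarrow> s y = 0" for n
  proof -
    have "AE x in \<pi>. \<forall>k. sing_mass (n + k) x \<le> (\<integral>\<^sup>+y. indicator sing (x, y) * sing_mass k y \<partial>nst n x)"
      by (subst AE_all_countable) (intro allI sing_mass_add)
    moreover have "AE x in \<pi>. AE y in nst n x. \<forall>n. sing_mass (Suc n) y \<le> sing_mass n y"
      by (rule AE_pi_nstep[OF AE_sing_mass_decreasing])
    ultimately have le: "AE x in \<pi>. s x \<le> (\<integral>\<^sup>+y. indicator sing (x, y) * s y \<partial>nst n x)"
      using AE_space
    proof eventually_elim
      case (elim x)
      then have x[measurable]: "x \<in> space S" by (simp add: space_pi)
      interpret prob_space "nst n x" by (rule prob_space_nstep[OF x])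
      note [measurable_cong] = sets_nstep[OF x]
      have "s x \<le> (INF k. sing_mass (n + k) x)"
        unfolding s_def by (rule INF_mono) auto
      also have "\<dots> \<le> (INF k. \<integral>\<^sup>+y. indicator sing (x, y) * sing_mass k y \<partial>nst n x)"
        using elim by (intro INF_mono) auto
      also have "\<dots> = (\<integral>\<^sup>+y. (INF k. indicator sing (x, y) * sing_mass k y) \<partial>nst n x)"
      proof (rule nn_integral_monotone_convergence_INF_AE[where i=0, symmetric])
        show "AE y in nst n x. indicator sing (x, y) * sing_mass (Suc i) y \<le> indicator sing (x, y) * sing_mass i y" for i
          using elim(2) by (auto elim!: AE_mono_space intro!: mult_left_mono)
        have "(\<integral>\<^sup>+y. indicator sing (x, y) * sing_mass 0 y \<partial>nst n x) \<le> (\<integral>\<^sup>+y. 1 \<partial>nst n x)"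
          using sing_mass_le_1 by (intro nn_integral_mono) (auto simp: indicator_def space_nstep[OF x])
        then show "(\<integral>\<^sup>+y. indicator sing (x, y) * sing_mass 0 y \<partial>nst n x) < \<infinity>"
          by (rule le_less_trans) (simp add: emeasure_space_1)
      qed measurable
      also have "\<dots> = (\<integral>\<^sup>+y. indicator sing (x, y) * s y \<partial>nst n x)"
        by (intro nn_integral_cong) (auto simp: s_def indicator_def)
      finally show ?case .
    qed
    \<comment> \<open>\<open>?I\<close> and \<open>?J\<close> split the stationary integral of
      \<open>s\<close> at time \<open>n\<close> into the parts on and off \<open>sing\<close>; by
      \<open>le\<close> the first part already carries everything.\<close>
    let ?I = "\<integral>\<^sup>+x. (\<integral>\<^sup>+y. indicator sing (x, y) * s y \<partial>nst n x) \<partial>\<pi>"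
    let ?J = "\<integral>\<^sup>+z. indicator (- sing) z * s (snd z) \<partial>joint n"
    have "(\<integral>\<^sup>+x. s x \<partial>\<pi>) \<le> (\<integral>\<^sup>+x. 1 \<partial>\<pi>)" by (intro nn_integral_mono s1) (simp add: space_pi)
    then have fin: "(\<integral>\<^sup>+x. s x \<partial>\<pi>) \<noteq> \<infinity>" by (auto simp: pi.emeasure_space_1 top_unique)
    have "?I = (\<integral>\<^sup>+z. indicator sing z * s (snd z) \<partial>joint n)"
      by (subst nn_integral_joint) auto
    then have "?I + ?J = (\<integral>\<^sup>+z. indicator sing z * s (snd z) + indicator (- sing) z * s (snd z) \<partial>joint n)"
      by (subst nn_integral_add) measurable
    also have "\<dots> = (\<integral>\<^sup>+z. s (snd z) \<partial>joint n)"
      by (intro nn_integral_cong) (auto simp: indicator_def)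
    also have "\<dots> = (\<integral>\<^sup>+x. (\<integral>\<^sup>+y. s y \<partial>nst n x) \<partial>\<pi>)" by (subst nn_integral_joint) auto
    also have "\<dots> = (\<integral>\<^sup>+x. s x \<partial>\<pi>)" by (rule nn_integral_pi_nstep) measurable
    finally have sum: "?I + ?J = (\<integral>\<^sup>+x. s x \<partial>\<pi>)" .
    also have "\<dots> \<le> ?I + 0" using nn_integral_mono_AE[OF le] by simp
    finally have "?I + ?J \<le> ?I + 0" .
    moreover have "?I \<noteq> \<infinity>" using sum fin by (metis ennreal_add_eq_top infinity_ennreal_def)
    ultimately have "?J = 0" by (subst (asm) ennreal_add_left_cancel_le) auto
    then have "AE z in joint n. z \<notin> sing \<longrightarrow> s (snd z) = 0"
      by (subst (asm) nn_integral_0_iff_AE) (auto elim!: AE_mono_space split: split_indicator_asm)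
    then show ?thesis by (subst (asm) AE_joint) auto
  qed
  then have "AE x in \<pi>. \<forall>n. AE y in nst n x. (x, y) \<notin> sing \<longrightarrow> s y = 0"
    by (subst AE_all_countable) auto
  then have "AE x in \<pi>. (\<forall>n. AE y in nst n x. (x, y) \<notin> sing \<longrightarrow> s y = 0) \<and> (AE y in \<pi>. (x, y) \<notin> sing)"
    using AE_section_sing by (rule AE_conjI)
  \<comment> \<open>One point suffices, chosen so that the statement holds for all \<open>n\<close>
    and its section of \<open>sing\<close> is null.\<close>
  then obtain x where x[measurable]: "x \<in> space S" and *: "\<And>n. AE y in nst n x. (x, y) \<notin> sing \<longrightarrow> s y = 0"
    and **: "AE y in \<pi>. (x, y) \<notin> sing"
    by (rule pi.AE_obtain) (auto simp: space_pi)
  have "AE y in \<pi>. (x, y) \<notin> sing \<longrightarrow> s y = 0"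
    by (rule AE_pi_of_AE_nstep[OF x _ *]) measurable
  with ** show ?thesis by eventually_elim (simp add: s_def)
qed

text \<open>The integral of \<open>sing_mass n\<close> is the mass of \<open>sing\<close> under
  \<open>joint n\<close>. The result selects the time \<open>n\<close> at which the transition
  operator is nearly an integral operator.\<close>

lemma emeasure_joint_sing_small:
  assumes "e > 0"
  shows "\<exists>n. emeasure (joint n) sing < e"
proof -
  have "(\<integral>\<^sup>+x. sing_mass 0 x \<partial>\<pi>) \<le> (\<integral>\<^sup>+x. 1 \<partial>\<pi>)"
    by (intro nn_integral_mono sing_mass_le_1) (simp add: space_pi)
  then have fin: "(\<integral>\<^sup>+x. sing_mass 0 x \<partial>\<pi>) < \<infinity>" by (rule le_less_trans) (simp add: pi.emeasure_space_1)
  have "(INF n. \<integral>\<^sup>+x. sing_mass n x \<partial>\<pi>) = (\<integral>\<^sup>+x. (INF n. sing_mass n x) \<partial>\<pi>)"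
  proof (rule nn_integral_monotone_convergence_INF_AE[where i=0, symmetric])
    show "AE x in \<pi>. sing_mass (Suc i) x \<le> sing_mass i x" for i
      using AE_sing_mass_decreasing by (rule AE_mono_space) auto
  qed (use fin in measurable)
  also have "\<dots> = (\<integral>\<^sup>+x. 0 \<partial>\<pi>)" by (rule nn_integral_cong_AE[OF AE_INF_sing_mass])
  finally have "(INF n. \<integral>\<^sup>+x. sing_mass n x \<partial>\<pi>) < e" using assms by simp
  moreover have "(\<integral>\<^sup>+x. sing_mass n x \<partial>\<pi>) = emeasure (joint n) sing" for n
  proof -
    have "emeasure (joint n) sing = (\<integral>\<^sup>+z. indicator sing z \<partial>joint n)" by simp
    then show ?thesis unfolding sing_mass_def by (subst (asm) nn_integral_joint) auto
  qed
  ultimately show ?thesis by (auto simp: INF_less_iff)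
qed

end

section \<open>Compactness of the iterated operators\<close>

context stationary_irreducible_chain
begin

section \<open>The transition operator on bounded functions, in the L1 norm\<close>

definition bfun :: "('a \<Rightarrow> real) set" where
  "bfun = {f \<in> borel_measurable S. \<exists>c. \<forall>x\<in>space S. \<bar>f x\<bar> \<le> c}"

definition unit_ball :: "('a \<Rightarrow> real) set" where
  "unit_ball = {f \<in> borel_measurable S. \<forall>x\<in>space S. \<bar>f x\<bar> \<le> 1}"

definition iter :: "nat \<Rightarrow> ('a \<Rightarrow> real) \<Rightarrow> 'a \<Rightarrow> real" where
  "iter n f x = (\<integral>y. f y \<partial>nst n x)"

definition dist1 :: "('a \<Rightarrow> real) \<Rightarrow> ('a \<Rightarrow> real) \<Rightarrow> real" where
  "dist1 f g = (\<integral>x. \<bar>f x - g x\<bar> \<partial>\<pi>)"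

lemma unit_ball_bfun: "f \<in> unit_ball \<Longrightarrow> f \<in> bfun"
  by (auto simp: unit_ball_def bfun_def)

lemma bfun_measurable[measurable_dest]: "f \<in> bfun \<Longrightarrow> f \<in> borel_measurable S"
  by (simp add: bfun_def)

lemma unit_ball_measurable[measurable_dest]: "f \<in> unit_ball \<Longrightarrow> f \<in> borel_measurable S"
  by (simp add: unit_ball_def)

lemma bfunE: 
  assumes "f \<in> bfun" obtains c where "c \<ge> 0" "\<And>x. x \<in> space S \<Longrightarrow> \<bar>f x\<bar> \<le> c"
proof -
  obtain c where "\<forall>x\<in>space S. \<bar>f x\<bar> \<le> c" using assms by (auto simp: bfun_def)
  then show thesis by (intro that[of "max 0 c"]) (auto simp: max_def)
qed

lemma bfunI: "f \<in> borel_measurable S \<Longrightarrow> (\<And>x. x \<in> space S \<Longrightarrow> \<bar>f x\<bar> \<le> c) \<Longrightarrow> f \<in> bfun"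
  by (auto simp: bfun_def)

lemma bfun_const: "(\<lambda>_. c) \<in> bfun" by (rule bfunI[where c="\<bar>c\<bar>"]) auto

lemma bfun_add: assumes "f \<in> bfun" "g \<in> bfun" shows "(\<lambda>x. f x + g x) \<in> bfun"
proof -
  obtain c d where "\<And>x. x \<in> space S \<Longrightarrow> \<bar>f x\<bar> \<le> c" "\<And>x. x \<in> space S \<Longrightarrow> \<bar>g x\<bar> \<le> d"
    by (rule bfunE[OF assms(1)], rule bfunE[OF assms(2)]) auto
  then have "\<bar>f x + g x\<bar> \<le> c + d" if "x \<in> space S" for x
    using that by (smt (verit))
  then show ?thesis using assms by (intro bfunI[where c="c+d"]) (auto dest: bfun_measurable)
qed

lemma bfun_mult: assumes "f \<in> bfun" "g \<in> bfun" shows "(\<lambda>x. f x * g x) \<in> bfun"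
proof -
  obtain c d where "c \<ge> 0" "\<And>x. x \<in> space S \<Longrightarrow> \<bar>f x\<bar> \<le> c" "\<And>x. x \<in> space S \<Longrightarrow> \<bar>g x\<bar> \<le> d"
    by (rule bfunE[OF assms(1)], rule bfunE[OF assms(2)]) auto
  then have "\<bar>f x * g x\<bar> \<le> c * d" if "x \<in> space S" for x
    unfolding abs_mult using that by (intro mult_mono) auto
  then show ?thesis using assms by (intro bfunI[where c="c*d"]) (auto dest: bfun_measurable)
qed

lemma bfun_uminus: "f \<in> bfun \<Longrightarrow> (\<lambda>x. - f x) \<in> bfun"
  using bfun_mult[OF bfun_const[of "-1"], of f] by simp

lemma bfun_diff: "f \<in> bfun \<Longrightarrow> g \<in> bfun \<Longrightarrow> (\<lambda>x. f x - g x) \<in> bfun"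
  using bfun_add[OF _ bfun_uminus, of f g] by simp

lemma bfun_abs: "f \<in> bfun \<Longrightarrow> (\<lambda>x. \<bar>f x\<bar>) \<in> bfun"
  by (auto simp: bfun_def)

lemma bfun_power2: "f \<in> bfun \<Longrightarrow> (\<lambda>x. (f x)\<^sup>2) \<in> bfun"
  using bfun_mult[of f f] by (simp add: power2_eq_square)

lemma bfun_sum: "(\<And>i. i \<in> I \<Longrightarrow> f i \<in> bfun) \<Longrightarrow> (\<lambda>x. \<Sum>i\<in>I. f i x) \<in> bfun"
  by (induction I rule: infinite_finite_induct) (auto intro: bfun_const bfun_add)

lemmas bfun_intros = bfun_const bfun_add bfun_mult bfun_uminus bfun_diff bfun_abs bfun_power2 bfun_sum

lemma integrable_pi:
  assumes f: "f \<in> bfun" shows "integrable \<pi> f"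
proof -
  note [measurable] = bfun_measurable[OF f]
  obtain c where "\<And>x. x \<in> space S \<Longrightarrow> \<bar>f x\<bar> \<le> c" by (rule bfunE[OF f]) auto
  then show ?thesis
    by (intro pi.integrable_const_bound[where B=c] AE_I2) (simp add: space_pi, measurable)
qed

lemma integrable_nst:
  assumes f: "f \<in> bfun" and x: "x \<in> space S" shows "integrable (nst n x) f"
proof -
  interpret prob_space "nst n x" by (rule prob_space_nstep[OF x])
  note [measurable_cong] = sets_nstep[OF x]
  note [measurable] = bfun_measurable[OF f]
  obtain c where "\<And>x. x \<in> space S \<Longrightarrow> \<bar>f x\<bar> \<le> c" by (rule bfunE[OF f]) auto
  then show ?thesis
    by (intro integrable_const_bound[where B=c] AE_I2) (simp add: space_nstep[OF x], measurable)
qed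

lemma iter_measurable: "f \<in> borel_measurable S \<Longrightarrow> iter n f \<in> borel_measurable S"
  unfolding iter_def[abs_def]
  by (rule measurable_compose[OF nstep_measurable integral_measurable_subprob_algebra])

lemma iter_le:
  assumes f: "f \<in> bfun" and x: "x \<in> space S" and c: "\<And>y. y \<in> space S \<Longrightarrow> \<bar>f y\<bar> \<le> c"
  shows "\<bar>iter n f x\<bar> \<le> c"
proof -
  interpret prob_space "nst n x" by (rule prob_space_nstep[OF x])
  have "\<bar>iter n f x\<bar> \<le> (\<integral>y. \<bar>f y\<bar> \<partial>nst n x)"
    unfolding iter_def by (rule integral_abs_bound)
  also have "\<dots> \<le> (\<integral>y. c \<partial>nst n x)"
    using c by (intro integral_mono integrable_nst x bfun_intros f) (auto simp: space_nstep[OF x])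
  finally show ?thesis by (simp add: prob_space)
qed

lemma iter_bfun: assumes f: "f \<in> bfun" shows "iter n f \<in> bfun"
proof -
  obtain c where c: "\<And>x. x \<in> space S \<Longrightarrow> \<bar>f x\<bar> \<le> c" by (rule bfunE[OF f]) auto
  show ?thesis
    by (rule bfunI[where c=c]) (use iter_le[OF f _ c] f in \<open>auto intro: iter_measurable dest: bfun_measurable\<close>)
qed

lemma iter_unit_ball: "f \<in> unit_ball \<Longrightarrow> iter n f \<in> unit_ball"
  using iter_le[OF unit_ball_bfun, of f _ 1] by (auto simp: unit_ball_def iter_measurable)

lemma iter_comp:
  assumes f: "f \<in> bfun" and x: "x \<in> space S"
  shows "iter (m + n) f x = iter m (iter n f) x"
proof -
  obtain c where c: "\<And>x. x \<in> space S \<Longrightarrow> \<bar>f x\<bar> \<le> c" by (rule bfunE[OF f]) auto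
  interpret prob_space "nst m x" by (rule prob_space_nstep[OF x])
  show ?thesis
    unfolding iter_def nstep_add[OF x]
  proof (rule integral_bind[where K=S and B=c and B'=1])
    show "nst n \<in> nst m x \<rightarrow>\<^sub>M subprob_algebra S"
      unfolding measurable_cong_sets[OF sets_nstep[OF x] refl] by (rule nstep_measurable)
    show "AE y in nst m x. emeasure (nst n y) (space (nst n y)) \<le> ennreal 1"
      using prob_space.emeasure_space_1[OF prob_space_nstep] by (intro AE_I2) (simp add: space_nstep[OF x])
  qed (use c bfun_measurable[OF f] finite_measure_axioms in auto)
qed

lemma integral_iter:
  assumes f: "f \<in> bfun" shows "(\<integral>x. iter n f x \<partial>\<pi>) = (\<integral>x. f x \<partial>\<pi>)"
proof -
  obtain c where c: "\<And>x. x \<in> space S \<Longrightarrow> \<bar>f x\<bar> \<le> c" by (rule bfunE[OF f]) auto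
  have "(\<integral>x. f x \<partial>(\<pi> \<bind> nst n)) = (\<integral>x. iter n f x \<partial>\<pi>)"
    unfolding iter_def
  proof (rule integral_bind[where K=S and B=c and B'=1])
    show "nst n \<in> \<pi> \<rightarrow>\<^sub>M subprob_algebra S"
      unfolding measurable_cong_sets[OF sets_pi refl] by (rule nstep_measurable)
    show "AE y in \<pi>. emeasure (nst n y) (space (nst n y)) \<le> ennreal 1"
      using prob_space.emeasure_space_1[OF prob_space_nstep] by (intro AE_I2) (simp add: space_pi)
  qed (use c bfun_measurable[OF f] pi.finite_measure_axioms in auto)
  then show ?thesis by (simp only: pi_bind_nstep)
qed

lemma iter_diff:
  "f \<in> bfun \<Longrightarrow> g \<in> bfun \<Longrightarrow> x \<in> space S \<Longrightarrow> iter n (\<lambda>x. f x - g x) x = iter n f x - iter n g x"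
  unfolding iter_def by (intro Bochner_Integration.integral_diff integrable_nst)

lemma iter_const: "x \<in> space S \<Longrightarrow> iter n (\<lambda>_. c) x = c"
  using prob_space.prob_space[OF prob_space_nstep, of x n] by (simp add: iter_def)

lemma iter_sum:
  "(\<And>i. i \<in> I \<Longrightarrow> f i \<in> bfun) \<Longrightarrow> x \<in> space S \<Longrightarrow> iter n (\<lambda>x. \<Sum>i\<in>I. f i x) x = (\<Sum>i\<in>I. iter n (f i) x)"
  unfolding iter_def by (intro Bochner_Integration.integral_sum integrable_nst)

lemma iter_cmult: "iter n (\<lambda>x. c * f x) x = c * iter n f x"
  by (simp add: iter_def)

text \<open>The absolute value of an average is at most the average of the absolute value, and
  stationarity preserves the integral of the latter.\<close>

lemma dist1_iter:
  assumes f: "f \<in> bfun" and g: "g \<in> bfun"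
  shows "dist1 (iter n f) (iter n g) \<le> dist1 f g"
proof -
  have "dist1 (iter n f) (iter n g) \<le> (\<integral>x. iter n (\<lambda>x. \<bar>f x - g x\<bar>) x \<partial>\<pi>)"
    unfolding dist1_def
  proof (rule integral_mono)
    fix x assume "x \<in> space \<pi>"
    then have x: "x \<in> space S" by (simp add: space_pi)
    show "\<bar>iter n f x - iter n g x\<bar> \<le> iter n (\<lambda>x. \<bar>f x - g x\<bar>) x"
      unfolding iter_diff[OF f g x, symmetric] by (simp add: iter_def)
  qed (intro integrable_pi bfun_intros iter_bfun f g)+
  also have "\<dots> = dist1 f g"
    unfolding dist1_def by (intro integral_iter bfun_intros f g)
  finally show ?thesis .
qed

lemma dist1_triangle:
  assumes "f \<in> bfun" "g \<in> bfun" "h \<in> bfun"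
  shows "dist1 f h \<le> dist1 f g + dist1 g h"
proof -
  have "dist1 f h \<le> (\<integral>x. \<bar>f x - g x\<bar> + \<bar>g x - h x\<bar> \<partial>\<pi>)"
    unfolding dist1_def by (intro integral_mono integrable_pi bfun_intros assms) auto
  also have "\<dots> = dist1 f g + dist1 g h"
    unfolding dist1_def by (intro Bochner_Integration.integral_add integrable_pi bfun_intros assms)
  finally show ?thesis .
qed

lemma dist1_commute: "dist1 f g = dist1 g f"
  by (simp add: dist1_def abs_minus_commute)

lemma integral_diff_le_dist1:
  assumes "f \<in> bfun" "g \<in> bfun"
  shows "\<bar>(\<integral>x. f x \<partial>\<pi>) - (\<integral>x. g x \<partial>\<pi>)\<bar> \<le> dist1 f g"
proof -
  have "(\<integral>x. f x - g x \<partial>\<pi>) = (\<integral>x. f x \<partial>\<pi>) - (\<integral>x. g x \<partial>\<pi>)"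
    by (rule Bochner_Integration.integral_diff; rule integrable_pi; fact)
  then show ?thesis
    using integral_abs_bound[of \<pi> "\<lambda>x. f x - g x"] unfolding dist1_def by argo
qed

section \<open>Integral operators with an L1 kernel\<close>

definition pairing :: "('a \<times> 'a \<Rightarrow> real) \<Rightarrow> ('a \<Rightarrow> real) \<Rightarrow> ('a \<Rightarrow> real) \<Rightarrow> real" where
  "pairing \<phi> \<sigma> f = (\<integral>z. \<sigma> (fst z) * f (snd z) * \<phi> z \<partial>(\<pi> \<Otimes>\<^sub>M \<pi>))"

text \<open>
  Total boundedness of the image of the unit ball under the integral operator with kernel \<open>\<phi>\<close>.
  Testing against \<open>\<sigma>\<close> instead of taking an L1 norm keeps every expression linear in \<open>\<phi>\<close>.
\<close>

definition compact_kernel :: "('a \<times> 'a \<Rightarrow> real) \<Rightarrow> bool" where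
  "compact_kernel \<phi> \<longleftrightarrow> (\<forall>e>0. \<exists>\<Phi>. finite \<Phi> \<and> \<Phi> \<subseteq> bfun \<and>
    (\<forall>f\<in>unit_ball. \<exists>h\<in>\<Phi>. \<forall>\<sigma>\<in>unit_ball. \<bar>pairing \<phi> \<sigma> f - (\<integral>x. \<sigma> x * h x \<partial>\<pi>)\<bar> \<le> e))"

lemma compact_kernelE:
  assumes "compact_kernel \<phi>" "e > 0"
  obtains \<Phi> where "finite \<Phi>" "\<Phi> \<subseteq> bfun"
    "\<forall>f\<in>unit_ball. \<exists>h\<in>\<Phi>. \<forall>\<sigma>\<in>unit_ball. \<bar>pairing \<phi> \<sigma> f - (\<integral>x. \<sigma> x * h x \<partial>\<pi>)\<bar> \<le> e"
  using assms unfolding compact_kernel_def by meson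

lemma compact_kernelI:
  assumes "\<And>e. e > 0 \<Longrightarrow> \<exists>\<Phi>. finite \<Phi> \<and> \<Phi> \<subseteq> bfun \<and>
    (\<forall>f\<in>unit_ball. \<exists>h\<in>\<Phi>. \<forall>\<sigma>\<in>unit_ball. \<bar>pairing \<phi> \<sigma> f - (\<integral>x. \<sigma> x * h x \<partial>\<pi>)\<bar> \<le> e)"
  shows "compact_kernel \<phi>"
  using assms unfolding compact_kernel_def by blast

lemma abs_test_le:
  assumes "\<sigma> \<in> unit_ball" "f \<in> unit_ball" "z \<in> space S \<times> space S"
  shows "\<bar>\<sigma> (fst z) * f (snd z) * t\<bar> \<le> \<bar>t\<bar>"
proof -
  have "\<bar>\<sigma> (fst z)\<bar> * \<bar>f (snd z)\<bar> \<le> 1 * 1"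
    using assms by (intro mult_mono) (auto simp: unit_ball_def)
  then have "\<bar>\<sigma> (fst z)\<bar> * \<bar>f (snd z)\<bar> * \<bar>t\<bar> \<le> 1 * \<bar>t\<bar>"
    by (intro mult_right_mono) auto
  then show ?thesis by (simp add: abs_mult)
qed

lemma integrable_test:
  assumes \<sigma>: "\<sigma> \<in> unit_ball" and f: "f \<in> unit_ball" and \<phi>: "integrable (\<pi> \<Otimes>\<^sub>M \<pi>) \<phi>"
  shows "integrable (\<pi> \<Otimes>\<^sub>M \<pi>) (\<lambda>z. \<sigma> (fst z) * f (snd z) * \<phi> z)"
proof (rule Bochner_Integration.integrable_bound[OF \<phi>])
  show "(\<lambda>z. \<sigma> (fst z) * f (snd z) * \<phi> z) \<in> borel_measurable (\<pi> \<Otimes>\<^sub>M \<pi>)"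
  proof -
    note [measurable] = unit_ball_measurable[OF \<sigma>] unit_ball_measurable[OF f] borel_measurable_integrable[OF \<phi>]
    show ?thesis by measurable
  qed
  show "AE z in \<pi> \<Otimes>\<^sub>M \<pi>. norm (\<sigma> (fst z) * f (snd z) * \<phi> z) \<le> norm (\<phi> z)"
    unfolding real_norm_def
    by (intro AE_I2 abs_test_le[OF \<sigma> f]) (simp add: space_pair_measure space_pi)
qed

lemma pairing_le:
  assumes \<sigma>: "\<sigma> \<in> unit_ball" and f: "f \<in> unit_ball" and \<phi>: "integrable (\<pi> \<Otimes>\<^sub>M \<pi>) \<phi>"
  shows "\<bar>pairing \<phi> \<sigma> f\<bar> \<le> (\<integral>z. \<bar>\<phi> z\<bar> \<partial>(\<pi> \<Otimes>\<^sub>M \<pi>))"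
proof -
  have "\<bar>pairing \<phi> \<sigma> f\<bar> \<le> (\<integral>z. \<bar>\<sigma> (fst z) * f (snd z) * \<phi> z\<bar> \<partial>(\<pi> \<Otimes>\<^sub>M \<pi>))"
    unfolding pairing_def by (rule integral_abs_bound)
  also have "\<dots> \<le> (\<integral>z. \<bar>\<phi> z\<bar> \<partial>(\<pi> \<Otimes>\<^sub>M \<pi>))"
    by (intro integral_mono integrable_abs integrable_test[OF \<sigma> f] \<phi> abs_test_le[OF \<sigma> f])
       (simp add: space_pair_measure space_pi)
  finally show ?thesis .
qed

lemma pairing_add:
  assumes "\<sigma> \<in> unit_ball" "f \<in> unit_ball" "integrable (\<pi> \<Otimes>\<^sub>M \<pi>) \<phi>" "integrable (\<pi> \<Otimes>\<^sub>M \<pi>) \<psi>"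
  shows "pairing (\<lambda>z. \<phi> z + \<psi> z) \<sigma> f = pairing \<phi> \<sigma> f + pairing \<psi> \<sigma> f"
  unfolding pairing_def distrib_left
  by (intro Bochner_Integration.integral_add integrable_test assms)

lemma pairing_cmult: "pairing (\<lambda>z. c * \<phi> z) \<sigma> f = c * pairing \<phi> \<sigma> f"
  unfolding pairing_def mult.left_commute[of _ c] by (rule integral_mult_right_zero)

lemma pairing_diff:
  assumes "\<sigma> \<in> unit_ball" "f \<in> unit_ball" "integrable (\<pi> \<Otimes>\<^sub>M \<pi>) \<phi>" "integrable (\<pi> \<Otimes>\<^sub>M \<pi>) \<psi>"
  shows "pairing (\<lambda>z. \<phi> z - \<psi> z) \<sigma> f = pairing \<phi> \<sigma> f - pairing \<psi> \<sigma> f"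
  unfolding pairing_def right_diff_distrib
  by (intro Bochner_Integration.integral_diff integrable_test assms)

lemma compact_kernel_add:
  assumes "compact_kernel \<phi>" "compact_kernel \<psi>" and int: "integrable (\<pi> \<Otimes>\<^sub>M \<pi>) \<phi>" "integrable (\<pi> \<Otimes>\<^sub>M \<pi>) \<psi>"
  shows "compact_kernel (\<lambda>z. \<phi> z + \<psi> z)"
proof (rule compact_kernelI)
  fix e :: real assume "e > 0"
  then have e2: "e / 2 > 0" by simp
  obtain \<Phi> where \<Phi>: "finite \<Phi>" "\<Phi> \<subseteq> bfun"
    "\<forall>f\<in>unit_ball. \<exists>h\<in>\<Phi>. \<forall>\<sigma>\<in>unit_ball. \<bar>pairing \<phi> \<sigma> f - (\<integral>x. \<sigma> x * h x \<partial>\<pi>)\<bar> \<le> e / 2"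
    by (rule compact_kernelE[OF assms(1) e2])
  obtain \<Psi> where \<Psi>: "finite \<Psi>" "\<Psi> \<subseteq> bfun"
    "\<forall>f\<in>unit_ball. \<exists>h\<in>\<Psi>. \<forall>\<sigma>\<in>unit_ball. \<bar>pairing \<psi> \<sigma> f - (\<integral>x. \<sigma> x * h x \<partial>\<pi>)\<bar> \<le> e / 2"
    by (rule compact_kernelE[OF assms(2) e2])
  let ?\<Theta> = "(\<lambda>(h, k) x. h x + k x) ` (\<Phi> \<times> \<Psi>)"
  show "\<exists>\<Theta>. finite \<Theta> \<and> \<Theta> \<subseteq> bfun \<and> (\<forall>f\<in>unit_ball. \<exists>h\<in>\<Theta>. \<forall>\<sigma>\<in>unit_ball.
    \<bar>pairing (\<lambda>z. \<phi> z + \<psi> z) \<sigma> f - (\<integral>x. \<sigma> x * h x \<partial>\<pi>)\<bar> \<le> e)"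
  proof (intro exI[of _ ?\<Theta>] conjI ballI)
    show "finite ?\<Theta>" using \<Phi>(1) \<Psi>(1) by auto
    show "?\<Theta> \<subseteq> bfun" using \<Phi>(2) \<Psi>(2) by (auto intro!: bfun_add)
    fix f assume f: "f \<in> unit_ball"
    obtain h where h: "h \<in> \<Phi>" and h': "\<forall>\<sigma>\<in>unit_ball. \<bar>pairing \<phi> \<sigma> f - (\<integral>x. \<sigma> x * h x \<partial>\<pi>)\<bar> \<le> e / 2"
      using bspec[OF \<Phi>(3) f] by (elim bexE)
    obtain k where k: "k \<in> \<Psi>" and k': "\<forall>\<sigma>\<in>unit_ball. \<bar>pairing \<psi> \<sigma> f - (\<integral>x. \<sigma> x * k x \<partial>\<pi>)\<bar> \<le> e / 2"
      using bspec[OF \<Psi>(3) f] by (elim bexE)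
    show "\<exists>h\<in>?\<Theta>. \<forall>\<sigma>\<in>unit_ball. \<bar>pairing (\<lambda>z. \<phi> z + \<psi> z) \<sigma> f - (\<integral>x. \<sigma> x * h x \<partial>\<pi>)\<bar> \<le> e"
    proof (intro bexI[of _ "\<lambda>x. h x + k x"] ballI)
      show "(\<lambda>x. h x + k x) \<in> ?\<Theta>" using h k by (auto intro!: rev_image_eqI[of "(h, k)"])
      fix \<sigma> assume \<sigma>: "\<sigma> \<in> unit_ball"
      have hk: "h \<in> bfun" "k \<in> bfun" using h k \<Phi>(2) \<Psi>(2) by blast+
      have 1: "(\<integral>x. \<sigma> x * (h x + k x) \<partial>\<pi>) = (\<integral>x. \<sigma> x * h x \<partial>\<pi>) + (\<integral>x. \<sigma> x * k x \<partial>\<pi>)"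
        unfolding distrib_left
        by (intro Bochner_Integration.integral_add integrable_pi bfun_mult hk unit_ball_bfun \<sigma>)
      show "\<bar>pairing (\<lambda>z. \<phi> z + \<psi> z) \<sigma> f - (\<integral>x. \<sigma> x * (h x + k x) \<partial>\<pi>)\<bar> \<le> e"
        using bspec[OF h' \<sigma>] bspec[OF k' \<sigma>] unfolding 1 pairing_add[OF \<sigma> f int] by argo
    qed
  qed
qed

lemma compact_kernel_cmult:
  assumes "compact_kernel \<phi>"
  shows "compact_kernel (\<lambda>z. c * \<phi> z)"
proof (rule compact_kernelI)
  fix e :: real assume e: "e > 0"
  \<comment> \<open>The added 1 keeps the denominator positive for \<open>c = 0\<close>.\<close>
  then have e2: "e / (\<bar>c\<bar> + 1) > 0" by (intro divide_pos_pos) auto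
  obtain \<Phi> where \<Phi>: "finite \<Phi>" "\<Phi> \<subseteq> bfun"
    "\<forall>f\<in>unit_ball. \<exists>h\<in>\<Phi>. \<forall>\<sigma>\<in>unit_ball. \<bar>pairing \<phi> \<sigma> f - (\<integral>x. \<sigma> x * h x \<partial>\<pi>)\<bar> \<le> e / (\<bar>c\<bar> + 1)"
    by (rule compact_kernelE[OF assms(1) e2])
  let ?\<Theta> = "(\<lambda>h x. c * h x) ` \<Phi>"
  show "\<exists>\<Theta>. finite \<Theta> \<and> \<Theta> \<subseteq> bfun \<and> (\<forall>f\<in>unit_ball. \<exists>h\<in>\<Theta>. \<forall>\<sigma>\<in>unit_ball.
    \<bar>pairing (\<lambda>z. c * \<phi> z) \<sigma> f - (\<integral>x. \<sigma> x * h x \<partial>\<pi>)\<bar> \<le> e)"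
  proof (intro exI[of _ ?\<Theta>] conjI ballI)
    show "finite ?\<Theta>" using \<Phi>(1) by auto
    show "?\<Theta> \<subseteq> bfun" using \<Phi>(2) by (auto intro!: bfun_mult bfun_const)
    fix f assume f: "f \<in> unit_ball"
    obtain h where h: "h \<in> \<Phi>" and h': "\<forall>\<sigma>\<in>unit_ball. \<bar>pairing \<phi> \<sigma> f - (\<integral>x. \<sigma> x * h x \<partial>\<pi>)\<bar> \<le> e / (\<bar>c\<bar> + 1)"
      using bspec[OF \<Phi>(3) f] by (elim bexE)
    show "\<exists>h\<in>?\<Theta>. \<forall>\<sigma>\<in>unit_ball. \<bar>pairing (\<lambda>z. c * \<phi> z) \<sigma> f - (\<integral>x. \<sigma> x * h x \<partial>\<pi>)\<bar> \<le> e"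
    proof (intro bexI[of _ "\<lambda>x. c * h x"] ballI)
      show "(\<lambda>x. c * h x) \<in> ?\<Theta>" using h by auto
      fix \<sigma> assume \<sigma>: "\<sigma> \<in> unit_ball"
      let ?d = "pairing \<phi> \<sigma> f - (\<integral>x. \<sigma> x * h x \<partial>\<pi>)"
      have 1: "(\<integral>x. \<sigma> x * (c * h x) \<partial>\<pi>) = c * (\<integral>x. \<sigma> x * h x \<partial>\<pi>)"
        unfolding mult.left_commute[of _ c] by (rule integral_mult_right_zero)
      have "\<bar>pairing (\<lambda>z. c * \<phi> z) \<sigma> f - (\<integral>x. \<sigma> x * (c * h x) \<partial>\<pi>)\<bar> = \<bar>c\<bar> * \<bar>?d\<bar>"
        unfolding 1 pairing_cmult right_diff_distrib[symmetric] by (rule abs_mult)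
      also have "\<dots> \<le> \<bar>c\<bar> * (e / (\<bar>c\<bar> + 1))"
        using bspec[OF h' \<sigma>] by (intro mult_left_mono) auto
      also have "\<dots> \<le> e"
        using e by (simp add: field_simps)
      finally show "\<bar>pairing (\<lambda>z. c * \<phi> z) \<sigma> f - (\<integral>x. \<sigma> x * (c * h x) \<partial>\<pi>)\<bar> \<le> e" .
    qed
  qed
qed

text \<open>\<open>pairing_le\<close> bounds the change of the pairing by the L1 distance of the
  kernels, uniformly in \<open>\<sigma>\<close> and \<open>f\<close>, so a net for a nearby kernel
  is a net for \<open>\<phi>\<close> at the cost of \<open>e / 2\<close>.\<close>

lemma compact_kernel_limit:
  assumes \<phi>: "integrable (\<pi> \<Otimes>\<^sub>M \<pi>) \<phi>"
    and approx: "\<And>e. e > 0 \<Longrightarrow> \<exists>\<psi>. integrable (\<pi> \<Otimes>\<^sub>M \<pi>) \<psi> \<and> compact_kernel \<psi> \<and> (\<integral>z. \<bar>\<phi> z - \<psi> z\<bar> \<partial>(\<pi> \<Otimes>\<^sub>M \<pi>)) \<le> e"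
  shows "compact_kernel \<phi>"
proof (rule compact_kernelI)
  fix e :: real assume "e > 0"
  then have e2: "e / 2 > 0" by simp
  obtain \<psi> where \<psi>: "integrable (\<pi> \<Otimes>\<^sub>M \<pi>) \<psi>" "compact_kernel \<psi>" "(\<integral>z. \<bar>\<phi> z - \<psi> z\<bar> \<partial>(\<pi> \<Otimes>\<^sub>M \<pi>)) \<le> e / 2"
    using approx[OF e2] by blast
  obtain \<Phi> where \<Phi>: "finite \<Phi>" "\<Phi> \<subseteq> bfun"
    "\<forall>f\<in>unit_ball. \<exists>h\<in>\<Phi>. \<forall>\<sigma>\<in>unit_ball. \<bar>pairing \<psi> \<sigma> f - (\<integral>x. \<sigma> x * h x \<partial>\<pi>)\<bar> \<le> e / 2"
    by (rule compact_kernelE[OF \<psi>(2) e2])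
  show "\<exists>\<Theta>. finite \<Theta> \<and> \<Theta> \<subseteq> bfun \<and> (\<forall>f\<in>unit_ball. \<exists>h\<in>\<Theta>. \<forall>\<sigma>\<in>unit_ball.
    \<bar>pairing \<phi> \<sigma> f - (\<integral>x. \<sigma> x * h x \<partial>\<pi>)\<bar> \<le> e)"
  proof (intro exI[of _ \<Phi>] conjI ballI \<Phi>(1,2))
    fix f assume f: "f \<in> unit_ball"
    obtain h where h: "h \<in> \<Phi>" and h': "\<forall>\<sigma>\<in>unit_ball. \<bar>pairing \<psi> \<sigma> f - (\<integral>x. \<sigma> x * h x \<partial>\<pi>)\<bar> \<le> e / 2"
      using bspec[OF \<Phi>(3) f] by (elim bexE)
    show "\<exists>h\<in>\<Phi>. \<forall>\<sigma>\<in>unit_ball. \<bar>pairing \<phi> \<sigma> f - (\<integral>x. \<sigma> x * h x \<partial>\<pi>)\<bar> \<le> e"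
    proof (intro bexI[OF _ h] ballI)
      fix \<sigma> assume \<sigma>: "\<sigma> \<in> unit_ball"
      have "\<bar>pairing \<phi> \<sigma> f - pairing \<psi> \<sigma> f\<bar> \<le> e / 2"
        using pairing_le[OF \<sigma> f Bochner_Integration.integrable_diff[OF \<phi> \<psi>(1)]] \<psi>(3)
        unfolding pairing_diff[OF \<sigma> f \<phi> \<psi>(1)] by (rule order_trans)
      then show "\<bar>pairing \<phi> \<sigma> f - (\<integral>x. \<sigma> x * h x \<partial>\<pi>)\<bar> \<le> e"
        using bspec[OF h' \<sigma>] by argo
    qed
  qed
qed

lemma compact_kernel_cong:
  assumes "\<And>z. z \<in> space S \<times> space S \<Longrightarrow> \<phi> z = \<psi> z"
  shows "compact_kernel \<phi> \<longleftrightarrow> compact_kernel \<psi>"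
proof -
  have "pairing \<phi> = pairing \<psi>"
    unfolding pairing_def using assms
    by (intro ext Bochner_Integration.integral_cong) (auto simp: space_pair_measure space_pi)
  then show ?thesis unfolding compact_kernel_def by (simp only:)
qed

lemma integral_indicator_le_1:
  assumes f: "f \<in> unit_ball" and [measurable]: "A \<in> sets S"
  shows "\<bar>\<integral>y. f y * indicator A y \<partial>\<pi>\<bar> \<le> 1"
proof -
  note [measurable] = unit_ball_measurable[OF f]
  have b: "\<bar>f y * indicator A y\<bar> \<le> 1" if "y \<in> space S" for y
    using f that by (auto simp: unit_ball_def indicator_def)
  have "\<bar>\<integral>y. f y * indicator A y \<partial>\<pi>\<bar> \<le> (\<integral>y. \<bar>f y * indicator A y\<bar> \<partial>\<pi>)"
    by (rule integral_abs_bound)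
  also have "\<dots> \<le> (\<integral>y. 1 \<partial>\<pi>)"
  proof (rule integral_mono)
    have "(\<lambda>y. f y * indicator A y) \<in> bfun" by (rule bfunI[where c=1]) (measurable, rule b)
    then show "integrable \<pi> (\<lambda>y. \<bar>f y * indicator A y\<bar>)" by (intro integrable_pi bfun_abs)
  qed (use b in \<open>auto simp only: space_pi pi.integrable_const\<close>)
  finally show ?thesis by (simp add: pi.prob_space)
qed

text \<open>The operator has rank one: it sends \<open>f\<close> to the integral of \<open>f\<close>
  over \<open>B\<close> times the indicator of \<open>A\<close>. This number lies in [-1, 1], where
  a finite grid approximates it.\<close>

lemma compact_kernel_rectangle:
  assumes [measurable]: "A \<in> sets S" "B \<in> sets S"
  shows "compact_kernel (indicator (A \<times> B))"
proof (rule compact_kernelI)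
  fix e :: real assume e: "e > 0"
  \<comment> \<open>The grid consists of the multiples of \<open>1 / c\<close> from -1 to 1. The
    ceiling makes its mesh at most \<open>e\<close>; the added 1 keeps \<open>c\<close>
    positive.\<close>
  define c where "c = nat \<lceil>1 / e\<rceil> + 1"
  have c: "c > 0" "1 / real c \<le> e"
  proof -
    show "c > 0" by (simp add: c_def)
    have "1 / e \<le> real c" unfolding c_def by linarith
    then show "1 / real c \<le> e" using e \<open>c > 0\<close> by (simp add: field_simps)
  qed
  let ?\<Theta> = "(\<lambda>(k::int) x. real_of_int k / real c * indicator A x) ` {- int c .. int c}"
  show "\<exists>\<Theta>. finite \<Theta> \<and> \<Theta> \<subseteq> bfun \<and> (\<forall>f\<in>unit_ball. \<exists>h\<in>\<Theta>. \<forall>\<sigma>\<in>unit_ball.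
    \<bar>pairing (indicator (A \<times> B)) \<sigma> f - (\<integral>x. \<sigma> x * h x \<partial>\<pi>)\<bar> \<le> e)"
  proof (intro exI[of _ ?\<Theta>] conjI ballI)
    have A: "indicator A \<in> bfun" by (rule bfunI[where c=1]) (auto simp: indicator_def)
    show "finite ?\<Theta>" by auto
    show "?\<Theta> \<subseteq> bfun" by (intro image_subsetI bfun_mult bfun_const A)
    fix f assume f: "f \<in> unit_ball"
    define t where "t = (\<integral>y. f y * indicator B y \<partial>\<pi>)"
    define k where "k = \<lfloor>t * real c\<rfloor>"
    have t: "\<bar>t\<bar> \<le> 1" unfolding t_def by (rule integral_indicator_le_1[OF f]) simp
    have "\<bar>t * real c\<bar> \<le> 1 * real c"
      unfolding abs_mult using t by (intro mult_mono) auto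
    then have tc: "- real c \<le> t * real c" "t * real c \<le> real c" by linarith+
    have k: "k \<in> {- int c .. int c}"
      using tc unfolding k_def by (auto simp: le_floor_iff floor_le_iff)
    have tk: "\<bar>t - real_of_int k / real c\<bar> \<le> e"
    proof -
      have "real_of_int k \<le> t * real c" "t * real c \<le> real_of_int k + 1" unfolding k_def by linarith+
      then have "real_of_int k / real c \<le> t" "t \<le> real_of_int k / real c + 1 / real c"
        using c by (simp_all add: field_simps)
      then show ?thesis using c(2) by linarith
    qed
    show "\<exists>h\<in>?\<Theta>. \<forall>\<sigma>\<in>unit_ball.
      \<bar>pairing (indicator (A \<times> B)) \<sigma> f - (\<integral>x. \<sigma> x * h x \<partial>\<pi>)\<bar> \<le> e"
    proof (intro bexI[of _ "\<lambda>x. real_of_int k / real c * indicator A x"] ballI)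
      show "(\<lambda>x. real_of_int k / real c * indicator A x) \<in> ?\<Theta>" using k by auto
      fix \<sigma> assume \<sigma>: "\<sigma> \<in> unit_ball"
      define u where "u = (\<integral>x. \<sigma> x * indicator A x \<partial>\<pi>)"
    have u: "\<bar>u\<bar> \<le> 1" unfolding u_def by (rule integral_indicator_le_1[OF \<sigma>]) simp
      have int: "integrable (\<pi> \<Otimes>\<^sub>M \<pi>) (\<lambda>z. \<sigma> (fst z) * f (snd z) * indicator (A \<times> B) z)"
        by (rule integrable_test[OF \<sigma> f]) (auto intro!: pp.integrable_const_bound[where B=1])
      have "pairing (indicator (A \<times> B)) \<sigma> f = (\<integral>x. (\<integral>y. \<sigma> (fst (x, y)) * f (snd (x, y)) * indicator (A \<times> B) (x, y) \<partial>\<pi>) \<partial>\<pi>)"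
        unfolding pairing_def by (rule pp.integral_fst'[OF int, symmetric])
      also have "\<dots> = (\<integral>x. \<sigma> x * indicator A x * t \<partial>\<pi>)"
      proof (intro Bochner_Integration.integral_cong refl)
        fix x
        have "(\<integral>y. \<sigma> (fst (x, y)) * f (snd (x, y)) * indicator (A \<times> B) (x, y) \<partial>\<pi>)
          = (\<integral>y. (\<sigma> x * indicator A x) * (f y * indicator B y) \<partial>\<pi>)"
          by (intro Bochner_Integration.integral_cong) (auto simp: indicator_def)
        then show "(\<integral>y. \<sigma> (fst (x, y)) * f (snd (x, y)) * indicator (A \<times> B) (x, y) \<partial>\<pi>) = \<sigma> x * indicator A x * t"
          by (simp add: t_def)
      qed
      also have "\<dots> = u * t" by (simp add: u_def)
      finally have 1: "pairing (indicator (A \<times> B)) \<sigma> f = u * t" .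
      have 2: "(\<integral>x. \<sigma> x * (real_of_int k / real c * indicator A x) \<partial>\<pi>) = u * (real_of_int k / real c)"
        unfolding u_def by (simp add: mult.left_commute mult.commute)
      have "\<bar>u * t - u * (real_of_int k / real c)\<bar> = \<bar>u\<bar> * \<bar>t - real_of_int k / real c\<bar>"
        by (simp only: abs_mult[symmetric] right_diff_distrib)
      also have "\<dots> \<le> 1 * e" using u tk by (intro mult_mono) auto
      finally show "\<bar>pairing (indicator (A \<times> B)) \<sigma> f
          - (\<integral>x. \<sigma> x * (real_of_int k / real c * indicator A x) \<partial>\<pi>)\<bar> \<le> e"
        unfolding 1 2 by simp
    qed
  qed
qed

lemma integrable_indicator_pair:
  "B \<in> sets (S \<Otimes>\<^sub>M S) \<Longrightarrow> integrable (\<pi> \<Otimes>\<^sub>M \<pi>) (indicator B :: _ \<Rightarrow> real)"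
  by (rule pp.integrable_const_bound[where B=1])
     (auto simp: measurable_cong_sets[OF sets_pi_pair refl])

text \<open>Rectangles are stable under intersection and generate the product sigma-algebra;
  complements follow by linearity and countable disjoint unions by L1 limits.\<close>

lemma compact_kernel_indicator:
  assumes B: "B \<in> sets (S \<Otimes>\<^sub>M S)"
  shows "compact_kernel (indicator B)"
proof -
  let ?G = "{a \<times> b |a b. a \<in> sets S \<and> b \<in> sets S}"
  have G: "?G \<subseteq> Pow (space S \<times> space S)" using sets.space_closed[of S] by auto
  have "B \<in> sigma_sets (space S \<times> space S) ?G"
    using B by (simp add: sets_pair_measure)
  with Int_stable_pair_measure_generator[of S S] G show ?thesis
  proof (induction rule: sigma_sets_induct_disjoint)
    case (basic A) then show ?case using compact_kernel_rectangle by auto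
  next
    case empty
    show ?case using compact_kernel_rectangle[OF sets.empty_sets sets.empty_sets] by (simp only: Sigma_empty1)
  next
    case (compl A)
    have A: "A \<in> sets (S \<Otimes>\<^sub>M S)" using compl by (simp add: sets_pair_measure)
    have "compact_kernel (\<lambda>z. indicator (space S \<times> space S) z + -1 * indicator A z)"
      by (intro compact_kernel_add compact_kernel_cmult compl.IH compact_kernel_rectangle
            integrable_mult_right integrable_indicator_pair A)
         (auto simp: space_pair_measure[symmetric])
    then show ?case
      by (subst compact_kernel_cong) (auto simp: indicator_def)
  next
    case (union A)
    have A: "A i \<in> sets (S \<Otimes>\<^sub>M S)" for i using union by (auto simp: sets_pair_measure)
    show ?case
    proof (rule compact_kernel_limit[OF integrable_indicator_pair])
      show "(\<Union>i. A i) \<in> sets (S \<Otimes>\<^sub>M S)" using A by auto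
      have C: "integrable (\<pi> \<Otimes>\<^sub>M \<pi>) (\<lambda>z. \<Sum>i<n. indicator (A i) z :: real) \<and> compact_kernel (\<lambda>z. \<Sum>i<n. indicator (A i) z)" for n
      proof (induction n)
        case 0
        show ?case using compact_kernel_cmult[OF compact_kernel_rectangle[of "{}" "{}"], of 0] by simp
      next
        case (Suc n)
        then show ?case using union.IH[of n] A[of n]
          by (auto intro!: compact_kernel_add integrable_indicator_pair)
      qed
      have s: "(\<lambda>n. (\<Sum>i<n. indicator (A i) z :: real)) \<longlonglongrightarrow> indicator (\<Union>i. A i) z" for z
        using indicator_sums[of A z] union.hyps by (auto simp: sums_def disjoint_family_on_def)
      \<comment> \<open>Partial sums are indicators of parts of the union, so the error is at most
        1, which serves as the dominating function.\<close>
      have le: "\<bar>indicator (\<Union>i. A i) z - (\<Sum>i<n. indicator (A i) z)\<bar> \<le> (1::real)" for n z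
      proof -
        have "(\<Sum>i<n. indicator (A i) z :: real) = indicator (\<Union>i<n. A i) z"
          using union.hyps by (intro indicator_UN_disjoint[symmetric]) (auto simp: disjoint_family_on_def)
        then show ?thesis by (auto simp: indicator_def)
      qed
      have U: "(\<Union>i. A i) \<in> sets (S \<Otimes>\<^sub>M S)" using A by auto
      have lim: "(\<lambda>n. \<integral>z. \<bar>indicator (\<Union>i. A i) z - (\<Sum>i<n. indicator (A i) z)\<bar> \<partial>(\<pi> \<Otimes>\<^sub>M \<pi>)) \<longlonglongrightarrow> (\<integral>z. 0 \<partial>(\<pi> \<Otimes>\<^sub>M \<pi>) :: real)"
      proof (rule integral_dominated_convergence[where w="\<lambda>_. 1"])
        show "(\<lambda>z. \<bar>indicator (\<Union>i. A i) z - (\<Sum>i<n. indicator (A i) z)\<bar> :: real) \<in> borel_measurable (\<pi> \<Otimes>\<^sub>M \<pi>)" for n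
          by (intro borel_measurable_integrable integrable_abs Bochner_Integration.integrable_diff
                integrable_indicator_pair U conjunct1[OF C])
        show "AE z in \<pi> \<Otimes>\<^sub>M \<pi>. (\<lambda>n. \<bar>indicator (\<Union>i. A i) z - (\<Sum>i<n. indicator (A i) z)\<bar> :: real) \<longlonglongrightarrow> 0"
        proof (rule AE_I2)
          fix z
          show "(\<lambda>n. \<bar>indicator (\<Union>i. A i) z - (\<Sum>i<n. indicator (A i) z)\<bar> :: real) \<longlonglongrightarrow> 0"
            using tendsto_rabs[OF tendsto_diff[OF tendsto_const s], of "indicator (\<Union>i. A i) z" z] by simp
        qed
      qed (use le in \<open>auto intro: AE_I2\<close>)
      show "\<exists>\<psi>. integrable (\<pi> \<Otimes>\<^sub>M \<pi>) \<psi> \<and> compact_kernel \<psi> \<and> (\<integral>z. \<bar>indicator (\<Union>i. A i) z - \<psi> z\<bar> \<partial>(\<pi> \<Otimes>\<^sub>M \<pi>)) \<le> e"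
        if e: "e > 0" for e
      proof -
        have "eventually (\<lambda>n. (\<integral>z. \<bar>indicator (\<Union>i. A i) z - (\<Sum>i<n. indicator (A i) z)\<bar> \<partial>(\<pi> \<Otimes>\<^sub>M \<pi>)) < e) sequentially"
          using lim e by (intro order_tendstoD(2)[OF lim]) simp
        then obtain n where "(\<integral>z. \<bar>indicator (\<Union>i. A i) z - (\<Sum>i<n. indicator (A i) z)\<bar> \<partial>(\<pi> \<Otimes>\<^sub>M \<pi>)) < e"
          by (auto simp: eventually_sequentially)
        then show ?thesis
          using C[of n] by (intro exI[of _ "\<lambda>z. \<Sum>i<n. indicator (A i) z"]) (auto intro: less_imp_le)
      qed
    qed
  qed
qed

lemma compact_kernel_integrable:
  assumes "integrable (\<pi> \<Otimes>\<^sub>M \<pi>) (\<phi> :: 'a \<times> 'a \<Rightarrow> real)"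
  shows "compact_kernel \<phi>"
  using assms
proof (induction rule: integrable_induct)
  case (base A c)
  have "compact_kernel (\<lambda>z. c * indicator A z)"
    using base by (intro compact_kernel_cmult compact_kernel_indicator) (simp add: sets_pi_pair)
  then show ?case by (simp add: mult.commute)
next
  case (add f g)
  then show ?case by (intro compact_kernel_add) auto
next
  case (lim f s)
  show ?case
  proof (rule compact_kernel_limit[OF lim(4)])
    fix e :: real assume e: "e > 0"
    note [measurable] = borel_measurable_integrable[OF lim(1)] borel_measurable_integrable[OF lim(4)]
    have l: "(\<lambda>n. \<integral>z. \<bar>f z - s n z\<bar> \<partial>(\<pi> \<Otimes>\<^sub>M \<pi>)) \<longlonglongrightarrow> (\<integral>z. 0 \<partial>(\<pi> \<Otimes>\<^sub>M \<pi>) :: real)"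
    \<comment> \<open>The induction rule provides approximations bounded by twice the absolute value
      of \<open>f\<close>, hence errors bounded by three times it.\<close>
    proof (rule integral_dominated_convergence[where w="\<lambda>z. 3 * \<bar>f z\<bar>"])
      show "AE z in \<pi> \<Otimes>\<^sub>M \<pi>. (\<lambda>n. \<bar>f z - s n z\<bar>) \<longlonglongrightarrow> 0"
      proof (rule AE_I2)
        fix z assume "z \<in> space (\<pi> \<Otimes>\<^sub>M \<pi>)"
        from tendsto_rabs[OF tendsto_diff[OF tendsto_const lim(2)[OF this]], of "f z"]
        show "(\<lambda>n. \<bar>f z - s n z\<bar>) \<longlonglongrightarrow> 0" by simp
      qed
      show "AE z in \<pi> \<Otimes>\<^sub>M \<pi>. norm \<bar>f z - s n z\<bar> \<le> 3 * \<bar>f z\<bar>" for n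
      proof (rule AE_I2)
        fix z assume "z \<in> space (\<pi> \<Otimes>\<^sub>M \<pi>)"
        from lim(3)[OF this, of n] show "norm \<bar>f z - s n z\<bar> \<le> 3 * \<bar>f z\<bar>" by simp
      qed
    qed (use lim(4) in auto)
    have "eventually (\<lambda>n. (\<integral>z. \<bar>f z - s n z\<bar> \<partial>(\<pi> \<Otimes>\<^sub>M \<pi>)) < e) sequentially"
      using l e by (intro order_tendstoD(2)[OF l]) simp
    then obtain n where "(\<integral>z. \<bar>f z - s n z\<bar> \<partial>(\<pi> \<Otimes>\<^sub>M \<pi>)) < e"
      by (auto simp: eventually_sequentially)
    then show "\<exists>\<psi>. integrable (\<pi> \<Otimes>\<^sub>M \<pi>) \<psi> \<and> compact_kernel \<psi> \<and> (\<integral>z. \<bar>f z - \<psi> z\<bar> \<partial>(\<pi> \<Otimes>\<^sub>M \<pi>)) \<le> e"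
      using lim by (intro exI[of _ "s n"]) (auto intro: less_imp_le)
  qed
qed

section \<open>Comparison of the iterated operators with integral operators\<close>

lemma measurable_fst_snd_mult:
  assumes "\<sigma> \<in> unit_ball" "f \<in> unit_ball"
  shows "(\<lambda>z. \<sigma> (fst z) * f (snd z)) \<in> borel_measurable (S \<Otimes>\<^sub>M S)"
proof -
  note [measurable] = assms[THEN unit_ball_measurable]
  show ?thesis by measurable
qed

lemma abs_mult_unit_ball_le:
  assumes "\<sigma> \<in> unit_ball" "f \<in> unit_ball" "x \<in> space S" "y \<in> space S"
  shows "\<bar>\<sigma> x * f y\<bar> \<le> 1"
  using abs_test_le[OF assms(1,2), of "(x, y)" 1] assms(3,4) by simp

lemma integral_joint:
  assumes \<sigma>: "\<sigma> \<in> unit_ball" and f: "f \<in> unit_ball"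
  shows "(\<integral>z. \<sigma> (fst z) * f (snd z) \<partial>joint n) = (\<integral>x. \<sigma> x * iter n f x \<partial>\<pi>)"
proof -
  have "(\<integral>z. \<sigma> (fst z) * f (snd z) \<partial>joint n)
      = (\<integral>x. (\<integral>z. \<sigma> (fst z) * f (snd z) \<partial>distr (nst n x) (S \<Otimes>\<^sub>M S) (Pair x)) \<partial>\<pi>)"
    unfolding joint_def
  proof (rule integral_bind[where K="S \<Otimes>\<^sub>M S" and B=1 and B'=1])
    show "(\<lambda>x. distr (nst n x) (S \<Otimes>\<^sub>M S) (Pair x)) \<in> \<pi> \<rightarrow>\<^sub>M subprob_algebra (S \<Otimes>\<^sub>M S)"
      unfolding measurable_cong_sets[OF sets_pi refl] by (rule joint_kernel)
    show "AE x in \<pi>. emeasure (distr (nst n x) (S \<Otimes>\<^sub>M S) (Pair x)) (space (distr (nst n x) (S \<Otimes>\<^sub>M S) (Pair x))) \<le> ennreal 1"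
    proof (rule AE_I2)
      fix x assume "x \<in> space \<pi>"
      then have x: "x \<in> space S" by (simp add: space_pi)
      interpret prob_space "nst n x" by (rule prob_space_nstep[OF x])
      have "prob_space (distr (nst n x) (S \<Otimes>\<^sub>M S) (Pair x))"
        using x by (intro prob_space_distr) (simp add: measurable_cong_sets[OF sets_nstep[OF x] refl])
      from prob_space.emeasure_space_1[OF this]
      show "emeasure (distr (nst n x) (S \<Otimes>\<^sub>M S) (Pair x)) (space (distr (nst n x) (S \<Otimes>\<^sub>M S) (Pair x))) \<le> ennreal 1"
        by simp
    qed
    show "\<bar>\<sigma> (fst z) * f (snd z)\<bar> \<le> 1" if "z \<in> space (S \<Otimes>\<^sub>M S)" for z
      using abs_mult_unit_ball_le[OF \<sigma> f, of "fst z" "snd z"] that by (auto simp: space_pair_measure)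
    show "finite_measure \<pi>" by (rule pi.finite_measure_axioms)
  qed (rule measurable_fst_snd_mult[OF \<sigma> f])
  also have "\<dots> = (\<integral>x. \<sigma> x * iter n f x \<partial>\<pi>)"
  proof (rule Bochner_Integration.integral_cong[OF refl])
    fix x assume "x \<in> space \<pi>"
    then have x: "x \<in> space S" by (simp add: space_pi)
    have "(\<integral>z. \<sigma> (fst z) * f (snd z) \<partial>distr (nst n x) (S \<Otimes>\<^sub>M S) (Pair x)) = (\<integral>y. \<sigma> (fst (x, y)) * f (snd (x, y)) \<partial>nst n x)"
      using x by (intro integral_distr measurable_fst_snd_mult[OF \<sigma> f])
        (simp add: measurable_cong_sets[OF sets_nstep[OF x] refl])
    then show "(\<integral>z. \<sigma> (fst z) * f (snd z) \<partial>distr (nst n x) (S \<Otimes>\<^sub>M S) (Pair x)) = \<sigma> x * iter n f x"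
      by (simp add: iter_def)
  qed
  finally show ?thesis .
qed

lemma joint_real_density:
  obtains \<phi> :: "'a \<times> 'a \<Rightarrow> real" where "integrable (\<pi> \<Otimes>\<^sub>M \<pi>) \<phi>" "\<And>z. \<phi> z \<ge> 0"
    "density (\<pi> \<Otimes>\<^sub>M \<pi>) (\<lambda>z. ennreal (\<phi> z)) = density (joint n) (\<lambda>z. ennreal (indicator (- sing) z))"
proof -
  interpret j: prob_space "joint n" by (rule prob_space_joint)
  obtain f :: "'a \<times> 'a \<Rightarrow> ennreal" where "f \<in> borel_measurable (S \<Otimes>\<^sub>M S)"
    and dens: "density (\<pi> \<Otimes>\<^sub>M \<pi>) f = density (joint n) (indicator (- sing))"
    by (rule joint_density)
  then have f[measurable]: "f \<in> borel_measurable (\<pi> \<Otimes>\<^sub>M \<pi>)"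
    by (simp add: measurable_cong_sets[OF sets_pi_pair refl])
  have "(\<integral>\<^sup>+z. f z \<partial>(\<pi> \<Otimes>\<^sub>M \<pi>)) = (\<integral>\<^sup>+z. f z * indicator (space (\<pi> \<Otimes>\<^sub>M \<pi>)) z \<partial>(\<pi> \<Otimes>\<^sub>M \<pi>))"
    by (intro nn_integral_cong) simp
  also have "\<dots> = emeasure (density (\<pi> \<Otimes>\<^sub>M \<pi>) f) (space (\<pi> \<Otimes>\<^sub>M \<pi>))"
    by (rule emeasure_density[symmetric]) auto
  also have "\<dots> = emeasure (density (joint n) (indicator (- sing))) (space (joint n))"
    unfolding dens by (simp only: space_joint space_pair_measure space_pi)
  also have "\<dots> = (\<integral>\<^sup>+z. indicator (- sing) z * indicator (space (joint n)) z \<partial>joint n)"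
    by (rule emeasure_density) auto
  also have "\<dots> \<le> (\<integral>\<^sup>+z. 1 \<partial>joint n)"
    by (intro nn_integral_mono) (auto simp: indicator_def)
  also have "\<dots> = 1" by (simp add: j.emeasure_space_1)
  finally have le1: "(\<integral>\<^sup>+z. f z \<partial>(\<pi> \<Otimes>\<^sub>M \<pi>)) \<le> 1" .
  then have "(\<integral>\<^sup>+z. f z \<partial>(\<pi> \<Otimes>\<^sub>M \<pi>)) \<noteq> \<infinity>" by (auto simp: top_unique)
  from nn_integral_PInf_AE[OF f this]
  have ae: "AE z in \<pi> \<Otimes>\<^sub>M \<pi>. ennreal (enn2real (f z)) = f z"
    by (rule AE_mono_space) (simp add: less_top)
  have "integrable (\<pi> \<Otimes>\<^sub>M \<pi>) (\<lambda>z. enn2real (f z))"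
  proof (rule integrableI_nonneg)
    have "(\<integral>\<^sup>+z. ennreal (enn2real (f z)) \<partial>(\<pi> \<Otimes>\<^sub>M \<pi>)) = (\<integral>\<^sup>+z. f z \<partial>(\<pi> \<Otimes>\<^sub>M \<pi>))"
      by (rule nn_integral_cong_AE[OF ae])
    also have "\<dots> < \<infinity>" using le1 by (rule le_less_trans) simp
    finally show "(\<integral>\<^sup>+z. ennreal (enn2real (f z)) \<partial>(\<pi> \<Otimes>\<^sub>M \<pi>)) < \<infinity>" .
  qed auto
  moreover have "density (\<pi> \<Otimes>\<^sub>M \<pi>) (\<lambda>z. ennreal (enn2real (f z))) = density (\<pi> \<Otimes>\<^sub>M \<pi>) f"
    by (rule density_cong[OF _ _ ae]) auto
  moreover have "(\<lambda>z. ennreal (indicator (- sing) z)) = indicator (- sing)"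
    by (rule ext) (simp only: ennreal_indicator)
  ultimately show thesis using dens by (intro that[of "\<lambda>z. enn2real (f z)"]) simp_all
qed

text \<open>The integrand is bounded by 1, so removing \<open>sing\<close> from the domain changes
  the integral by at most the mass of \<open>sing\<close>.\<close>

lemma joint_split:
  assumes \<sigma>: "\<sigma> \<in> unit_ball" and f: "f \<in> unit_ball"
    and \<phi>: "integrable (\<pi> \<Otimes>\<^sub>M \<pi>) \<phi>" "\<And>z. \<phi> z \<ge> 0"
    and dens: "density (\<pi> \<Otimes>\<^sub>M \<pi>) (\<lambda>z. ennreal (\<phi> z)) = density (joint n) (\<lambda>z. ennreal (indicator (- sing) z))"
  shows "\<bar>(\<integral>x. \<sigma> x * iter n f x \<partial>\<pi>) - pairing \<phi> \<sigma> f\<bar> \<le> measure (joint n) sing"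
proof -
  interpret j: prob_space "joint n" by (rule prob_space_joint)
  let ?g = "\<lambda>z. \<sigma> (fst z) * f (snd z)"
  note m[measurable] = measurable_fst_snd_mult[OF \<sigma> f]
  note [measurable] = borel_measurable_integrable[OF \<phi>(1)]
  have b: "\<bar>?g z\<bar> \<le> 1" if "z \<in> space (joint n)" for z
    using abs_mult_unit_ball_le[OF \<sigma> f, of "fst z" "snd z"] that by (auto simp: space_joint)
  have "pairing \<phi> \<sigma> f = (\<integral>z. \<phi> z *\<^sub>R ?g z \<partial>(\<pi> \<Otimes>\<^sub>M \<pi>))"
    unfolding pairing_def by (simp only: real_scaleR_def mult.commute)
  also have "\<dots> = (\<integral>z. ?g z \<partial>density (\<pi> \<Otimes>\<^sub>M \<pi>) (\<lambda>z. ennreal (\<phi> z)))"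
    using \<phi>(2) by (intro integral_density[symmetric]) (auto simp: measurable_cong_sets[OF sets_pi_pair refl])
  also have "\<dots> = (\<integral>z. indicator (- sing) z *\<^sub>R ?g z \<partial>joint n)"
    unfolding dens by (intro integral_density) auto
  finally have 1: "pairing \<phi> \<sigma> f = (\<integral>z. indicator (- sing) z *\<^sub>R ?g z \<partial>joint n)" .
  have int: "integrable (joint n) ?g"
    using b by (intro j.integrable_const_bound[where B=1]) (auto simp: AE_I2)
  have int2: "integrable (joint n) (\<lambda>z. indicator (- sing) z *\<^sub>R ?g z)"
  proof (rule j.integrable_const_bound[where B=1])
    show "AE z in joint n. norm (indicator (- sing) z *\<^sub>R ?g z) \<le> 1"
      by (rule AE_I2) (use b in \<open>auto simp: indicator_def\<close>)
  qed measurable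
  have "(\<integral>x. \<sigma> x * iter n f x \<partial>\<pi>) - pairing \<phi> \<sigma> f = (\<integral>z. ?g z - indicator (- sing) z *\<^sub>R ?g z \<partial>joint n)"
    unfolding 1 integral_joint[OF \<sigma> f, symmetric]
    by (rule Bochner_Integration.integral_diff[OF int int2, symmetric])
  also have "\<bar>\<dots>\<bar> \<le> (\<integral>z. \<bar>?g z - indicator (- sing) z *\<^sub>R ?g z\<bar> \<partial>joint n)"
    by (rule integral_abs_bound)
  also have "\<dots> \<le> (\<integral>z. indicator sing z \<partial>joint n)"
  proof (rule integral_mono)
    show "\<bar>?g z - indicator (- sing) z *\<^sub>R ?g z\<bar> \<le> indicator sing z" if "z \<in> space (joint n)" for z
      using b[OF that] by (auto simp: indicator_def)
    show "integrable (joint n) (\<lambda>z. \<bar>?g z - indicator (- sing) z *\<^sub>R ?g z\<bar>)"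
      by (intro integrable_abs Bochner_Integration.integrable_diff int int2)
    show "integrable (joint n) (indicat_real sing)"
      by (intro j.integrable_const_bound[where B=1]) auto
  qed
  also have "\<dots> = measure (joint n) sing"
    using sets.sets_into_space[OF sing_measurable] by (simp add: space_pair_measure space_joint Int_absorb2)
  finally show ?thesis .
qed

text \<open>
  The map \<open>\<kappa>\<close> assigns to \<open>f\<close> the center of a ball of the finite net that contains its image.
\<close>

lemma totally_bounded_iter:
  assumes e: "e > 0"
  obtains n and \<kappa> :: "('a \<Rightarrow> real) \<Rightarrow> ('a \<Rightarrow> real)" where "finite (\<kappa> ` unit_ball)"
    "\<And>f g. f \<in> unit_ball \<Longrightarrow> g \<in> unit_ball \<Longrightarrow> \<kappa> f = \<kappa> g \<Longrightarrow> dist1 (iter n f) (iter n g) \<le> e"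
proof -
  \<comment> \<open>Four errors of \<open>e / 4\<close> add up at the end: the singular mass and the
    distance to the net, each once for \<open>f\<close> and once for \<open>g\<close>.\<close>
  have e4: "e / 4 > 0" using e by simp
  obtain n where n: "emeasure (joint n) sing < ennreal (e / 4)"
    using emeasure_joint_sing_small[of "ennreal (e / 4)"] e by auto
  interpret j: prob_space "joint n" by (rule prob_space_joint)
  have n': "measure (joint n) sing \<le> e / 4"
    using n e4 by (simp add: j.emeasure_eq_measure ennreal_less_iff)
  obtain \<phi> :: "'a \<times> 'a \<Rightarrow> real" where \<phi>: "integrable (\<pi> \<Otimes>\<^sub>M \<pi>) \<phi>" "\<And>z. \<phi> z \<ge> 0"
    and dens: "density (\<pi> \<Otimes>\<^sub>M \<pi>) (\<lambda>z. ennreal (\<phi> z)) = density (joint n) (\<lambda>z. ennreal (indicator (- sing) z))"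
    by (rule joint_real_density[of n]) blast
  obtain \<Phi> where \<Phi>: "finite \<Phi>" "\<Phi> \<subseteq> bfun"
    "\<forall>f\<in>unit_ball. \<exists>h\<in>\<Phi>. \<forall>\<sigma>\<in>unit_ball. \<bar>pairing \<phi> \<sigma> f - (\<integral>x. \<sigma> x * h x \<partial>\<pi>)\<bar> \<le> e / 4"
    by (rule compact_kernelE[OF compact_kernel_integrable[OF \<phi>(1)] e4])
  obtain \<kappa> where \<kappa>: "\<forall>f\<in>unit_ball. \<kappa> f \<in> \<Phi> \<and> (\<forall>\<sigma>\<in>unit_ball. \<bar>pairing \<phi> \<sigma> f - (\<integral>x. \<sigma> x * \<kappa> f x \<partial>\<pi>)\<bar> \<le> e / 4)"
    using bchoice[OF \<Phi>(3)[unfolded Bex_def]] by blast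
  show thesis
  proof (rule that[of \<kappa> n])
    show "finite (\<kappa> ` unit_ball)" using \<kappa> by (intro finite_subset[OF _ \<Phi>(1)]) blast
    fix f g assume f: "f \<in> unit_ball" and g: "g \<in> unit_ball" and eq: "\<kappa> f = \<kappa> g"
    \<comment> \<open>Testing against the sign of the difference recovers its L1 norm.\<close>
    define \<sigma> where "\<sigma> x = sgn (iter n f x - iter n g x)" for x
    note [measurable] = iter_measurable[OF unit_ball_measurable[OF f]] iter_measurable[OF unit_ball_measurable[OF g]]
    have \<sigma>: "\<sigma> \<in> unit_ball"
      unfolding unit_ball_def \<sigma>_def[abs_def] by (auto simp: sgn_if)
    have "dist1 (iter n f) (iter n g) = (\<integral>x. \<sigma> x * iter n f x - \<sigma> x * iter n g x \<partial>\<pi>)"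
      unfolding dist1_def \<sigma>_def
      by (intro Bochner_Integration.integral_cong refl) (simp add: abs_sgn algebra_simps)
    also have "\<dots> = (\<integral>x. \<sigma> x * iter n f x \<partial>\<pi>) - (\<integral>x. \<sigma> x * iter n g x \<partial>\<pi>)"
      by (intro Bochner_Integration.integral_diff integrable_pi bfun_mult unit_ball_bfun iter_unit_ball \<sigma> f g)
    finally have d: "dist1 (iter n f) (iter n g) = (\<integral>x. \<sigma> x * iter n f x \<partial>\<pi>) - (\<integral>x. \<sigma> x * iter n g x \<partial>\<pi>)" .
    have "\<bar>pairing \<phi> \<sigma> f - (\<integral>x. \<sigma> x * \<kappa> g x \<partial>\<pi>)\<bar> \<le> e / 4" "\<bar>pairing \<phi> \<sigma> g - (\<integral>x. \<sigma> x * \<kappa> g x \<partial>\<pi>)\<bar> \<le> e / 4"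
      using \<kappa> f g \<sigma> eq by metis+
    with joint_split[OF \<sigma> f \<phi> dens] joint_split[OF \<sigma> g \<phi> dens] n' d
    show "dist1 (iter n f) (iter n g) \<le> e" by argo
  qed
qed

section \<open>Limit points of orbits and their recurrence\<close>

lemma dist1_cong:
  assumes "\<And>x. x \<in> space S \<Longrightarrow> f x = f' x" "\<And>x. x \<in> space S \<Longrightarrow> g x = g' x"
  shows "dist1 f g = dist1 f' g'"
  unfolding dist1_def using assms by (intro Bochner_Integration.integral_cong refl) (simp add: space_pi)

text \<open>Pigeonhole on the finite net: infinitely many members of the orbit, taken
  \<open>n\<close> steps before the times in \<open>s\<close>, share one net point, and the
  \<open>n\<close> remaining steps bring them within \<open>e\<close> of each other.\<close>

lemma orbit_subsequence_close:
  fixes s :: "nat \<Rightarrow> nat"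
  assumes f: "f \<in> unit_ball" and e: "e > 0" and s: "strict_mono s"
  obtains r :: "nat \<Rightarrow> nat" where "strict_mono r" "\<And>i j. dist1 (iter (s (r i)) f) (iter (s (r j)) f) \<le> e"
proof -
  obtain n and \<kappa> :: "('a \<Rightarrow> real) \<Rightarrow> ('a \<Rightarrow> real)" where \<kappa>: "finite (\<kappa> ` unit_ball)"
    "\<And>f g. f \<in> unit_ball \<Longrightarrow> g \<in> unit_ball \<Longrightarrow> \<kappa> f = \<kappa> g \<Longrightarrow> dist1 (iter n f) (iter n g) \<le> e"
    by (rule totally_bounded_iter[OF e]) blast
  \<comment> \<open>The shift by \<open>n\<close> ensures \<open>n \<le> s (i + n)\<close>, so the
    subtraction is not truncated.\<close>
  define q where "q i = \<kappa> (iter (s (i + n) - n) f)" for i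
  have sn: "n \<le> s (i + n)" for i using seq_suble[OF s, of "i + n"] by linarith
  have "finite (range q)"
    by (rule finite_subset[OF _ \<kappa>(1)]) (auto simp: q_def intro!: imageI iter_unit_ball f)
  then obtain i0 where inf: "infinite {i. q i = q i0}"
    using pigeonhole_infinite[of "UNIV :: nat set" q] by auto
  define r where "r i = enumerate {i. q i = q i0} i + n" for i
  show thesis
  proof
    show "strict_mono r"
      unfolding r_def strict_mono_def using strict_mono_enumerate[OF inf] by (auto simp: strict_mono_def)
    fix i j
    let ?u = "\<lambda>i. iter (s (r i) - n) f"
    have eq: "iter (s (r i)) f x = iter n (?u i) x" if "x \<in> space S" for i x
      using iter_comp[OF unit_ball_bfun[OF f] that, of n "s (r i) - n"] sn by (simp add: r_def)
    have k: "\<kappa> (?u i) = q i0" for i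
      using enumerate_in_set[OF inf, of i] by (simp add: r_def q_def)
    have "dist1 (iter (s (r i)) f) (iter (s (r j)) f) = dist1 (iter n (?u i)) (iter n (?u j))"
      by (rule dist1_cong) (simp_all only: eq)
    also have "\<dots> \<le> e"
      by (rule \<kappa>(2)) (simp_all only: iter_unit_ball[OF f] k)
    finally show "dist1 (iter (s (r i)) f) (iter (s (r j)) f) \<le> e" .
  qed
qed

text \<open>A diagonal sequence over the accuracies \<open>1 / 2 ^ n\<close> is Cauchy in L1. A
  further subsequence converges almost everywhere, and boundedness turns this back into L1
  convergence to the pointwise limit.\<close>

lemma orbit_limit_point:
  assumes f: "f \<in> unit_ball"
  obtains r :: "nat \<Rightarrow> nat" and w where "strict_mono r" "w \<in> unit_ball" "(\<lambda>i. dist1 (iter (r i) f) w) \<longlonglongrightarrow> 0"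
proof -
  define P where "P n s \<longleftrightarrow> (\<forall>i j. dist1 (iter (s i) f) (iter (s j) f) \<le> 1 / 2 ^ n)" for n :: nat and s :: "nat \<Rightarrow> nat"
  have PD: "P n s \<Longrightarrow> dist1 (iter (s i) f) (iter (s j) f) \<le> 1 / 2 ^ n" for n s i j
    unfolding P_def by blast
  interpret subseqs P
  proof
    fix n and s :: "nat \<Rightarrow> nat" assume s: "strict_mono s"
    have "(1 / 2 ^ n :: real) > 0" by simp
    from orbit_subsequence_close[OF f this s] show "\<exists>r'. strict_mono r' \<and> P n (s \<circ> r')"
      unfolding P_def by (metis comp_apply)
  qed
  have P: "P k (diagseq \<circ> ((+) (Suc k)))" for k
    by (rule diagseq_holds) (auto simp: P_def)
  let ?a = "\<lambda>i. iter (diagseq i) f"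
  have a: "?a i \<in> unit_ball" for i by (rule iter_unit_ball[OF f])
  have cauchy: "\<exists>N. \<forall>i\<ge>N. \<forall>j\<ge>N. (\<integral>x. norm (?a i x - ?a j x) \<partial>\<pi>) < e" if e: "e > 0" for e
  proof -
    obtain k where k: "(1/2) ^ k < e" using real_arch_pow_inv[OF e, of "1/2"] by auto
    show ?thesis
    proof (intro exI allI impI)
      fix i j assume "Suc k \<le> i" "Suc k \<le> j"
      then have "i = Suc k + (i - Suc k)" "j = Suc k + (j - Suc k)" by linarith+
      then have "dist1 (?a i) (?a j) \<le> 1 / 2 ^ k"
        using PD[OF P[of k], of "i - Suc k" "j - Suc k"] by simp
      also have "\<dots> < e" using k by (simp add: power_divide)
      finally show "(\<integral>x. norm (?a i x - ?a j x) \<partial>\<pi>) < e" by (simp only: dist1_def real_norm_def)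
    qed
  qed
  obtain r where r: "strict_mono r" "AE x in \<pi>. Cauchy (\<lambda>i. ?a (r i) x)"
    using cauchy_L1_AE_cauchy_subseq[OF integrable_pi[OF unit_ball_bfun[OF a]] cauchy] by blast
  \<comment> \<open>Where the sequence diverges, \<open>lim\<close> is an arbitrary value; clipping
    puts \<open>w\<close> into the unit ball at every point and leaves genuine limits
    unchanged.\<close>
  define w where "w x = max (-1) (min 1 (lim (\<lambda>i. ?a (r i) x)))" for x
  have [measurable]: "?a i \<in> borel_measurable S" for i by (rule unit_ball_measurable[OF a])
  have w: "w \<in> unit_ball"
    unfolding unit_ball_def w_def[abs_def] by auto
  have lim: "AE x in \<pi>. (\<lambda>i. ?a (r i) x) \<longlonglongrightarrow> w x"
    using r(2)
  proof (rule AE_mono_space)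
    fix x assume x: "x \<in> space \<pi>" and "Cauchy (\<lambda>i. ?a (r i) x)"
    then have l: "(\<lambda>i. ?a (r i) x) \<longlonglongrightarrow> lim (\<lambda>i. ?a (r i) x)"
      by (simp add: Cauchy_convergent_iff convergent_LIMSEQ_iff)
    have b: "\<bar>?a i x\<bar> \<le> 1" for i using a[of i] x by (simp add: unit_ball_def space_pi)
    have "lim (\<lambda>i. ?a (r i) x) \<le> 1" using l by (rule LIMSEQ_le_const2) (use b in \<open>auto simp: abs_le_iff\<close>)
    moreover have "-1 \<le> lim (\<lambda>i. ?a (r i) x)"
      using l by (rule LIMSEQ_le_const) (use b in \<open>auto simp: abs_le_iff minus_le_iff\<close>)
    ultimately show "(\<lambda>i. ?a (r i) x) \<longlonglongrightarrow> w x" using l by (simp add: w_def)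
  qed
  have "(\<lambda>i. dist1 (?a (r i)) w) \<longlonglongrightarrow> (\<integral>x. 0 \<partial>\<pi>)"
    unfolding dist1_def
  proof (rule integral_dominated_convergence[where w="\<lambda>_. 2"])
    show "(\<lambda>x. \<bar>?a (r i) x - w x\<bar>) \<in> borel_measurable \<pi>" for i
      by (intro borel_measurable_integrable integrable_pi bfun_intros unit_ball_bfun[OF a] unit_ball_bfun[OF w])
    show "AE x in \<pi>. (\<lambda>i. \<bar>?a (r i) x - w x\<bar>) \<longlonglongrightarrow> 0"
      using lim
    proof (rule AE_mono_space)
      fix x assume "(\<lambda>i. ?a (r i) x) \<longlonglongrightarrow> w x"
      from tendsto_rabs[OF tendsto_diff[OF this tendsto_const[of "w x"]]]
      show "(\<lambda>i. \<bar>?a (r i) x - w x\<bar>) \<longlonglongrightarrow> 0" by simp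
    qed
    show "AE x in \<pi>. norm \<bar>?a (r i) x - w x\<bar> \<le> 2" for i
    proof (rule AE_I2)
      fix x assume "x \<in> space \<pi>"
      then have "\<bar>?a (r i) x\<bar> \<le> 1" "\<bar>w x\<bar> \<le> 1" using a[of "r i"] w by (simp_all add: unit_ball_def space_pi)
      then show "norm \<bar>?a (r i) x - w x\<bar> \<le> 2" by simp
    qed
  qed auto
  then have "(\<lambda>i. dist1 (iter ((diagseq \<circ> r) i) f) w) \<longlonglongrightarrow> 0" by simp
  then show thesis
    using w strict_mono_o[OF subseq_diagseq r(1)] by (intro that[of "diagseq \<circ> r" w])
qed

text \<open>Take two late times \<open>r i < r j\<close> at which the orbit is close to
  \<open>w\<close>. Running for the difference \<open>l\<close> of the two times maps the earlier
  member onto the later one, and by contraction maps \<open>w\<close> close to the later one, hence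
  close to \<open>w\<close>.\<close>

lemma limit_point_recurrent:
  assumes f: "f \<in> unit_ball" and w: "w \<in> unit_ball" and r: "strict_mono r"
    and lim: "(\<lambda>i. dist1 (iter (r i) f) w) \<longlonglongrightarrow> 0" and e: "e > 0"
  obtains l where "l \<ge> N" "dist1 (iter l w) w \<le> e"
proof -
  have "eventually (\<lambda>i. dist1 (iter (r i) f) w < e / 2) sequentially"
    using e by (intro order_tendstoD(2)[OF lim]) simp
  then obtain i where i: "\<And>j. j \<ge> i \<Longrightarrow> dist1 (iter (r j) f) w < e / 2"
    by (auto simp: eventually_sequentially)
  \<comment> \<open>As \<open>j \<le> r j\<close>, this choice makes \<open>r j\<close> at least
    \<open>r i + N\<close>, so the difference is not truncated and is at least
    \<open>N\<close>.\<close>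
  define j where "j = i + r i + N"
  have "j \<le> r j" by (rule seq_suble[OF r])
  then have rj: "r j = (r j - r i) + r i" and N: "r j - r i \<ge> N" by (simp_all add: j_def)
  let ?l = "r j - r i"
  note b = unit_ball_bfun[OF f] unit_ball_bfun[OF w]
  have "dist1 (iter ?l w) w \<le> dist1 (iter ?l w) (iter ?l (iter (r i) f)) + dist1 (iter ?l (iter (r i) f)) w"
    by (intro dist1_triangle iter_bfun b)
  also have "dist1 (iter ?l w) (iter ?l (iter (r i) f)) \<le> dist1 w (iter (r i) f)"
    by (intro dist1_iter iter_bfun b)
  also have "dist1 w (iter (r i) f) \<le> e / 2" using i[of i] by (simp add: dist1_commute)
  also have "dist1 (iter ?l (iter (r i) f)) w = dist1 (iter (r j) f) w"
    by (rule dist1_cong) (use iter_comp[OF b(1), of _ ?l "r i"] rj in simp_all)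
  also have "\<dots> \<le> e / 2" using i[of j] by (simp add: j_def)
  finally have "dist1 (iter ?l w) w \<le> e" by simp
  with N show thesis by (rule that)
qed

section \<open>Energy and conditional variance\<close>

definition energy :: "('a \<Rightarrow> real) \<Rightarrow> real" where "energy f = (\<integral>x. (f x)\<^sup>2 \<partial>\<pi>)"

lemma variance_eq:
  assumes v: "v \<in> bfun" and x: "x \<in> space S"
  shows "iter n (\<lambda>y. (v y - iter n v x)\<^sup>2) x = iter n (\<lambda>y. (v y)\<^sup>2) x - (iter n v x)\<^sup>2"
proof -
  define c where "c = iter n v x"
  have "iter n (\<lambda>y. (v y - c)\<^sup>2) x = (\<integral>y. ((v y)\<^sup>2 - 2 * c * v y) + c\<^sup>2 \<partial>nst n x)"
    unfolding iter_def by (intro Bochner_Integration.integral_cong refl) (simp add: power2_eq_square algebra_simps)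
  also have "\<dots> = (\<integral>y. (v y)\<^sup>2 - 2 * c * v y \<partial>nst n x) + (\<integral>y. c\<^sup>2 \<partial>nst n x)"
    by (intro Bochner_Integration.integral_add integrable_nst bfun_intros v x)
  also have "(\<integral>y. (v y)\<^sup>2 - 2 * c * v y \<partial>nst n x) = (\<integral>y. (v y)\<^sup>2 \<partial>nst n x) - (\<integral>y. 2 * c * v y \<partial>nst n x)"
    by (intro Bochner_Integration.integral_diff integrable_nst bfun_intros v x)
  also have "(\<integral>y. 2 * c * v y \<partial>nst n x) = 2 * c * c"
    unfolding c_def iter_def by (rule integral_mult_right_zero)
  also have "(\<integral>y. c\<^sup>2 \<partial>nst n x) = c\<^sup>2"
    using iter_const[OF x, of n "c\<^sup>2"] by (simp only: iter_def)
  finally show ?thesis unfolding c_def[symmetric] by (simp add: iter_def power2_eq_square)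
qed

lemma variance_nonneg: "iter n (\<lambda>y. (v y - c)\<^sup>2) x \<ge> 0"
  unfolding iter_def by (rule Bochner_Integration.integral_nonneg) simp

text \<open>Stationarity identifies the mean conditional variance with the loss of energy in
  \<open>n\<close> steps. So energy cannot increase, and it is conserved only if the value of
  \<open>v\<close> after \<open>n\<close> steps is determined by the present state.\<close>

lemma integral_variance:
  assumes v: "v \<in> bfun"
  shows "(\<integral>x. iter n (\<lambda>y. (v y)\<^sup>2) x - (iter n v x)\<^sup>2 \<partial>\<pi>) = energy v - energy (iter n v)"
proof -
  have "(\<integral>x. iter n (\<lambda>y. (v y)\<^sup>2) x - (iter n v x)\<^sup>2 \<partial>\<pi>)
      = (\<integral>x. iter n (\<lambda>y. (v y)\<^sup>2) x \<partial>\<pi>) - (\<integral>x. (iter n v x)\<^sup>2 \<partial>\<pi>)"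
    by (intro Bochner_Integration.integral_diff integrable_pi iter_bfun bfun_intros v)
  also have "(\<integral>x. iter n (\<lambda>y. (v y)\<^sup>2) x \<partial>\<pi>) = energy v"
    unfolding energy_def by (intro integral_iter bfun_intros v)
  finally show ?thesis by (simp only: energy_def)
qed

lemma energy_iter_le:
  assumes v: "v \<in> bfun"
  shows "energy (iter n v) \<le> energy v"
proof -
  have "0 \<le> (\<integral>x. iter n (\<lambda>y. (v y)\<^sup>2) x - (iter n v x)\<^sup>2 \<partial>\<pi>)"
  proof (rule Bochner_Integration.integral_nonneg_AE, rule AE_I2)
    fix x assume "x \<in> space \<pi>"
    then have x: "x \<in> space S" by (simp add: space_pi)
    show "0 \<le> iter n (\<lambda>y. (v y)\<^sup>2) x - (iter n v x)\<^sup>2"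
      unfolding variance_eq[OF v x, symmetric] by (rule variance_nonneg)
  qed
  then show ?thesis unfolding integral_variance[OF v] by simp
qed

lemma energy_eq_imp_deterministic:
  assumes v: "v \<in> bfun" and eq: "energy (iter n v) = energy v"
  shows "AE x in \<pi>. AE y in nst n x. v y = iter n v x"
proof -
  let ?V = "\<lambda>x. iter n (\<lambda>y. (v y)\<^sup>2) x - (iter n v x)\<^sup>2"
  have int: "integrable \<pi> ?V" by (intro integrable_pi bfun_intros iter_bfun v)
  have nn: "AE x in \<pi>. 0 \<le> ?V x"
  proof (rule AE_I2)
    fix x assume "x \<in> space \<pi>"
    then have x: "x \<in> space S" by (simp add: space_pi)
    show "0 \<le> ?V x"
      unfolding variance_eq[OF v x, symmetric] by (rule variance_nonneg)
  qed
  have "(\<integral>x. ?V x \<partial>\<pi>) = 0" unfolding integral_variance[OF v] eq by simp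
  then have "AE x in \<pi>. ?V x = 0"
    by (subst (asm) integral_nonneg_eq_0_iff_AE[OF int nn])
  then show ?thesis
  proof (rule AE_mono_space)
    fix x assume "x \<in> space \<pi>" and V: "?V x = 0"
    then have x: "x \<in> space S" by (simp add: space_pi)
    have int: "integrable (nst n x) (\<lambda>y. (v y - iter n v x)\<^sup>2)"
      by (intro integrable_nst bfun_intros v x)
    have "(\<integral>y. (v y - iter n v x)\<^sup>2 \<partial>nst n x) = 0"
      using V unfolding variance_eq[OF v x, symmetric] by (simp only: iter_def)
    then have "AE y in nst n x. (v y - iter n v x)\<^sup>2 = 0"
      by (subst (asm) integral_nonneg_eq_0_iff_AE[OF int]) auto
    then show "AE y in nst n x. v y = iter n v x" by (rule AE_mono_space) simp
  qed
qed

lemma energy_cong: "(\<And>x. x \<in> space S \<Longrightarrow> f x = g x) \<Longrightarrow> energy f = energy g"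
  unfolding energy_def by (intro Bochner_Integration.integral_cong refl) (simp add: space_pi)

lemma energy_diff_le:
  assumes f: "f \<in> unit_ball" and g: "g \<in> unit_ball"
  shows "energy g - energy f \<le> 2 * dist1 f g"
proof -
  have "energy g - energy f = (\<integral>x. (g x)\<^sup>2 - (f x)\<^sup>2 \<partial>\<pi>)"
    unfolding energy_def by (intro Bochner_Integration.integral_diff[symmetric] integrable_pi bfun_intros unit_ball_bfun[OF f] unit_ball_bfun[OF g])
  also have "\<dots> \<le> (\<integral>x. 2 * \<bar>f x - g x\<bar> \<partial>\<pi>)"
  proof (rule integral_mono)
    fix x assume "x \<in> space \<pi>"
    then have "\<bar>f x\<bar> \<le> 1" "\<bar>g x\<bar> \<le> 1" using f g by (auto simp: unit_ball_def space_pi)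
    then have "\<bar>g x + f x\<bar> \<le> 2" by linarith
    then have "\<bar>g x + f x\<bar> * \<bar>g x - f x\<bar> \<le> 2 * \<bar>f x - g x\<bar>"
      unfolding abs_minus_commute[of "g x"] by (rule mult_right_mono) simp
    moreover have "(g x)\<^sup>2 - (f x)\<^sup>2 \<le> \<bar>g x + f x\<bar> * \<bar>g x - f x\<bar>"
      unfolding abs_mult[symmetric] by (rule order_trans[OF _ abs_ge_self]) (simp add: power2_eq_square algebra_simps)
    ultimately show "(g x)\<^sup>2 - (f x)\<^sup>2 \<le> 2 * \<bar>f x - g x\<bar>" by linarith
  qed (intro integrable_pi bfun_intros unit_ball_bfun[OF f] unit_ball_bfun[OF g])+
  also have "\<dots> = 2 * dist1 f g" unfolding dist1_def by (rule integral_mult_right_zero)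
  finally show ?thesis .
qed

text \<open>For \<open>l \<ge> n\<close> the energy of \<open>iter n w\<close> lies between those of
  \<open>iter l w\<close> and \<open>w\<close>. Recurrence brings the outer two arbitrarily close
  together with \<open>l\<close> as late as desired, so every \<open>iter n w\<close> has the energy
  of \<open>w\<close>, and nothing is lost between any two times of the orbit.\<close>

lemma recurrent_imp_deterministic:
  assumes w: "w \<in> unit_ball" and rec: "\<And>e N. e > 0 \<Longrightarrow> \<exists>l\<ge>N. dist1 (iter l w) w \<le> e"
  shows "AE x in \<pi>. \<forall>n k. AE y in nst n x. iter k w y = iter (n + k) w x"
proof -
  have wb: "w \<in> bfun" by (rule unit_ball_bfun[OF w])
  have en: "energy (iter n w) = energy w" for n
  proof (rule antisym)
    show "energy (iter n w) \<le> energy w" by (rule energy_iter_le[OF wb])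
    show "energy w \<le> energy (iter n w)"
    proof (rule field_le_epsilon)
      fix e :: real assume e: "e > 0"
      obtain l where l: "l \<ge> n" "dist1 (iter l w) w \<le> e / 2" using rec[of "e/2" n] e by auto
      have "energy w - energy (iter l w) \<le> 2 * dist1 (iter l w) w"
        by (rule energy_diff_le[OF iter_unit_ball[OF w] w])
      moreover have "energy (iter l w) = energy (iter (l - n) (iter n w))"
        by (rule energy_cong) (use iter_comp[OF wb, of _ "l - n" n] l in simp)
      moreover have "\<dots> \<le> energy (iter n w)" by (rule energy_iter_le[OF iter_bfun[OF wb]])
      ultimately show "energy w \<le> energy (iter n w) + e" using l by linarith
    qed
  qed
  have "AE x in \<pi>. AE y in nst n x. iter k w y = iter (n + k) w x" for n k
  proof -
    have c: "iter n (iter k w) x = iter (n + k) w x" if "x \<in> space S" for x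
      using iter_comp[OF wb that] by simp
    have "energy (iter n (iter k w)) = energy (iter (n + k) w)" by (rule energy_cong[OF c])
    then have "energy (iter n (iter k w)) = energy (iter k w)" by (simp only: en)
    from energy_eq_imp_deterministic[OF iter_bfun[OF wb] this] show ?thesis
      by (rule AE_mono_space) (simp only: c space_pi)
  qed
  then show ?thesis by (subst AE_all_countable, intro allI, subst AE_all_countable, intro allI)
qed

end

section \<open>Cyclic classes\<close>

text \<open>With truncated subtraction the claim is trivial for \<open>j < i\<close>, so it can be
  applied in both orders without a case distinction.\<close>

lemma dvd_diff_of_mod_eq:
  fixes i j d :: nat
  assumes "i mod d = j mod d" shows "d dvd j - i"
proof (cases "i \<le> j")
  case True
  then show ?thesis using assms mod_eq_dvd_iff_nat[OF True, of d] by simp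
qed simp

context stationary_irreducible_chain
begin

text \<open>
  A cyclic decomposition up to null sets, indexed by all natural numbers with period \<open>d\<close>.
\<close>

definition ae_cycle :: "nat \<Rightarrow> (nat \<Rightarrow> 'a set) \<Rightarrow> bool" where
  "ae_cycle d Z \<longleftrightarrow> d \<ge> 1 \<and> (\<forall>j. Z j \<in> sets S) \<and> (\<forall>j. Z (j + d) = Z j) \<and> disjoint_family_on Z {..<d} \<and>
    (\<forall>j. emeasure \<pi> (Z j) > 0) \<and> (AE y in \<pi>. \<forall>j. y \<in> Z j \<longrightarrow> (AE z in K y. z \<in> Z (Suc j)))"

lemma ae_cycle_mod: "ae_cycle d Z \<Longrightarrow> Z j = Z (j mod d)"
proof -
  assume "ae_cycle d Z"
  then have p: "Z (i + d) = Z i" for i by (simp add: ae_cycle_def)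
  have "Z (i + k * d) = Z i" for i k
    by (induction k) (simp_all add: add.assoc[symmetric] p add.commute[of d])
  from this[of "j mod d" "j div d"] show ?thesis by (simp add: mod_div_mult_eq)
qed

lemma ae_cycle_disjoint:
  assumes "ae_cycle d Z" "y \<in> Z i" "y \<in> Z j"
  shows "i mod d = j mod d"
proof (rule ccontr)
  assume ne: "i mod d \<noteq> j mod d"
  have "d > 0" "disjoint_family_on Z {..<d}" using assms(1) by (auto simp: ae_cycle_def)
  then have "Z (i mod d) \<inter> Z (j mod d) = {}"
    using ne by (intro disjoint_family_onD) auto
  then show False using assms ae_cycle_mod[OF assms(1)] by blast
qed

text \<open>By stationarity the measure of \<open>B\<close> is the average chance of entering
  \<open>B\<close>, which is 1 from almost every point of \<open>A\<close>.\<close>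

lemma emeasure_mono_step:
  assumes [measurable]: "A \<in> sets S" "B \<in> sets S"
    and ae: "AE y in \<pi>. y \<in> A \<longrightarrow> (AE z in K y. z \<in> B)"
  shows "emeasure \<pi> A \<le> emeasure \<pi> B"
proof -
  have "emeasure \<pi> A = (\<integral>\<^sup>+y. indicator A y \<partial>\<pi>)" by (simp add: sets_pi)
  also have "\<dots> \<le> (\<integral>\<^sup>+y. (\<integral>\<^sup>+z. indicator B z \<partial>nst (Suc 0) y) \<partial>\<pi>)"
  proof (rule nn_integral_mono_AE, rule AE_mono_space[OF ae])
    fix y assume "y \<in> space \<pi>" and *: "y \<in> A \<longrightarrow> (AE z in K y. z \<in> B)"
    then have y: "y \<in> space S" by (simp add: space_pi)
    interpret prob_space "nst (Suc 0) y" by (rule prob_space_nstep[OF y])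
    show "(indicator A y :: ennreal) \<le> (\<integral>\<^sup>+z. indicator B z \<partial>nst (Suc 0) y)"
    proof (cases "y \<in> A")
      case True
      then have "AE z in nst (Suc 0) y. z \<in> B" using * by (simp only: AE_nstep_1[OF y])
      then have "emeasure (nst (Suc 0) y) B = 1"
        by (intro emeasure_eq_1_AE) (simp_all only: sets_nstep[OF y] assms)
      then have "(\<integral>\<^sup>+z. indicator B z \<partial>nst (Suc 0) y) = 1"
        by (subst nn_integral_indicator) (simp_all only: sets_nstep[OF y] assms)
      then show ?thesis by (simp add: indicator_def del: nn_integral_indicator nstep.simps)
    qed simp
  qed
  also have "\<dots> = (\<integral>\<^sup>+y. indicator B y \<partial>\<pi>)" by (rule nn_integral_pi_nstep) simp
  also have "\<dots> = emeasure \<pi> B" by (simp add: sets_pi)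
  finally show ?thesis .
qed

text \<open>The union of the classes has positive measure and is absorbing up to a null set.\<close>

lemma ae_cycle_UN:
  assumes "ae_cycle d Z"
  shows "AE y in \<pi>. \<exists>j<d. y \<in> Z j"
proof -
  have [measurable]: "Z j \<in> sets S" for j using assms by (simp add: ae_cycle_def)
  have d: "d \<ge> 1" using assms by (simp add: ae_cycle_def)
  have U: "y \<in> Z j \<Longrightarrow> y \<in> (\<Union>j<d. Z j)" for y j
    using d by (subst (asm) ae_cycle_mod[OF assms]) (auto intro!: bexI[of _ "j mod d"])
  have "AE y in \<pi>. y \<in> (\<Union>j<d. Z j)"
  proof (rule AE_pi_absorbing)
    have "emeasure \<pi> (Z 0) > 0" using assms by (simp add: ae_cycle_def)
    also have "emeasure \<pi> (Z 0) \<le> emeasure \<pi> (\<Union>j<d. Z j)"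
      using U[of _ 0] by (intro emeasure_mono) (auto simp: sets_pi)
    finally show "emeasure \<pi> (\<Union>j<d. Z j) > 0" .
    have "AE y in \<pi>. \<forall>j. y \<in> Z j \<longrightarrow> (AE z in K y. z \<in> Z (Suc j))"
      using assms by (simp add: ae_cycle_def)
    then show "AE y in \<pi>. y \<in> (\<Union>j<d. Z j) \<longrightarrow> (AE z in K y. z \<in> (\<Union>j<d. Z j))"
    proof (rule AE_mono_space, intro impI)
      fix y assume *: "\<forall>j. y \<in> Z j \<longrightarrow> (AE z in K y. z \<in> Z (Suc j))" and "y \<in> (\<Union>j<d. Z j)"
      then obtain j where "y \<in> Z j" by blast
      with * have "AE z in K y. z \<in> Z (Suc j)" by blast
      then show "AE z in K y. z \<in> (\<Union>j<d. Z j)" by (rule AE_mono_space) (rule U)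
    qed
  qed measurable
  then show ?thesis by (rule AE_mono_space) auto
qed

lemma measure_kernel_eq_1_iff:
  assumes x: "x \<in> space S" and A: "A \<in> sets S"
  shows "measure (K x) A = 1 \<longleftrightarrow> (AE y in K x. y \<in> A)"
proof -
  interpret prob_space "K x" by (rule prob_space_kernel[OF x])
  show ?thesis using prob_eq_1[of A] A by (simp add: sets_kernel[OF x])
qed

text \<open>Each class is intersected with an absorbing set of full measure that avoids the
  exceptional null set of the transitions. Absorption keeps the transition probabilities equal to 1,
  now from every point of the class.\<close>

lemma ae_cycle_imp_cyclic_decomposition:
  assumes Z: "ae_cycle d Z"
  shows "\<exists>X. cyclic_decomposition S K \<pi> d X"
proof -
  have d: "d \<ge> 1" and Zm[measurable]: "\<And>j. Z j \<in> sets S" and pos: "\<And>j. emeasure \<pi> (Z j) > 0"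
    using Z by (simp_all add: ae_cycle_def)
  have "AE y in \<pi>. \<forall>j. y \<in> Z j \<longrightarrow> (AE z in K y. z \<in> Z (Suc j))"
    using Z by (simp add: ae_cycle_def)
  then obtain N where N: "{y \<in> space \<pi>. \<not> (\<forall>j. y \<in> Z j \<longrightarrow> (AE z in K y. z \<in> Z (Suc j)))} \<subseteq> N"
    "emeasure \<pi> N = 0" "N \<in> sets \<pi>"
    by (auto elim!: AE_E)
  then have "N \<in> null_sets \<pi>" by auto
  then obtain H where H: "H \<in> sets S" "H \<inter> N = {}" "AE x in \<pi>. x \<in> H" "\<And>x. x \<in> H \<Longrightarrow> AE y in K x. y \<in> H"
    by (rule absorbing_avoiding_null_set) blast
  note [measurable] = H(1)
  have Hs: "x \<in> H \<Longrightarrow> x \<in> space S" for x using sets.sets_into_space[OF H(1)] by auto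
  define X where "X j = Z j \<inter> H" for j
  have Xm: "X j \<in> sets S" for j unfolding X_def by measurable
  have step: "measure (K x) (X (Suc j)) = 1" if "x \<in> X j" for x j
  proof -
    have x: "x \<in> Z j" "x \<in> H" using that by (auto simp: X_def)
    then have "AE z in K x. z \<in> Z (Suc j)"
      using N(1) H(2) Hs[OF x(2)] by (auto simp: space_pi)
    with H(4)[OF x(2)] have "AE z in K x. z \<in> X (Suc j)"
      by eventually_elim (simp add: X_def)
    then show ?thesis by (subst measure_kernel_eq_1_iff[OF Hs[OF x(2)] Xm])
  qed
  \<comment> \<open>The classes of a decomposition are numbered from 1 to \<open>d\<close>;
    periodicity closes the cycle from \<open>d\<close> back to 1.\<close>
  have Xd: "X (Suc d) = X 1" using Z unfolding X_def ae_cycle_def by (metis add.commute plus_1_eq_Suc)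
  show ?thesis
  proof (intro exI[of _ X], unfold cyclic_decomposition_def, intro conjI ballI)
    show "disjoint_family_on X {1..d}"
      unfolding disjoint_family_on_def
    proof (intro ballI impI)
      fix i j assume ij: "i \<in> {1..d}" "j \<in> {1..d}" "i \<noteq> j"
      show "X i \<inter> X j = {}"
      proof (rule ccontr)
        assume "X i \<inter> X j \<noteq> {}"
        then obtain y where "y \<in> Z i" "y \<in> Z j" by (auto simp: X_def)
        then have "i mod d = j mod d" by (rule ae_cycle_disjoint[OF Z])
        then have "d dvd j - i" "d dvd i - j" by (simp_all add: dvd_diff_of_mod_eq)
        moreover have "j - i < d" "i - j < d" "0 < j - i \<or> 0 < i - j" using ij by auto
        ultimately show False using nat_dvd_not_less by blast
      qed
    qed
    fix i assume "i \<in> {1..d}"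
    show "X i \<in> sets S" by (rule Xm)
    have "emeasure \<pi> (Z i) = emeasure \<pi> (X i)"
      by (rule emeasure_eq_AE) (use H(3) in \<open>auto simp: X_def sets_pi elim!: AE_mono_space\<close>)
    then show "0 < measure \<pi> (X i)"
      using pos[of i] by (simp add: pi.emeasure_eq_measure)
  next
    fix i x assume "x \<in> X i"
    then show "measure (K x) (X (Suc i)) = 1" by (rule step)
  next
    fix x assume "x \<in> X d"
    then show "measure (K x) (X 1) = 1" using step[of x d] by (simp only: Xd)
  qed
qed

lemma cyclic_decomposition_imp_ae_cycle:
  assumes X: "cyclic_decomposition S K \<pi> d X" and d: "d \<ge> 1"
  shows "ae_cycle d (\<lambda>j. X (Suc (j mod d)))"
  unfolding ae_cycle_def
proof (intro conjI allI)
  have in_range: "Suc (j mod d) \<in> {1..d}" for j using d by (auto simp: Suc_le_eq)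
  have Xm: "X i \<in> sets S" "measure \<pi> (X i) > 0" if "i \<in> {1..d}" for i
    using X that by (auto simp: cyclic_decomposition_def)
  show "X (Suc (j mod d)) \<in> sets S" for j by (rule Xm[OF in_range])
  show "0 < emeasure \<pi> (X (Suc (j mod d)))" for j
    using Xm(2)[OF in_range] by (simp add: pi.emeasure_eq_measure)
  show "disjoint_family_on (\<lambda>j. X (Suc (j mod d))) {..<d}"
    unfolding disjoint_family_on_def
  proof (intro ballI impI)
    fix i j assume "i \<in> {..<d}" "j \<in> {..<d}" "i \<noteq> j"
    then show "X (Suc (i mod d)) \<inter> X (Suc (j mod d)) = {}"
      using X in_range[of i] in_range[of j]
      by (intro disjoint_family_onD[of X "{1..d}"]) (auto simp: cyclic_decomposition_def)
  qed
  show "AE y in \<pi>. \<forall>j. y \<in> X (Suc (j mod d)) \<longrightarrow> (AE z in K y. z \<in> X (Suc (Suc j mod d)))"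
  proof (rule AE_I2, intro allI impI)
    fix y j assume y: "y \<in> X (Suc (j mod d))"
    have ys: "y \<in> space S" using y sets.sets_into_space[OF Xm(1)[OF in_range[of j]]] by blast
    have "measure (K y) (X (Suc (Suc j mod d))) = 1"
    proof (cases "Suc (j mod d) = d")
      case True
      then have "Suc j mod d = 0" by (simp add: mod_Suc)
      then show ?thesis using X y True by (simp add: cyclic_decomposition_def)
    next
      case False
      then have "Suc j mod d = Suc (j mod d)" by (simp add: mod_Suc)
      moreover have "Suc (j mod d) \<in> {1..<d}" using in_range[of j] False by auto
      ultimately show ?thesis using X y by (simp add: cyclic_decomposition_def)
    qed
    then show "AE z in K y. z \<in> X (Suc (Suc j mod d))"
      by (subst (asm) measure_kernel_eq_1_iff[OF ys Xm(1)[OF in_range]])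
  qed
qed (use d in simp_all)

text \<open>Intersect the two cycles moving in step, after an offset \<open>a\<close> at which
  \<open>X a\<close> and \<open>Z 0\<close> overlap in positive measure. Overlap then persists,
  because the measures of successive intersections cannot decrease. A point common to the
  intersections at times \<open>i\<close> and \<open>j\<close> forces \<open>i\<close> and
  \<open>j\<close> to agree modulo both periods.\<close>

lemma ae_cycle_lcm:
  assumes X: "ae_cycle D X" and Z: "ae_cycle d Z"
  obtains U where "ae_cycle (lcm D d) U"
proof -
  note [measurable] = X[unfolded ae_cycle_def, THEN conjunct2, THEN conjunct1, rule_format]
    Z[unfolded ae_cycle_def, THEN conjunct2, THEN conjunct1, rule_format]
  have D: "D \<ge> 1" and d: "d \<ge> 1" using X Z by (simp_all add: ae_cycle_def)
  obtain a where a: "emeasure \<pi> (X a \<inter> Z 0) > 0"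
  proof (rule ccontr)
    assume no: "\<not> thesis"
    then have 0: "emeasure \<pi> (X a \<inter> Z 0) = 0" for a
      using that zero_less_iff_neq_zero by blast
    have "AE y in \<pi>. y \<notin> X a \<inter> Z 0" for a
      by (rule AE_not_in) (use 0[of a] in \<open>auto simp: null_sets_def sets_pi\<close>)
    then have "AE y in \<pi>. \<forall>a. y \<notin> X a \<inter> Z 0" by (subst AE_all_countable) blast
    with ae_cycle_UN[OF X] have "AE y in \<pi>. y \<notin> Z 0"
      by eventually_elim blast
    then have "emeasure \<pi> (Z 0) = 0"
      using sets.sets_into_space[of "Z 0" S] by (subst (asm) AE_iff_measurable[of "Z 0"]) (auto simp: sets_pi space_pi)
    moreover have "emeasure \<pi> (Z 0) > 0" using Z unfolding ae_cycle_def by blast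
    ultimately show False by simp
  qed
  define U where "U j = X (a + j) \<inter> Z j" for j
  have Um[measurable]: "U j \<in> sets S" for j unfolding U_def by measurable
  have "AE y in \<pi>. (\<forall>j. y \<in> X j \<longrightarrow> (AE z in K y. z \<in> X (Suc j))) \<and> (\<forall>j. y \<in> Z j \<longrightarrow> (AE z in K y. z \<in> Z (Suc j)))"
    by (rule AE_conjI) (use X Z in \<open>simp_all add: ae_cycle_def\<close>)
  then have ae: "AE y in \<pi>. \<forall>j. y \<in> U j \<longrightarrow> (AE z in K y. z \<in> U (Suc j))"
  proof (rule AE_mono_space, intro allI impI)
    fix y j assume *: "(\<forall>j. y \<in> X j \<longrightarrow> (AE z in K y. z \<in> X (Suc j))) \<and> (\<forall>j. y \<in> Z j \<longrightarrow> (AE z in K y. z \<in> Z (Suc j)))"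
      and "y \<in> U j"
    then have "AE z in K y. z \<in> X (Suc (a + j))" "AE z in K y. z \<in> Z (Suc j)"
      by (auto simp: U_def)
    then show "AE z in K y. z \<in> U (Suc j)" by eventually_elim (simp add: U_def)
  qed
  have pos: "emeasure \<pi> (U j) > 0" for j
  proof (induction j)
    case 0 then show ?case using a by (simp add: U_def)
  next
    case (Suc j)
    have "emeasure \<pi> (U j) \<le> emeasure \<pi> (U (Suc j))"
      by (rule emeasure_mono_step[OF Um Um]) (rule AE_mono_space[OF ae], blast)
    with Suc show ?case by (rule less_le_trans)
  qed
  show thesis
  proof (rule that[of U], unfold ae_cycle_def, intro conjI allI)
    show "1 \<le> lcm D d" using D d by (simp add: Suc_le_eq lcm_pos_nat)
    have p: "X (i + lcm D d) = X i \<and> Z (i + lcm D d) = Z i" for i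
    proof
      have m: "(i + t) mod q = i mod q" if "q dvd t" for t q :: nat
        using that by (elim dvdE) (simp only: mod_mult_self2)
      show "X (i + lcm D d) = X i"
        using ae_cycle_mod[OF X, of "i + lcm D d"] ae_cycle_mod[OF X, of i] m[OF dvd_lcm1[of D d]]
        by (simp only:)
      show "Z (i + lcm D d) = Z i"
        using ae_cycle_mod[OF Z, of "i + lcm D d"] ae_cycle_mod[OF Z, of i] m[OF dvd_lcm2[of d D]]
        by (simp only:)
    qed
    show "U (j + lcm D d) = U j" for j unfolding U_def add.assoc[symmetric] using p by blast
    show "disjoint_family_on U {..<lcm D d}"
      unfolding disjoint_family_on_def
    proof (intro ballI impI)
      fix i j assume ij: "i \<in> {..<lcm D d}" "j \<in> {..<lcm D d}" "i \<noteq> j"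
      show "U i \<inter> U j = {}"
      proof (rule ccontr)
        assume "U i \<inter> U j \<noteq> {}"
        then obtain y where y: "y \<in> U i" "y \<in> U j" by blast
        then have mem: "y \<in> X (a + i)" "y \<in> X (a + j)" "y \<in> Z i" "y \<in> Z j" by (auto simp: U_def)
        have "(a + i) mod D = (a + j) mod D" by (rule ae_cycle_disjoint[OF X mem(1,2)])
        moreover have "i mod d = j mod d" by (rule ae_cycle_disjoint[OF Z mem(3,4)])
        ultimately have "D dvd j - i" "D dvd i - j" "d dvd j - i" "d dvd i - j"
          using dvd_diff_of_mod_eq[of "a + i" D "a + j"] dvd_diff_of_mod_eq[of "a + j" D "a + i"]
          by (simp_all add: dvd_diff_of_mod_eq)
        then have "lcm D d dvd j - i" "lcm D d dvd i - j" by (simp_all add: lcm_least)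
        moreover have "j - i < lcm D d" "i - j < lcm D d" "0 < j - i \<or> 0 < i - j" using ij by auto
        ultimately show False using nat_dvd_not_less by blast
      qed
    qed
  qed (use pos ae Um in auto)
qed

text \<open>A cycle of length \<open>lcm D d\<close> exists, and the maximality of \<open>D\<close>
  forces this length to be \<open>D\<close>.\<close>

lemma ae_cycle_dvd_period:
  assumes period: "is_period S K \<pi> D" and Z: "ae_cycle d Z"
  shows "d dvd D"
proof -
  have D: "D \<ge> 1" and max: "\<And>D' X. D' \<ge> 1 \<Longrightarrow> cyclic_decomposition S K \<pi> D' X \<Longrightarrow> D' \<le> D"
    using period unfolding is_period_def by blast+
  obtain X where X: "cyclic_decomposition S K \<pi> D X"
    using period unfolding is_period_def by blast
  obtain U where U: "ae_cycle (lcm D d) U"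
    by (rule ae_cycle_lcm[OF cyclic_decomposition_imp_ae_cycle[OF X D] Z])
  then have pos: "lcm D d \<ge> 1" unfolding ae_cycle_def by (rule conjunct1)
  obtain Y where "cyclic_decomposition S K \<pi> (lcm D d) Y"
    using ae_cycle_imp_cyclic_decomposition[OF U] by blast
  then have "lcm D d \<le> D" by (rule max[OF pos])
  moreover have "D \<le> lcm D d" using pos by (intro dvd_imp_le dvd_lcm1) simp
  ultimately have "lcm D d = D" by (rule antisym)
  then show ?thesis using dvd_lcm2[of d D] by (simp only:)
qed

text \<open>From one good \<open>x\<close> the chain is almost surely in \<open>A n\<close> at time
  \<open>n\<close>, so by irreducibility the sets \<open>A n\<close> cover almost everything and
  some \<open>A n0\<close> has positive mass. Masses do not decrease from \<open>A j\<close> to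
  \<open>A (Suc j)\<close>, so the sets after \<open>n0\<close> cannot all be disjoint in a
  probability space. A coincidence makes \<open>\<eta>\<close> periodic from some index on, and the
  sets over a least period are the classes.\<close>

lemma deterministic_imp_cyclic:
  assumes w: "w \<in> unit_ball"
    and det: "AE x in \<pi>. \<forall>n k. AE y in nst n x. iter k w y = iter (n + k) w x"
  obtains d Z \<theta> where "ae_cycle d Z" "\<And>j y k. y \<in> Z j \<Longrightarrow> iter k w y = \<theta> (j + k)" "\<And>j. \<theta> (j + d) = \<theta> j"
proof -
  note [measurable] = iter_measurable[OF unit_ball_measurable[OF w]]
  obtain x where x: "x \<in> space S" and dx: "\<And>n k. AE y in nst n x. iter k w y = iter (n + k) w x"
  proof -
    obtain x where "x \<in> space \<pi>" "\<forall>n k. AE y in nst n x. iter k w y = iter (n + k) w x"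
      by (rule pi.AE_obtain[OF det])
    then show thesis by (intro that) (simp only: space_pi, blast)
  qed
  define \<eta> where "\<eta> k = iter k w x" for k
  \<comment> \<open>\<open>A j\<close> collects the states whose sequence of values is that of
    \<open>x\<close> after \<open>j\<close> steps; two such sets meet only if the corresponding
    shifts of \<open>\<eta>\<close> coincide.\<close>
  define A where "A j = {y \<in> space S. \<forall>k. iter k w y = \<eta> (j + k)}" for j
  have Am[measurable]: "A j \<in> sets S" for j unfolding A_def by measurable
  have in_A: "AE y in nst n x. y \<in> A n" for n
  proof -
    have "AE y in nst n x. \<forall>k. iter k w y = \<eta> (n + k)"
      unfolding AE_all_countable \<eta>_def by (intro allI dx)
    then show ?thesis by (rule AE_mono_space) (simp add: A_def space_nstep[OF x])
  qed
  have stepA: "AE y in \<pi>. \<forall>j. y \<in> A j \<longrightarrow> (AE z in K y. z \<in> A (Suc j))"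
    using det
  proof (rule AE_mono_space, intro allI impI)
    fix y j assume "y \<in> space \<pi>" and *: "\<forall>n k. AE z in nst n y. iter k w z = iter (n + k) w y" and yA: "y \<in> A j"
    then have y: "y \<in> space S" by (simp add: space_pi)
    have "AE z in K y. \<forall>k. iter k w z = iter (Suc 0 + k) w y"
      unfolding AE_all_countable AE_nstep_1[OF y, symmetric] using * by blast
    then show "AE z in K y. z \<in> A (Suc j)"
      by (rule AE_mono_space) (use yA in \<open>simp add: A_def space_kernel[OF y]\<close>)
  qed
  have "AE y in \<pi>. y \<in> (\<Union>n. A n)"
    by (rule AE_pi_of_AE_nstep[OF x]) (measurable, rule AE_mono_space[OF in_A], blast)
  have "\<exists>n0. emeasure \<pi> (A n0) > 0"
  proof (rule ccontr)
    assume "\<not> ?thesis"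
    then have "(\<Union>n. A n) \<in> null_sets \<pi>"
      by (intro null_sets_UN) (auto simp: null_sets_def sets_pi zero_less_iff_neq_zero)
    from AE_not_in[OF this] \<open>AE y in \<pi>. y \<in> (\<Union>n. A n)\<close> have "AE y in \<pi>. False"
      by eventually_elim blast
    then show False by simp
  qed
  then obtain n0 where n0: "emeasure \<pi> (A n0) > 0" by blast
  have mono: "emeasure \<pi> (A j) \<le> emeasure \<pi> (A (Suc j))" for j
    by (rule emeasure_mono_step[OF Am Am]) (rule AE_mono_space[OF stepA], blast)
  have ge: "emeasure \<pi> (A n0) \<le> emeasure \<pi> (A (n0 + i))" for i
    by (induction i) (auto intro: order_trans[OF _ mono])
  \<comment> \<open>The bound \<open>i \<ge> n0\<close> ensures that the sets \<open>A j\<close>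
    from there on have positive mass. Choosing the least \<open>d\<close> later makes the classes
    within one period disjoint.\<close>
  define Q where "Q d \<longleftrightarrow> d \<ge> 1 \<and> (\<exists>i\<ge>n0. \<forall>k. \<eta> (i + k) = \<eta> (i + d + k))" for d
  have meet: "\<eta> (i + k) = \<eta> (j + k)" if "y \<in> A i" "y \<in> A j" for y i j k
    using that by (simp add: A_def)
  have "\<exists>d. Q d"
  proof (rule ccontr)
    assume no: "\<nexists>d. Q d"
    have disj: "A i \<inter> A j = {}" if "i \<ge> n0" "i < j" for i j
    proof (rule ccontr)
      assume "A i \<inter> A j \<noteq> {}"
      then obtain y where y: "y \<in> A i" "y \<in> A j" by blast
      have "i + (j - i) = j" "1 \<le> j - i" using that by linarith+
      then have "Q (j - i)"
        unfolding Q_def using that(1) meet[OF y] by metis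
      then show False using no by blast
    qed
    have d: "disjoint_family_on (\<lambda>i. A (n0 + i)) {..<N}" for N
      unfolding disjoint_family_on_def
    proof (intro ballI impI)
      fix i j :: nat assume "i \<noteq> j"
      then show "A (n0 + i) \<inter> A (n0 + j) = {}"
        using disj[of "n0 + i" "n0 + j"] disj[of "n0 + j" "n0 + i"] by (cases "i < j") auto
    qed
    define c where "c = measure \<pi> (A n0)"
    have c: "c > 0" using n0 by (simp add: c_def pi.emeasure_eq_measure)
    have "real N * c \<le> 1" for N
    proof -
      have "real N * c = (\<Sum>i<N. c)" by simp
      also have "\<dots> \<le> (\<Sum>i<N. measure \<pi> (A (n0 + i)))"
        using ge by (intro sum_mono) (simp add: c_def pi.emeasure_eq_measure)
      also have "\<dots> = measure \<pi> (\<Union>i<N. A (n0 + i))"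
        by (rule pi.finite_measure_finite_Union[symmetric]) (use d in \<open>auto simp: sets_pi\<close>)
      also have "\<dots> \<le> 1" by (rule pi.prob_le_1)
      finally show ?thesis .
    qed
    moreover obtain N :: nat where N: "1 / c < real N" using reals_Archimedean2 by blast
    from N c have "1 < real N * c" by (simp only: pos_divide_less_eq)
    ultimately show False by (meson not_le)
  qed
  then obtain d where Qd: "Q d" and least: "\<And>d'. d' < d \<Longrightarrow> \<not> Q d'"
    using LeastI_ex[of Q] not_less_Least[of _ Q] by blast
  obtain i where d1: "d \<ge> 1" and i: "i \<ge> n0" "\<And>k. \<eta> (i + k) = \<eta> (i + d + k)"
    using Qd unfolding Q_def by blast
  \<comment> \<open>\<open>\<eta>\<close> restarted at an index from which it has period
    \<open>d\<close>.\<close>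
  define \<theta> where "\<theta> k = \<eta> (i + k)" for k
  have \<theta>: "\<theta> (j + d) = \<theta> j" for j
    using i(2)[of j] by (simp add: \<theta>_def add_ac)
  define Z where "Z j = A (i + j)" for j
  have "ae_cycle d Z"
    unfolding ae_cycle_def
  proof (intro conjI allI d1)
    show "Z j \<in> sets S" for j unfolding Z_def by (rule Am)
    show "Z (j + d) = Z j" for j
    proof -
      have "\<eta> (i + (j + d) + k) = \<eta> (i + j + k)" for k
        using \<theta>[of "j + k"] by (simp add: \<theta>_def add_ac)
      then show ?thesis unfolding Z_def A_def by simp
    qed
    show "emeasure \<pi> (Z j) > 0" for j
      using n0 ge[of "i + j - n0"] i(1) by (simp add: Z_def)
    show "AE y in \<pi>. \<forall>j. y \<in> Z j \<longrightarrow> (AE z in K y. z \<in> Z (Suc j))"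
      using stepA by (rule AE_mono_space) (simp add: Z_def)
    have disj: "Z a \<inter> Z b = {}" if "a < b" "b < d" for a b
    proof (rule ccontr)
      assume "Z a \<inter> Z b \<noteq> {}"
      then obtain y where y: "y \<in> A (i + a)" "y \<in> A (i + b)" by (auto simp: Z_def)
      have "i + a + (b - a) = i + b" "1 \<le> b - a" "i + a \<ge> n0" using that i(1) by linarith+
      then have "Q (b - a)"
        unfolding Q_def using meet[OF y] by metis
      then show False using least[of "b - a"] that by simp
    qed
    show "disjoint_family_on Z {..<d}"
      unfolding disjoint_family_on_def
    proof (intro ballI impI)
      fix a b assume "a \<in> {..<d}" "b \<in> {..<d}" "a \<noteq> b"
      then show "Z a \<inter> Z b = {}"
        using disj[of a b] disj[of b a] by (cases "a < b") auto
    qed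
  qed
  moreover have "iter k w y = \<theta> (j + k)" if "y \<in> Z j" for j y k
    using that by (simp add: Z_def A_def \<theta>_def add.assoc)
  ultimately show thesis using \<theta> by (rule that)
qed

section \<open>Convergence of the averages over a period\<close>

definition cycle_defect :: "nat \<Rightarrow> ('a \<Rightarrow> real) \<Rightarrow> 'a \<Rightarrow> real" where
  "cycle_defect D f x = (1 / real D) * (\<Sum>r=1..D. iter r f x) - (\<integral>y. f y \<partial>\<pi>)"

lemma cycle_defect_bfun:
  assumes f: "f \<in> bfun" shows "cycle_defect D f \<in> bfun"
  unfolding cycle_defect_def[abs_def] by (intro bfun_diff bfun_mult bfun_const bfun_sum iter_bfun f)

lemma cycle_defect_abs_le:
  assumes f: "f \<in> unit_ball" and x: "x \<in> space S" and D: "D \<ge> 1"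
  shows "\<bar>cycle_defect D f x\<bar> \<le> 2"
proof -
  have b: "\<bar>iter r f x\<bar> \<le> 1" for r using iter_unit_ball[OF f] x by (simp add: unit_ball_def)
  have "\<bar>\<Sum>r=1..D. iter r f x\<bar> \<le> (\<Sum>r=1..D. \<bar>iter r f x\<bar>)" by (rule sum_abs)
  also have "\<dots> \<le> (\<Sum>r=1..D. 1)" by (intro sum_mono b)
  finally have "\<bar>(1 / real D) * (\<Sum>r=1..D. iter r f x)\<bar> \<le> 1"
    using D by (simp add: abs_mult field_simps)
  moreover have "\<bar>\<integral>y. f y \<partial>\<pi>\<bar> \<le> 1"
    using integral_indicator_le_1[OF f sets.top] f
    by (simp add: space_pi[symmetric] cong: Bochner_Integration.integral_cong)
  ultimately show ?thesis unfolding cycle_defect_def by linarith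
qed

lemma cycle_defect_iter:
  assumes f: "f \<in> bfun" and x: "x \<in> space S"
  shows "cycle_defect D (iter n f) x = iter n (cycle_defect D f) x"
proof -
  have c: "iter r (iter n f) x = iter n (iter r f) x" for r
    using iter_comp[OF f x, of r n] iter_comp[OF f x, of n r] by (simp add: add.commute)
  have "iter n (cycle_defect D f) x = iter n (\<lambda>x. (1 / real D) * (\<Sum>r=1..D. iter r f x)) x - iter n (\<lambda>x. \<integral>y. f y \<partial>\<pi>) x"
    unfolding cycle_defect_def[abs_def] by (intro iter_diff bfun_intros iter_bfun f x)
  also have "iter n (\<lambda>x. (1 / real D) * (\<Sum>r=1..D. iter r f x)) x = (1 / real D) * (\<Sum>r=1..D. iter n (iter r f) x)"
    unfolding iter_cmult by (subst iter_sum[OF iter_bfun[OF f] x]) simp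
  also have "iter n (\<lambda>x. \<integral>y. f y \<partial>\<pi>) x = (\<integral>y. f y \<partial>\<pi>)" by (rule iter_const[OF x])
  finally show ?thesis unfolding cycle_defect_def[of D "iter n f"] c integral_iter[OF f] by simp
qed

text \<open>One copy of \<open>dist1 f g\<close> bounds the difference of the averages, since every
  iterate is a contraction; the other bounds the difference of the two means.\<close>

lemma cycle_defect_L1_le:
  assumes f: "f \<in> bfun" and g: "g \<in> bfun" and D: "D \<ge> 1"
  shows "(\<integral>x. \<bar>cycle_defect D f x\<bar> \<partial>\<pi>) \<le> (\<integral>x. \<bar>cycle_defect D g x\<bar> \<partial>\<pi>) + 2 * dist1 f g"
proof -
  have "(\<integral>x. \<bar>cycle_defect D f x\<bar> \<partial>\<pi>)
     \<le> (\<integral>x. \<bar>cycle_defect D g x\<bar> + ((1 / real D) * (\<Sum>r=1..D. \<bar>iter r f x - iter r g x\<bar>) + dist1 f g) \<partial>\<pi>)"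
  proof (rule integral_mono)
    fix x assume "x \<in> space \<pi>"
    have "cycle_defect D f x - cycle_defect D g x
        = (1 / real D) * (\<Sum>r=1..D. iter r f x - iter r g x) - ((\<integral>y. f y \<partial>\<pi>) - (\<integral>y. g y \<partial>\<pi>))"
      unfolding cycle_defect_def sum_subtractf right_diff_distrib by simp
    moreover have "\<bar>(1 / real D) * (\<Sum>r=1..D. iter r f x - iter r g x)\<bar> \<le> (1 / real D) * (\<Sum>r=1..D. \<bar>iter r f x - iter r g x\<bar>)"
      unfolding abs_mult by (intro mult_mono sum_abs) auto
    ultimately show "\<bar>cycle_defect D f x\<bar> \<le> \<bar>cycle_defect D g x\<bar> + ((1 / real D) * (\<Sum>r=1..D. \<bar>iter r f x - iter r g x\<bar>) + dist1 f g)"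
      using integral_diff_le_dist1[OF f g] by linarith
  qed (intro integrable_pi bfun_intros cycle_defect_bfun iter_bfun f g)+
  also have "\<dots> = (\<integral>x. \<bar>cycle_defect D g x\<bar> \<partial>\<pi>) + (\<integral>x. (1 / real D) * (\<Sum>r=1..D. \<bar>iter r f x - iter r g x\<bar>) + dist1 f g \<partial>\<pi>)"
    by (intro Bochner_Integration.integral_add integrable_pi bfun_intros cycle_defect_bfun iter_bfun f g)
  also have "(\<integral>x. (1 / real D) * (\<Sum>r=1..D. \<bar>iter r f x - iter r g x\<bar>) + dist1 f g \<partial>\<pi>)
     = (\<integral>x. (1 / real D) * (\<Sum>r=1..D. \<bar>iter r f x - iter r g x\<bar>) \<partial>\<pi>) + (\<integral>x. dist1 f g \<partial>\<pi>)"
    by (intro Bochner_Integration.integral_add integrable_pi bfun_intros iter_bfun f g)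
  also have "(\<integral>x. (1 / real D) * (\<Sum>r=1..D. \<bar>iter r f x - iter r g x\<bar>) \<partial>\<pi>)
     = (1 / real D) * (\<integral>x. (\<Sum>r=1..D. \<bar>iter r f x - iter r g x\<bar>) \<partial>\<pi>)"
    by (rule integral_mult_right_zero)
  also have "(\<integral>x. (\<Sum>r=1..D. \<bar>iter r f x - iter r g x\<bar>) \<partial>\<pi>) = (\<Sum>r=1..D. dist1 (iter r f) (iter r g))"
    unfolding dist1_def by (intro Bochner_Integration.integral_sum integrable_pi bfun_intros iter_bfun f g)
  also have "(\<integral>x. dist1 f g \<partial>\<pi>) = dist1 f g" by (simp add: pi.prob_space)
  finally have *: "(\<integral>x. \<bar>cycle_defect D f x\<bar> \<partial>\<pi>) \<le> (\<integral>x. \<bar>cycle_defect D g x\<bar> \<partial>\<pi>) +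
     ((1 / real D) * (\<Sum>r=1..D. dist1 (iter r f) (iter r g)) + dist1 f g)" .
  have "(\<Sum>r=1..D. dist1 (iter r f) (iter r g)) \<le> (\<Sum>r=1..D. dist1 f g)"
    by (intro sum_mono dist1_iter f g)
  then have "(1 / real D) * (\<Sum>r=1..D. dist1 (iter r f) (iter r g)) \<le> dist1 f g"
    using D by (simp add: field_simps)
  with * show ?thesis by linarith
qed

lemma cycle_defect_L1_iter_le:
  assumes f: "f \<in> bfun"
  shows "(\<integral>x. \<bar>cycle_defect D (iter n f) x\<bar> \<partial>\<pi>) \<le> (\<integral>x. \<bar>cycle_defect D f x\<bar> \<partial>\<pi>)"
proof -
  have "(\<integral>x. \<bar>cycle_defect D (iter n f) x\<bar> \<partial>\<pi>) \<le> (\<integral>x. iter n (\<lambda>x. \<bar>cycle_defect D f x\<bar>) x \<partial>\<pi>)"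
  proof (rule integral_mono)
    fix x assume "x \<in> space \<pi>"
    then have x: "x \<in> space S" by (simp add: space_pi)
    show "\<bar>cycle_defect D (iter n f) x\<bar> \<le> iter n (\<lambda>x. \<bar>cycle_defect D f x\<bar>) x"
      unfolding cycle_defect_iter[OF f x] unfolding iter_def[of n] by (rule integral_abs_bound)
  qed (intro integrable_pi bfun_intros cycle_defect_bfun iter_bfun f)+
  also have "\<dots> = (\<integral>x. \<bar>cycle_defect D f x\<bar> \<partial>\<pi>)"
    by (intro integral_iter bfun_intros cycle_defect_bfun f)
  finally show ?thesis .
qed

text \<open>A shift by one changes the sum by a telescoping difference of two values a period
  apart.\<close>

lemma sum_periodic_shift:
  fixes \<theta> :: "nat \<Rightarrow> real"
  assumes "\<And>j. \<theta> (j + D) = \<theta> j"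
  shows "(\<Sum>r=1..D. \<theta> (j + r)) = (\<Sum>r=1..D. \<theta> r)"
proof (induction j)
  case (Suc j)
  have "(\<Sum>r=1..D. \<theta> (Suc j + r)) = (\<Sum>r=1..D. \<theta> (j + Suc r))" by simp
  also have "\<dots> = (\<Sum>r=1..D. \<theta> (j + r))"
  proof -
    have "(\<Sum>r=1..D. \<theta> (j + Suc r) - \<theta> (j + r)) = \<theta> (j + Suc D) - \<theta> (j + 1)"
      using sum_Suc_diff[of 1 D "\<lambda>r. \<theta> (j + r)"] by simp
    also have "\<dots> = 0" using assms[of "j + 1"] by simp
    finally show ?thesis by (simp add: sum_subtractf)
  qed
  finally show ?case using Suc by simp
qed simp

text \<open>On the class \<open>Z j\<close> the average runs over \<open>D\<close> consecutive
  values of \<open>\<theta>\<close> starting after \<open>j\<close>. Since \<open>d\<close> divides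
  \<open>D\<close>, these are full periods and the result does not depend on
  \<open>j\<close>.\<close>

lemma cycle_defect_deterministic:
  assumes period: "is_period S K \<pi> D" and w: "w \<in> unit_ball"
    and det: "AE x in \<pi>. \<forall>n k. AE y in nst n x. iter k w y = iter (n + k) w x"
  shows "AE x in \<pi>. cycle_defect D w x = 0"
proof -
  obtain d Z \<theta> where Z: "ae_cycle d Z" and \<theta>: "\<And>j y k. y \<in> Z j \<Longrightarrow> iter k w y = \<theta> (j + k)" "\<And>j. \<theta> (j + d) = \<theta> j"
    by (rule deterministic_imp_cyclic[OF w det]) blast
  have "d dvd D" by (rule ae_cycle_dvd_period[OF period Z])
  then obtain m where m: "D = d * m" by blast
  have "\<theta> (j + d * k) = \<theta> j" for j k
    by (induction k) (simp_all add: add.assoc[symmetric] \<theta>(2) add.commute[of d])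
  then have \<theta>D: "\<theta> (j + D) = \<theta> j" for j by (simp add: m)
  define c where "c = (1 / real D) * (\<Sum>r=1..D. \<theta> r)"
  have avg: "AE x in \<pi>. (1 / real D) * (\<Sum>r=1..D. iter r w x) = c"
    using ae_cycle_UN[OF Z]
  proof (rule AE_mono_space)
    fix x assume "\<exists>j<d. x \<in> Z j"
    then obtain j where j: "x \<in> Z j" by blast
    show "(1 / real D) * (\<Sum>r=1..D. iter r w x) = c"
      unfolding c_def \<theta>(1)[OF j] sum_periodic_shift[of \<theta>, OF \<theta>D] ..
  qed
  have wb: "w \<in> bfun" by (rule unit_ball_bfun[OF w])
  have D: "D \<ge> 1" using period by (simp add: is_period_def)
  \<comment> \<open>Stationarity identifies the constant: every summand of the average has the same
    mean as \<open>w\<close>.\<close>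
  have "c = (\<integral>x. c \<partial>\<pi>)" by (simp add: pi.prob_space)
  also have "\<dots> = (\<integral>x. (1 / real D) * (\<Sum>r=1..D. iter r w x) \<partial>\<pi>)"
  proof (rule integral_cong_AE)
    show "AE x in \<pi>. c = 1 / real D * (\<Sum>r = 1..D. iter r w x)"
      using avg by (rule AE_mono_space) (rule sym)
  qed (intro borel_measurable_integrable integrable_pi bfun_intros iter_bfun wb)+
  also have "\<dots> = (1 / real D) * (\<integral>x. (\<Sum>r=1..D. iter r w x) \<partial>\<pi>)"
    by (rule integral_mult_right_zero)
  also have "(\<integral>x. (\<Sum>r=1..D. iter r w x) \<partial>\<pi>) = (\<Sum>r=1..D. (\<integral>x. iter r w x \<partial>\<pi>))"
    by (intro Bochner_Integration.integral_sum integrable_pi iter_bfun wb)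
  also have "\<dots> = real D * (\<integral>x. w x \<partial>\<pi>)" unfolding integral_iter[OF wb] by simp
  finally have "c = (\<integral>x. w x \<partial>\<pi>)" using D by simp
  with avg show ?thesis unfolding cycle_defect_def by (auto elim!: AE_mono_space)
qed

text \<open>Some member of the orbit is close to a limit point, whose defect vanishes almost
  everywhere. The L1 norm of the defect does not increase along the orbit, so one good time takes
  care of all later ones.\<close>

lemma cycle_defect_tendsto_0:
  assumes period: "is_period S K \<pi> D" and f: "f \<in> unit_ball" and e: "e > 0"
  shows "\<exists>m. \<forall>k\<ge>m. (\<integral>x. \<bar>cycle_defect D (iter k f) x\<bar> \<partial>\<pi>) \<le> e"
proof -
  have D: "D \<ge> 1" using period by (simp add: is_period_def)
  have fb: "f \<in> bfun" by (rule unit_ball_bfun[OF f])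
  obtain r :: "nat \<Rightarrow> nat" and w where r: "strict_mono r" and w: "w \<in> unit_ball"
    and lim: "(\<lambda>i. dist1 (iter (r i) f) w) \<longlonglongrightarrow> 0"
    by (rule orbit_limit_point[OF f])
  have "AE x in \<pi>. \<forall>n k. AE y in nst n x. iter k w y = iter (n + k) w x"
    by (rule recurrent_imp_deterministic[OF w]) (metis limit_point_recurrent[OF f w r lim])
  from cycle_defect_deterministic[OF period w this]
  have "(\<integral>x. \<bar>cycle_defect D w x\<bar> \<partial>\<pi>) = (\<integral>x. 0 \<partial>\<pi>)"
    by (intro integral_cong_AE borel_measurable_integrable integrable_pi bfun_intros cycle_defect_bfun unit_ball_bfun[OF w])
       (auto elim!: AE_mono_space)
  then have w0: "(\<integral>x. \<bar>cycle_defect D w x\<bar> \<partial>\<pi>) = 0" by simp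
  have "eventually (\<lambda>i. dist1 (iter (r i) f) w < e / 2) sequentially"
    using e by (intro order_tendstoD(2)[OF lim]) simp
  then obtain i where i: "dist1 (iter (r i) f) w < e / 2"
    by (auto simp: eventually_sequentially)
  have 1: "(\<integral>x. \<bar>cycle_defect D (iter (r i) f) x\<bar> \<partial>\<pi>) \<le> e"
    using cycle_defect_L1_le[OF iter_bfun[OF fb] unit_ball_bfun[OF w] D, of "r i"] i w0 by linarith
  show ?thesis
  proof (intro exI allI impI)
    fix k assume k: "r i \<le> k"
    have "(\<integral>x. \<bar>cycle_defect D (iter k f) x\<bar> \<partial>\<pi>) = (\<integral>x. \<bar>cycle_defect D (iter (k - r i) (iter (r i) f)) x\<bar> \<partial>\<pi>)"
    proof (intro Bochner_Integration.integral_cong refl)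
      fix x assume "x \<in> space \<pi>"
      then have x: "x \<in> space S" by (simp add: space_pi)
      have "iter n (cycle_defect D f) x = iter (n - r i) (iter (r i) (cycle_defect D f)) x" if "n \<ge> r i" for n
        using iter_comp[OF cycle_defect_bfun[OF fb] x, of "n - r i" "r i"] that by simp
      moreover have "iter n (iter (r i) (cycle_defect D f)) x = iter n (cycle_defect D (iter (r i) f)) x" for n
        unfolding iter_def[of n] using cycle_defect_iter[OF fb]
        by (intro Bochner_Integration.integral_cong refl) (simp add: space_nstep[OF x])
      ultimately show "\<bar>cycle_defect D (iter k f) x\<bar> = \<bar>cycle_defect D (iter (k - r i) (iter (r i) f)) x\<bar>"
        unfolding cycle_defect_iter[OF fb x] cycle_defect_iter[OF iter_bfun[OF fb] x] using k by simp
    qed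
    also have "\<dots> \<le> (\<integral>x. \<bar>cycle_defect D (iter (r i) f) x\<bar> \<partial>\<pi>)"
      by (rule cycle_defect_L1_iter_le[OF iter_bfun[OF fb]])
    finally show "(\<integral>x. \<bar>cycle_defect D (iter k f) x\<bar> \<partial>\<pi>) \<le> e" using 1 by linarith
  qed
qed

lemma cycle_defect_cong:
  assumes "\<And>x. x \<in> space S \<Longrightarrow> f x = g x" and x: "x \<in> space S"
  shows "cycle_defect D f x = cycle_defect D g x"
proof -
  have "iter r f x = iter r g x" for r
    unfolding iter_def using assms by (intro Bochner_Integration.integral_cong refl) (simp add: space_nstep)
  moreover have "(\<integral>y. f y \<partial>\<pi>) = (\<integral>y. g y \<partial>\<pi>)"
    using assms by (intro Bochner_Integration.integral_cong refl) (simp add: space_pi)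
  ultimately show ?thesis by (simp add: cycle_defect_def)
qed

text \<open>Finitely many representatives, one for each net point in use, are controlled at all late
  times. Any other \<open>f\<close> is within \<open>e / 4\<close> of its representative after
  \<open>n\<close> steps, and by contraction ever after, which costs at most \<open>e / 2\<close> in
  the defect.\<close>

lemma cycle_defect_uniform:
  assumes period: "is_period S K \<pi> D" and e: "e > 0"
  shows "\<exists>m. \<forall>k\<ge>m. \<forall>f\<in>unit_ball. (\<integral>x. \<bar>cycle_defect D (iter k f) x\<bar> \<partial>\<pi>) \<le> e"
proof -
  have D: "D \<ge> 1" using period by (simp add: is_period_def)
  have e4: "e / 4 > 0" and e2: "e / 2 > 0" using e by simp_all
  obtain n and \<kappa> :: "('a \<Rightarrow> real) \<Rightarrow> ('a \<Rightarrow> real)" where \<kappa>: "finite (\<kappa> ` unit_ball)"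
    "\<And>f g. f \<in> unit_ball \<Longrightarrow> g \<in> unit_ball \<Longrightarrow> \<kappa> f = \<kappa> g \<Longrightarrow> dist1 (iter n f) (iter n g) \<le> e / 4"
    by (rule totally_bounded_iter[OF e4]) blast
  define R where "R h = (SOME g. g \<in> unit_ball \<and> \<kappa> g = h)" for h
  have R: "R h \<in> unit_ball" "\<kappa> (R h) = h" if "h \<in> \<kappa> ` unit_ball" for h
    using someI_ex[of "\<lambda>g. g \<in> unit_ball \<and> \<kappa> g = h"] that unfolding R_def by blast+
  have "\<exists>m. \<forall>h\<in>\<kappa> ` unit_ball. \<forall>k\<ge>m h. (\<integral>x. \<bar>cycle_defect D (iter k (R h)) x\<bar> \<partial>\<pi>) \<le> e / 2"
    by (rule bchoice) (intro ballI cycle_defect_tendsto_0[OF period R(1) e2])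
  then obtain m where m: "\<And>h k. h \<in> \<kappa> ` unit_ball \<Longrightarrow> k \<ge> m h \<Longrightarrow> (\<integral>x. \<bar>cycle_defect D (iter k (R h)) x\<bar> \<partial>\<pi>) \<le> e / 2"
    by blast
  show ?thesis
  proof (intro exI allI impI ballI)
    \<comment> \<open>The sum bounds each of the finitely many \<open>m h\<close>; the added
      \<open>n\<close> leaves room for the steps after which \<open>f\<close> is close to its
      representative.\<close>
    fix k f assume k: "k \<ge> n + (\<Sum>h\<in>\<kappa> ` unit_ball. m h)" and f: "f \<in> unit_ball"
    let ?g = "R (\<kappa> f)"
    have h: "\<kappa> f \<in> \<kappa> ` unit_ball" using f by blast
    note g = R[OF h]
    have "m (\<kappa> f) \<le> (\<Sum>h\<in>\<kappa> ` unit_ball. m h)" by (rule member_le_sum[OF h _ \<kappa>(1)]) simp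
    then have mk: "k \<ge> m (\<kappa> f)" and nk: "k = (k - n) + n" using k by linarith+
    have "dist1 (iter k f) (iter k ?g) = dist1 (iter (k - n) (iter n f)) (iter (k - n) (iter n ?g))"
    proof (rule dist1_cong)
      fix x assume x: "x \<in> space S"
      show "iter k f x = iter (k - n) (iter n f) x" "iter k ?g x = iter (k - n) (iter n ?g) x"
        using iter_comp[OF unit_ball_bfun[OF f] x, of "k - n" n] iter_comp[OF unit_ball_bfun[OF g(1)] x, of "k - n" n]
        by (simp_all only: nk[symmetric])
    qed
    also have "\<dots> \<le> dist1 (iter n f) (iter n ?g)"
      by (intro dist1_iter iter_bfun unit_ball_bfun f g(1))
    also have "\<dots> \<le> e / 4" by (rule \<kappa>(2)[OF f g(1)]) (rule g(2)[symmetric])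
    finally have "dist1 (iter k f) (iter k ?g) \<le> e / 4" .
    then show "(\<integral>x. \<bar>cycle_defect D (iter k f) x\<bar> \<partial>\<pi>) \<le> e"
      using cycle_defect_L1_le[OF iter_bfun iter_bfun D, OF unit_ball_bfun[OF f] unit_ball_bfun[OF g(1)], of k k] m[OF h mk]
      by linarith
  qed
qed

end

section \<open>Harris recurrence\<close>

context markov_kernel
begin

text \<open>As \<open>H\<close> is absorbing, a chain found outside \<open>H\<close> at time
  \<open>n\<close> has almost surely been outside at all times from 1 to \<open>n\<close>.\<close>

lemma emeasure_nstep_le_stay:
  assumes H: "H \<in> sets S" and abs: "\<And>x. x \<in> H \<Longrightarrow> emeasure (K x) (space S - H) = 0" and x: "x \<in> space S"
  shows "emeasure (nst n x) (space S - H) \<le> stay (space S - H) n x"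
proof -
  define B where "B = space S - H"
  have B[measurable]: "B \<in> sets S" using H by (simp add: B_def)
  have suc: "emeasure (nst (Suc n) x) B = (\<integral>\<^sup>+y. emeasure (nst n y) B \<partial>K x)" if x: "x \<in> space S" for n x
    unfolding nstep.simps
    by (rule emeasure_bind[where N=S])
       (use x B in \<open>auto simp: space_kernel measurable_cong_sets[OF sets_kernel[OF x] refl]\<close>)
  have 0: "emeasure (nst n y) B = 0" if "y \<in> H" for n y
    using that
  proof (induction n arbitrary: y)
    case 0
    then show ?case using B by (simp add: B_def)
  next
    case (Suc n)
    have y: "y \<in> space S" using sets.sets_into_space[OF H] Suc.prems by auto
    interpret prob_space "K y" by (rule prob_space_kernel[OF y])
    have "B \<in> null_sets (K y)" using abs[OF Suc.prems] B by (auto simp: null_sets_def sets_kernel[OF y] B_def)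
    from AE_not_in[OF this] AE_space have "AE z in K y. emeasure (nst n z) B = 0"
      by eventually_elim (auto simp: B_def[symmetric] space_kernel[OF y] intro!: Suc.IH, simp add: B_def)
    then have "(\<integral>\<^sup>+z. emeasure (nst n z) B \<partial>K y) = (\<integral>\<^sup>+z. 0 \<partial>K y)" by (rule nn_integral_cong_AE)
    then show ?case unfolding suc[OF y] by simp
  qed
  have "emeasure (nst n x) B \<le> stay B n x"
    using x
  proof (induction n arbitrary: x)
    case 0
    then show ?case using B by (simp add: stay_simps indicator_def)
  next
    case (Suc n)
    show ?case
      unfolding suc[OF Suc.prems] stay_simps
    proof (rule nn_integral_mono)
      fix y assume "y \<in> space (K x)"
      then have y: "y \<in> space S" by (simp add: space_kernel[OF Suc.prems])
      show "emeasure (nst n y) B \<le> indicator B y * stay B n y"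
        using 0[of y n] Suc.IH[OF y] y by (cases "y \<in> H") (simp_all add: B_def)
    qed
  qed
  then show ?thesis by (simp only: B_def)
qed

text \<open>At a zero of \<open>trapped B\<close> there is no chance left of remaining in
  \<open>B\<close> afterwards. Treating each deterministic time \<open>m\<close> separately and
  uniting the null events avoids a stopping-time argument.\<close>

lemma trapped_eq_0_of_AE:
  assumes x: "x \<in> space S" and B[measurable]: "B \<in> sets S"
    and ae: "AE \<omega> in law x. \<exists>m\<ge>1. trapped B (\<omega> m) = 0"
  shows "trapped B x = 0"
proof -
  note [measurable_cong] = sets_law[OF x]
  define H where "H = {y \<in> space S. trapped B y = 0}"
  have H[measurable]: "H \<in> sets S" by (simp add: H_def)
  have "AE \<omega> in law x. \<not> (\<omega> m \<in> H \<and> (\<forall>i>m. \<omega> i \<in> B))" for m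
  proof -
    have "emeasure (law x) {\<omega> \<in> space (law x). \<omega> m \<in> H \<and> (\<forall>i>m. \<omega> i \<in> B)} = (\<integral>\<^sup>+y. indicator H y * trapped B y \<partial>nst m x)"
      by (rule emeasure_law_trapped[OF x B H])
    also have "\<dots> = (\<integral>\<^sup>+y. 0 \<partial>nst m x)"
      by (intro nn_integral_cong) (simp add: H_def indicator_def)
    finally have "emeasure (law x) {\<omega> \<in> space (law x). \<not> \<not> (\<omega> m \<in> H \<and> (\<forall>i>m. \<omega> i \<in> B))} = 0" by simp
    then show ?thesis by (subst AE_iff_measurable[OF _ refl]) measurable
  qed
  then have "AE \<omega> in law x. \<forall>m. \<not> (\<omega> m \<in> H \<and> (\<forall>i>m. \<omega> i \<in> B))"
    unfolding AE_all_countable by blast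
  with ae AE_space have "AE \<omega> in law x. \<not> (\<forall>i\<ge>1. \<omega> i \<in> B)"
  proof eventually_elim
    case (elim \<omega>)
    obtain m where m: "m \<ge> 1" "trapped B (\<omega> m) = 0" using elim(1) by blast
    have "\<omega> m \<in> H" using m path_in_space[OF x elim(2)] by (simp add: H_def)
    then obtain i where "i > m" "\<omega> i \<notin> B" using elim(3) by blast
    then show ?case using m(1) by (auto intro!: exI[of _ i])
  qed
  then have "emeasure (law x) {\<omega> \<in> space (law x). \<not> \<not> (\<forall>i\<ge>1. \<omega> i \<in> B)} = 0"
    by (subst (asm) AE_iff_measurable[OF _ refl]) measurable
  then show ?thesis using emeasure_law_trapped_0[OF x B] by simp
qed

lemma AE_visit:
  assumes x: "x \<in> space S" and p: "\<P>(\<omega> in law x. return_time G \<omega> < \<infinity>) = 1"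
  shows "AE \<omega> in law x. \<exists>m\<ge>1. \<omega> m \<in> G"
proof -
  interpret prob_space "law x" by (rule prob_space_law[OF x])
  \<comment> \<open>\<open>G\<close> may fail to be measurable. The event is measurable
    nevertheless, since \<open>measure\<close> would otherwise be 0 instead of 1.\<close>
  have "{\<omega> \<in> space (law x). return_time G \<omega> < \<infinity>} \<in> sets (law x)"
    using p measure_notin_sets[of _ "law x"] by (metis zero_neq_one)
  then have "AE \<omega> in law x. return_time G \<omega> < \<infinity>" using p by (subst (asm) prob_Collect_eq_1)
  then show ?thesis by (simp only: return_time_finite_iff)
qed

text \<open>Infinitely many visits mean a visit after every time \<open>m\<close>; conditioning on
  the state at time \<open>m\<close> produces \<open>trapped\<close>.\<close>

lemma prob_infinitely_often_eq_1_iff: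
  assumes x: "x \<in> space S" and A[measurable]: "A \<in> sets S"
  shows "\<P>(\<omega> in law x. \<exists>\<^sub>\<infinity>n. \<omega> n \<in> A) = 1 \<longleftrightarrow> (\<forall>m. (\<integral>\<^sup>+y. trapped (space S - A) y \<partial>nst m x) = 0)"
proof -
  interpret prob_space "law x" by (rule prob_space_law[OF x])
  note [measurable_cong] = sets_law[OF x]
  have B: "space S - A \<in> sets S" by measurable
  have "(\<P>(\<omega> in law x. \<exists>\<^sub>\<infinity>n. \<omega> n \<in> A) = 1) \<longleftrightarrow> (AE \<omega> in law x. \<forall>m. \<exists>n>m. \<omega> n \<in> A)"
    unfolding INFM_nat by (rule prob_Collect_eq_1) measurable
  also have "\<dots> \<longleftrightarrow> (\<forall>m. AE \<omega> in law x. \<exists>n>m. \<omega> n \<in> A)" by (rule AE_all_countable)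
  also have "\<dots> \<longleftrightarrow> (\<forall>m. (\<integral>\<^sup>+y. trapped (space S - A) y \<partial>nst m x) = 0)"
  proof (rule arg_cong[where f=All], rule ext)
    fix m
    have "(AE \<omega> in law x. \<exists>n>m. \<omega> n \<in> A) \<longleftrightarrow> emeasure (law x) {\<omega> \<in> space (law x). \<not> (\<exists>n>m. \<omega> n \<in> A)} = 0"
      by (rule AE_iff_measurable[OF _ refl]) measurable
    also have "{\<omega> \<in> space (law x). \<not> (\<exists>n>m. \<omega> n \<in> A)} = {\<omega> \<in> space (law x). \<omega> m \<in> space S \<and> (\<forall>i>m. \<omega> i \<in> space S - A)}"
      using path_in_space[OF x] by auto
    also have "emeasure (law x) \<dots> = (\<integral>\<^sup>+y. indicator (space S) y * trapped (space S - A) y \<partial>nst m x)"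
      by (rule emeasure_law_trapped[OF x B sets.top])
    also have "\<dots> = (\<integral>\<^sup>+y. trapped (space S - A) y \<partial>nst m x)"
      by (intro nn_integral_cong) (simp add: space_nstep[OF x])
    finally show "(AE \<omega> in law x. \<exists>n>m. \<omega> n \<in> A) \<longleftrightarrow> (\<integral>\<^sup>+y. trapped (space S - A) y \<partial>nst m x) = 0" .
  qed
  finally show ?thesis .
qed

text \<open>The event constrains time 0, which \<open>trapped\<close> leaves free; hence the
  restriction to \<open>x \<in> A\<close>.\<close>

lemma prob_never_leave_eq_0_iff:
  assumes x: "x \<in> space S" and A: "A \<in> sets S"
  shows "\<P>(\<omega> in law x. \<forall>n. \<omega> n \<in> A) = 0 \<longleftrightarrow> (x \<in> A \<longrightarrow> trapped A x = 0)"
proof -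
  interpret prob_space "law x" by (rule prob_space_law[OF x])
  have "{\<omega> \<in> space (law x). \<forall>n. \<omega> n \<in> A} = {\<omega> \<in> space (law x). \<omega> 0 \<in> A \<and> (\<forall>i>0. \<omega> i \<in> A)}"
    by (auto, metis gr0I)
  then have "emeasure (law x) {\<omega> \<in> space (law x). \<forall>n. \<omega> n \<in> A} = (\<integral>\<^sup>+y. indicator A y * trapped A y \<partial>nst 0 x)"
    using emeasure_law_trapped[OF x A A, of 0] by simp
  also have "\<dots> = indicator A x * trapped A x"
    proof -
    note [measurable] = A
    show ?thesis unfolding nstep.simps by (rule nn_integral_return[OF x]) measurable
  qed
  finally have "ennreal (prob {\<omega> \<in> space (law x). \<forall>n. \<omega> n \<in> A}) = indicator A x * trapped A x"
    by (simp only: emeasure_eq_measure)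
  then show ?thesis
    using ennreal_eq_0_iff[of "prob {\<omega> \<in> space (law x). \<forall>n. \<omega> n \<in> A}"]
      measure_nonneg[of "law x" "{\<omega> \<in> space (law x). \<forall>n. \<omega> n \<in> A}"]
    by (cases "x \<in> A") auto
qed

end

section \<open>From L1 convergence to an arbitrary starting point\<close>

context stationary_irreducible_chain
begin

text \<open>Cut the density of \<open>\<mu>\<close> at a level \<open>c\<close>. Below it the
  integral against \<open>\<mu>\<close> is at most \<open>c\<close> times that against
  \<open>\<pi>\<close>; above it only a set of \<open>\<mu>\<close>-measure less than
  \<open>e\<close> remains. The level does not depend on \<open>g\<close>, which preserves
  uniformity over the unit ball. The bound 2 is the one from
  \<open>cycle_defect_abs_le\<close>.\<close>

lemma abs_continuous_bound:
  assumes fin: "finite_measure \<mu>" and sets: "sets \<mu> = sets S" and ac: "absolutely_continuous \<pi> \<mu>" and e: "e > 0"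
  obtains c :: nat where "\<And>g :: 'a \<Rightarrow> ennreal. g \<in> borel_measurable S \<Longrightarrow> (\<And>x. x \<in> space S \<Longrightarrow> g x \<le> 2) \<Longrightarrow>
     (\<integral>\<^sup>+x. g x \<partial>\<mu>) \<le> of_nat c * (\<integral>\<^sup>+x. g x \<partial>\<pi>) + 2 * ennreal e"
proof -
  interpret m: finite_measure \<mu> by fact
  note [measurable_cong] = sets
  have sp: "space \<mu> = space S" by (rule sets_eq_imp_space_eq[OF sets])
  have "\<exists>f\<in>borel_measurable \<pi>. density \<pi> f = \<mu>"
    by (rule pi.Radon_Nikodym[OF ac]) (simp add: sets sets_pi)
  then obtain f where f': "f \<in> borel_measurable \<pi>" and dens: "density \<pi> f = \<mu>" by blast
  from f' have f[measurable]: "f \<in> borel_measurable S" by (simp add: measurable_cong_sets[OF sets_pi refl])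
  let ?L = "\<lambda>n::nat. {x \<in> space S. of_nat n < f x}"
  have "(\<integral>\<^sup>+x. f x \<partial>\<pi>) = (\<integral>\<^sup>+x. f x * indicator (space \<pi>) x \<partial>\<pi>)"
    by (intro nn_integral_cong) simp
  also have "\<dots> = emeasure (density \<pi> f) (space \<pi>)" by (rule emeasure_density[symmetric]) (auto simp: f')
  also have "\<dots> < \<infinity>" unfolding dens using m.emeasure_finite[of "space \<pi>"] by (simp only: less_top infinity_ennreal_def)
  finally have "(\<integral>\<^sup>+x. f x \<partial>\<pi>) \<noteq> \<infinity>" by simp
  from nn_integral_PInf_AE[OF f' this] have "AE x in \<pi>. f x \<noteq> \<infinity>" .
  then have "emeasure \<pi> {x \<in> space S. f x = \<infinity>} = 0"
    by (subst (asm) AE_iff_measurable[OF _ refl]) (auto simp: space_pi sets_pi)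
  then have "{x \<in> space S. f x = \<infinity>} \<in> null_sets \<pi>" by (simp add: null_sets_def sets_pi)
  then have "{x \<in> space S. f x = \<infinity>} \<in> null_sets \<mu>" using ac unfolding absolutely_continuous_def by blast
  then have null: "measure \<mu> {x \<in> space S. f x = \<infinity>} = 0" by (simp add: null_sets_def measure_def)
  have "(\<lambda>n. measure \<mu> (?L n)) \<longlonglongrightarrow> measure \<mu> (\<Inter>n. ?L n)"
  proof (rule m.finite_Lim_measure_decseq)
    show "range ?L \<subseteq> sets \<mu>" by (auto simp: sets)
    have "(of_nat n :: ennreal) \<le> of_nat m" if "n \<le> m" for n m using that by simp
    then show "decseq ?L" unfolding decseq_def by (blast intro: le_less_trans)
  qed
  \<comment> \<open>The density is infinite only on a \<open>\<pi>\<close>-null set, which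
    \<open>\<mu>\<close> does not charge either, so the tails shrink to measure 0.\<close>
  moreover have "(\<Inter>n. ?L n) = {x \<in> space S. f x = \<infinity>}"
  proof (intro set_eqI iffI)
    fix x assume x: "x \<in> (\<Inter>n. ?L n)"
    then have "of_nat n < f x" for n by blast
    then have "f x = \<top>" using ennreal_Ex_less_of_nat[of "f x"] by (metis less_asym top.not_eq_extremum)
    then show "x \<in> {x \<in> space S. f x = \<infinity>}" using x by auto
  qed (auto simp: of_nat_less_top)
  ultimately have "(\<lambda>n. measure \<mu> (?L n)) \<longlonglongrightarrow> 0" using null by simp
  then have "eventually (\<lambda>n. measure \<mu> (?L n) < e) sequentially" using e by (rule order_tendstoD(2))
  then obtain c where c: "measure \<mu> (?L c) < e" by (auto simp: eventually_sequentially)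
  show thesis
  proof (rule that[of c])
    fix g :: "'a \<Rightarrow> ennreal" assume g[measurable]: "g \<in> borel_measurable S" and g2: "\<And>x. x \<in> space S \<Longrightarrow> g x \<le> 2"
    have "(\<integral>\<^sup>+x. g x \<partial>\<mu>) = (\<integral>\<^sup>+x. g x * indicator (space S - ?L c) x + g x * indicator (?L c) x \<partial>\<mu>)"
      by (intro nn_integral_cong) (auto simp: indicator_def sp)
    also have "\<dots> = (\<integral>\<^sup>+x. g x * indicator (space S - ?L c) x \<partial>\<mu>) + (\<integral>\<^sup>+x. g x * indicator (?L c) x \<partial>\<mu>)"
      by (rule nn_integral_add) measurable
    also have "(\<integral>\<^sup>+x. g x * indicator (space S - ?L c) x \<partial>\<mu>) = (\<integral>\<^sup>+x. f x * (g x * indicator (space S - ?L c) x) \<partial>\<pi>)"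
      unfolding dens[symmetric] by (rule nn_integral_density) measurable
    also have "\<dots> \<le> (\<integral>\<^sup>+x. of_nat c * g x \<partial>\<pi>)"
      by (intro nn_integral_mono) (auto simp: indicator_def intro!: mult_right_mono)
    also have "\<dots> = of_nat c * (\<integral>\<^sup>+x. g x \<partial>\<pi>)" by (rule nn_integral_cmult) measurable
    also have "(\<integral>\<^sup>+x. g x * indicator (?L c) x \<partial>\<mu>) \<le> (\<integral>\<^sup>+x. 2 * indicator (?L c) x \<partial>\<mu>)"
      using g2 by (intro nn_integral_mono mult_right_mono) (auto simp: sp)
    also have "\<dots> = 2 * emeasure \<mu> (?L c)" by (rule nn_integral_cmult_indicator) measurable
    also have "\<dots> \<le> 2 * ennreal e"
      using c by (intro mult_left_mono) (auto simp: m.emeasure_eq_measure intro!: ennreal_leI)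
    finally show "(\<integral>\<^sup>+x. g x \<partial>\<mu>) \<le> of_nat c * (\<integral>\<^sup>+x. g x \<partial>\<pi>) + 2 * ennreal e"
      by (simp add: add_mono)
  qed
qed

lemma indicator_unit_ball: "A \<in> sets S \<Longrightarrow> indicator A \<in> unit_ball"
  unfolding unit_ball_def by (auto simp: indicator_def)

lemma iter_indicator:
  assumes x: "x \<in> space S" and A: "A \<in> sets S"
  shows "iter n (indicator A) x = measure (nst n x) A"
  unfolding iter_def using sets.sets_into_space[OF A] by (simp add: space_nstep[OF x] Int_absorb2)

text \<open>The first \<open>k\<close> steps are split off: they will carry \<open>x\<close> to a
  nearly absolutely continuous distribution, while the remaining steps act on functions, where the
  L1 bounds apply.\<close>

lemma cycle_average_eq:
  assumes x: "x \<in> space S" and A: "A \<in> sets S" and k: "k \<le> n * D"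
  shows "cycle_average S K D n x A - measure \<pi> A = iter k (cycle_defect D (iter (n * D - k) (indicator A))) x"
proof -
  have b: "indicator A \<in> bfun" by (rule unit_ball_bfun[OF indicator_unit_ball[OF A]])
  have "iter k (cycle_defect D (iter (n * D - k) (indicator A))) x = cycle_defect D (iter k (iter (n * D - k) (indicator A))) x"
    by (rule cycle_defect_iter[OF iter_bfun[OF b] x, symmetric])
  also have "\<dots> = cycle_defect D (iter (n * D) (indicator A)) x"
  proof (rule cycle_defect_cong[OF _ x])
    fix y assume y: "y \<in> space S"
    show "iter k (iter (n * D - k) (indicator A)) y = iter (n * D) (indicator A) y"
      using iter_comp[OF b y, of k "n * D - k"] k by simp
  qed
  also have "\<dots> = cycle_average S K D n x A - measure \<pi> A"
  proof -
    have "iter r (iter (n * D) (indicator A)) x = measure (nst (n * D + r) x) A" for r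
      using iter_comp[OF b x, of r "n * D"] iter_indicator[OF x A, of "n * D + r"] by (simp add: add.commute)
    moreover have "(\<integral>y. indicator A y \<partial>\<pi>) = measure \<pi> A"
      using sets.sets_into_space[OF A] by (simp add: space_pi Int_absorb2)
    ultimately show ?thesis
      unfolding cycle_defect_def cycle_average_def integral_iter[OF b] by simp
  qed
  finally show ?thesis by (rule sym)
qed

text \<open>The hypothesis on \<open>x\<close> makes the chain enter the absorbing set
  \<open>H\<close> almost surely. As \<open>H\<close> avoids \<open>N\<close>, the mass of
  \<open>N\<close> after \<open>k\<close> steps is small for some \<open>k\<close>. The rest of the
  distribution at that time is absolutely continuous, so \<open>abs_continuous_bound\<close>
  transfers the uniform L1 estimate. Both \<open>k\<close> and \<open>c\<close> are fixed before
  \<open>n\<close> and \<open>A\<close>.\<close>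

lemma cycle_average_uniform_limit:
  assumes period: "is_period S K \<pi> D" and x: "x \<in> space S"
    and harris: "\<And>A. A \<in> sets S \<Longrightarrow> emeasure \<pi> A > 0 \<Longrightarrow> trapped (space S - A) x = 0"
    and e: "e > 0"
  shows "\<exists>m. \<forall>n\<ge>m. \<forall>A\<in>sets S. \<bar>cycle_average S K D n x A - measure \<pi> A\<bar> \<le> 5 * e"
proof -
  have D: "D \<ge> 1" using period by (simp add: is_period_def)
  \<comment> \<open>One null set carries the singular parts of the distributions at all times, so
    the time \<open>k\<close> can be chosen afterwards.\<close>
  obtain N where N: "N \<in> null_sets \<pi>" and Nmax: "\<And>k A. A \<in> null_sets \<pi> \<Longrightarrow> emeasure (nst k x) (A - N) = 0"
    by (rule maximal_null_set[of "\<lambda>k. nst k x" \<pi>])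
       (use prob_space.finite_measure[OF prob_space_nstep[OF x]] in \<open>auto simp: sets_nstep[OF x] sets_pi\<close>)
  have Nm[measurable]: "N \<in> sets S" using N by (auto simp: sets_pi)
  obtain H where H: "H \<in> sets S" "H \<inter> N = {}" "AE x in \<pi>. x \<in> H" "\<And>x. x \<in> H \<Longrightarrow> AE y in K x. y \<in> H"
    by (rule absorbing_avoiding_null_set[OF N]) blast
  have "emeasure \<pi> H = 1" using pi.emeasure_eq_1_AE[OF _ H(3)] H(1) by (simp add: sets_pi)
  then have trap: "trapped (space S - H) x = 0" by (intro harris H(1)) simp
  have abs: "emeasure (K y) (space S - H) = 0" if y: "y \<in> H" for y
  proof -
    have ys: "y \<in> space S" using y sets.sets_into_space[OF H(1)] by auto
    have "AE z in K y. z \<notin> space S - H" using H(4)[OF y] by (rule AE_mono_space) simp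
    then show ?thesis using H(1)
      by (subst (asm) AE_iff_measurable[of "space S - H"]) (auto simp: sets_kernel[OF ys] space_kernel[OF ys])
  qed
  have "(INF k. stay (space S - H) k x) < ennreal e"
    using trap e unfolding trapped_def by simp
  then obtain k where "stay (space S - H) k x < ennreal e" by (auto simp: INF_less_iff)
  then have "emeasure (nst k x) (space S - H) < ennreal e"
    by (rule le_less_trans[rotated]) (rule emeasure_nstep_le_stay[OF H(1) abs x])
  moreover have "emeasure (nst k x) N \<le> emeasure (nst k x) (space S - H)"
    using H(1,2) sets.sets_into_space[OF Nm] by (intro emeasure_mono) (auto simp: sets_nstep[OF x])
  ultimately have small: "emeasure (nst k x) N \<le> ennreal e" by simp
  interpret k: prob_space "nst k x" by (rule prob_space_nstep[OF x])
  note [measurable_cong] = sets_nstep[OF x]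
  define \<mu> where "\<mu> = density (nst k x) (indicator (space S - N))"
  have s\<mu>: "sets \<mu> = sets S" unfolding \<mu>_def by (simp add: sets_nstep[OF x] del: nstep.simps)
  have em: "emeasure \<mu> A = emeasure (nst k x) (A - N)" if A: "A \<in> sets S" for A
  proof -
    have "emeasure \<mu> A = (\<integral>\<^sup>+y. indicator (space S - N) y * indicator A y \<partial>nst k x)"
      unfolding \<mu>_def using A by (intro emeasure_density) (auto simp: sets_nstep[OF x])
    also have "\<dots> = (\<integral>\<^sup>+y. indicator (A - N) y \<partial>nst k x)"
      by (intro nn_integral_cong) (auto simp: indicator_def space_nstep[OF x])
    also have "\<dots> = emeasure (nst k x) (A - N)"
      using A by (intro nn_integral_indicator) (auto simp: sets_nstep[OF x])
    finally show ?thesis .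
  qed
  have ac: "absolutely_continuous \<pi> \<mu>"
    unfolding absolutely_continuous_def
  proof
    fix A assume A: "A \<in> null_sets \<pi>"
    then have "A \<in> sets S" by (auto simp: sets_pi)
    with em Nmax[OF A] show "A \<in> null_sets \<mu>" by (auto simp: null_sets_def s\<mu>)
  qed
  have fin: "finite_measure \<mu>"
  proof
    have "space \<mu> \<in> sets S" using sets.top[of \<mu>] by (simp add: s\<mu>)
    then show "emeasure \<mu> (space \<mu>) \<noteq> \<infinity>" by (simp add: em)
  qed
  obtain c :: nat where c: "\<And>g :: 'a \<Rightarrow> ennreal. g \<in> borel_measurable S \<Longrightarrow> (\<And>x. x \<in> space S \<Longrightarrow> g x \<le> 2) \<Longrightarrow>
     (\<integral>\<^sup>+x. g x \<partial>\<mu>) \<le> of_nat c * (\<integral>\<^sup>+x. g x \<partial>\<pi>) + 2 * ennreal e"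
    by (rule abs_continuous_bound[OF fin s\<mu> ac e]) blast
  \<comment> \<open>Multiplied by \<open>c\<close> this threshold is at most \<open>e\<close>; the
    added 1 covers \<open>c = 0\<close>.\<close>
  have "e / (real c + 1) > 0" using e by (intro divide_pos_pos) auto
  then obtain m where m: "\<And>j f. j \<ge> m \<Longrightarrow> f \<in> unit_ball \<Longrightarrow> (\<integral>x. \<bar>cycle_defect D (iter j f) x\<bar> \<partial>\<pi>) \<le> e / (real c + 1)"
    using cycle_defect_uniform[OF period] by blast
  show ?thesis
  proof (intro exI allI impI ballI)
    \<comment> \<open>As \<open>D \<ge> 1\<close>, at least \<open>m\<close> steps remain after the
      first \<open>k\<close> of \<open>n * D\<close> are split off.\<close>
    fix n A assume n: "n \<ge> m + k" and A: "A \<in> sets S"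
    have "n \<le> n * D" using D by simp
    then have k: "k \<le> n * D" "m \<le> n * D - k" using n by linarith+
    define g where "g = cycle_defect D (iter (n * D - k) (indicator A))"
    have gb: "g \<in> bfun" unfolding g_def
      by (intro cycle_defect_bfun iter_bfun unit_ball_bfun indicator_unit_ball A)
    have g2: "\<bar>g y\<bar> \<le> 2" if "y \<in> space S" for y
      unfolding g_def by (intro cycle_defect_abs_le iter_unit_ball indicator_unit_ball A that D)
    have gm[measurable]: "g \<in> borel_measurable S" by (rule bfun_measurable[OF gb])
    let ?h = "\<lambda>y. ennreal \<bar>g y\<bar>"
    have h2: "?h y \<le> 2" if "y \<in> space S" for y
    proof -
      have "?h y \<le> ennreal 2" by (rule ennreal_leI[OF g2[OF that]])
      then show ?thesis by simp
    qed
    have gp: "(\<integral>y. \<bar>g y\<bar> \<partial>\<pi>) \<le> e / (real c + 1)"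
      unfolding g_def by (rule m[OF k(2) indicator_unit_ball[OF A]])
    have "(\<integral>\<^sup>+y. ?h y \<partial>\<pi>) = ennreal (\<integral>y. \<bar>g y\<bar> \<partial>\<pi>)"
      by (rule nn_integral_eq_integral[OF integrable_pi[OF bfun_abs[OF gb]]]) simp
    also have "\<dots> \<le> ennreal (e / (real c + 1))" by (rule ennreal_leI[OF gp])
    finally have hp: "(\<integral>\<^sup>+y. ?h y \<partial>\<pi>) \<le> ennreal (e / (real c + 1))" .
    have "of_nat c * (\<integral>\<^sup>+y. ?h y \<partial>\<pi>) \<le> of_nat c * ennreal (e / (real c + 1))"
      by (rule mult_left_mono[OF hp]) simp
    also have "\<dots> = ennreal (real c * (e / (real c + 1)))"
      using e by (subst ennreal_mult) (auto simp: ennreal_of_nat_eq_real_of_nat)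
    also have "\<dots> \<le> ennreal e"
      using e by (intro ennreal_leI) (simp add: field_simps)
    finally have cp: "of_nat c * (\<integral>\<^sup>+y. ?h y \<partial>\<pi>) \<le> ennreal e" .
    have "(\<integral>\<^sup>+y. ?h y \<partial>nst k x) = (\<integral>\<^sup>+y. indicator (space S - N) y * ?h y + ?h y * indicator N y \<partial>nst k x)"
      by (intro nn_integral_cong) (auto simp: indicator_def space_nstep[OF x])
    also have "\<dots> = (\<integral>\<^sup>+y. indicator (space S - N) y * ?h y \<partial>nst k x) + (\<integral>\<^sup>+y. ?h y * indicator N y \<partial>nst k x)"
      by (rule nn_integral_add) measurable
    also have "(\<integral>\<^sup>+y. indicator (space S - N) y * ?h y \<partial>nst k x) = (\<integral>\<^sup>+y. ?h y \<partial>\<mu>)"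
      unfolding \<mu>_def by (rule nn_integral_density[symmetric]) measurable
    also have "\<dots> \<le> of_nat c * (\<integral>\<^sup>+y. ?h y \<partial>\<pi>) + 2 * ennreal e"
      by (rule c[OF _ h2]) measurable
    also have "(\<integral>\<^sup>+y. ?h y * indicator N y \<partial>nst k x) \<le> (\<integral>\<^sup>+y. 2 * indicator N y \<partial>nst k x)"
      using h2 by (intro nn_integral_mono mult_right_mono) (auto simp: space_nstep[OF x])
    also have "\<dots> = 2 * emeasure (nst k x) N" by (rule nn_integral_cmult_indicator) measurable
    also have "\<dots> \<le> 2 * ennreal e" by (rule mult_left_mono[OF small]) simp
    finally have "(\<integral>\<^sup>+y. ?h y \<partial>nst k x) \<le> (of_nat c * (\<integral>\<^sup>+y. ?h y \<partial>\<pi>) + 2 * ennreal e) + 2 * ennreal e"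
      by (simp add: add_mono)
    \<comment> \<open>One \<open>e\<close> comes from the bounded part of the density,
      \<open>2 * e\<close> from its tail and \<open>2 * e\<close> from \<open>N\<close>, the factor
      2 being the bound on \<open>g\<close>.\<close>
    also have "\<dots> \<le> (ennreal e + 2 * ennreal e) + 2 * ennreal e"
      by (intro add_mono cp order_refl)
    also have "\<dots> = ennreal (5 * e)"
    proof -
      have "2 * ennreal e = ennreal (2 * e)" using e by (simp add: ennreal_mult)
      then show ?thesis using e by (simp add: ennreal_plus[symmetric] del: ennreal_plus)
    qed
    finally have h: "(\<integral>\<^sup>+y. ?h y \<partial>nst k x) \<le> ennreal (5 * e)" .
    have "ennreal (\<integral>y. \<bar>g y\<bar> \<partial>nst k x) = (\<integral>\<^sup>+y. ?h y \<partial>nst k x)"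
      by (rule nn_integral_eq_integral[symmetric, OF integrable_nst[OF bfun_abs[OF gb] x]]) simp
    with h have "ennreal (\<integral>y. \<bar>g y\<bar> \<partial>nst k x) \<le> ennreal (5 * e)" by (simp only:)
    then have "(\<integral>y. \<bar>g y\<bar> \<partial>nst k x) \<le> 5 * e" using e by (subst (asm) ennreal_le_iff) auto
    moreover have "\<bar>iter k g x\<bar> \<le> (\<integral>y. \<bar>g y\<bar> \<partial>nst k x)" unfolding iter_def by (rule integral_abs_bound)
    ultimately show "\<bar>cycle_average S K D n x A - measure \<pi> A\<bar> \<le> 5 * e"
      unfolding cycle_average_eq[OF x A k(1)] g_def[symmetric] by linarith
  qed
qed

lemma cycle_average_bounds:
  assumes x: "x \<in> space S"
  shows "0 \<le> cycle_average S K D n x A" "cycle_average S K D n x A \<le> 1"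
proof -
  have "measure (nst i x) A \<le> 1" for i
    by (rule prob_space.prob_le_1[OF prob_space_nstep[OF x]])
  then have "(\<Sum>r=1..D. measure (nst (n * D + r) x) A) \<le> (\<Sum>r=1..D. 1)" by (intro sum_mono)
  then show "cycle_average S K D n x A \<le> 1"
    unfolding cycle_average_def by (cases "D = 0") (auto simp: field_simps)
  show "0 \<le> cycle_average S K D n x A"
    unfolding cycle_average_def by (intro mult_nonneg_nonneg sum_nonneg) auto
qed

lemma le_tv_dist:
  assumes x: "x \<in> space S" and A: "A \<in> sets S"
  shows "\<bar>cycle_average S K D n x A - measure \<pi> A\<bar> \<le> tv_dist S (cycle_average S K D n x) (measure \<pi>)"
  unfolding tv_dist_def
proof (rule cSUP_upper[OF A])
  show "bdd_above ((\<lambda>A. \<bar>cycle_average S K D n x A - measure \<pi> A\<bar>) ` sets S)"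
  proof (rule bdd_aboveI2)
    fix A
    show "\<bar>cycle_average S K D n x A - measure \<pi> A\<bar> \<le> 2"
      using cycle_average_bounds[OF x, of D n A] pi.prob_le_1[of A] measure_nonneg[of \<pi> A] by linarith
  qed
qed

lemma harris_imp_tv_convergence:
  assumes period: "is_period S K \<pi> D" and x: "x \<in> space S"
    and harris: "\<And>A. A \<in> sets S \<Longrightarrow> emeasure \<pi> A > 0 \<Longrightarrow> trapped (space S - A) x = 0"
  shows "(\<lambda>n. tv_dist S (cycle_average S K D n x) (measure \<pi>)) \<longlonglongrightarrow> 0"
proof (rule LIMSEQ_I)
  fix e :: real assume e: "e > 0"
  \<comment> \<open>The uniform bound is five times its parameter, so this leaves
    \<open>e / 2\<close> and a strict inequality.\<close>
  then have e': "e / 10 > 0" by simp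
  obtain m where m: "\<And>n A. n \<ge> m \<Longrightarrow> A \<in> sets S \<Longrightarrow> \<bar>cycle_average S K D n x A - measure \<pi> A\<bar> \<le> 5 * (e / 10)"
    using cycle_average_uniform_limit[OF period x harris e'] by blast
  show "\<exists>m. \<forall>n\<ge>m. norm (tv_dist S (cycle_average S K D n x) (measure \<pi>) - 0) < e"
  proof (intro exI allI impI)
    fix n assume n: "n \<ge> m"
    have "tv_dist S (cycle_average S K D n x) (measure \<pi>) \<le> 5 * (e / 10)"
      unfolding tv_dist_def by (rule cSUP_least) (use m[OF n] in auto)
    moreover have "0 \<le> tv_dist S (cycle_average S K D n x) (measure \<pi>)"
      using le_tv_dist[OF x sets.empty_sets, of D n] by (rule order_trans[rotated]) simp
    ultimately show "norm (tv_dist S (cycle_average S K D n x) (measure \<pi>) - 0) < e"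
      using e by simp
  qed
qed

text \<open>Let \<open>V\<close> be where \<open>trapped B\<close> is nonzero, a
  \<open>\<pi>\<close>-null set. Since \<open>trapped B\<close> is subharmonic and at most 1, its
  value at \<open>x\<close> is a lower bound for the probability of \<open>V\<close> at every time,
  hence for every cycle average of \<open>V\<close> and for its total variation distance to
  \<open>\<pi>\<close>.\<close>

lemma convergence_imp_trapped_eq_0:
  assumes D: "D \<ge> 1" and x: "x \<in> convergence_set S K \<pi> D"
    and A: "A \<in> sets S" and pos: "emeasure \<pi> A > 0"
  shows "trapped (space S - A) x = 0"
proof -
  have xs: "x \<in> space S" and lim: "(\<lambda>n. tv_dist S (cycle_average S K D n x) (measure \<pi>)) \<longlonglongrightarrow> 0"
    using x by (auto simp: convergence_set_def)
  define B where "B = space S - A"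
  have B[measurable]: "B \<in> sets S" using A by (simp add: B_def)
  define V where "V = {y \<in> space S. trapped B y \<noteq> 0}"
  have V[measurable]: "V \<in> sets S" unfolding V_def by measurable
  have "AE y in \<pi>. trapped B y = 0" using AE_trapped_eq_0[OF A pos] by (simp add: B_def)
  then have "emeasure \<pi> V = 0"
    unfolding V_def by (subst (asm) AE_iff_measurable[OF _ refl]) (auto simp: space_pi sets_pi)
  then have V0: "measure \<pi> V = 0" by (simp add: measure_def)
  define t where "t = enn2real (trapped B x)"
  have t: "trapped B x = ennreal t"
    using trapped_le_1[OF xs, of B] unfolding t_def by (subst ennreal_enn2real) (auto simp: top_unique less_top[symmetric])
  have le: "t \<le> measure (nst i x) V" for i
  proof -
    interpret prob_space "nst i x" by (rule prob_space_nstep[OF xs])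
    have "trapped B x \<le> (\<integral>\<^sup>+y. trapped B y \<partial>nst i x)" by (rule trapped_le_nstep[OF B xs])
    also have "\<dots> \<le> (\<integral>\<^sup>+y. indicator V y \<partial>nst i x)"
      using trapped_le_1 by (intro nn_integral_mono) (auto simp: V_def indicator_def space_nstep[OF xs])
    also have "\<dots> = emeasure (nst i x) V" by (rule nn_integral_indicator) (simp add: sets_nstep[OF xs])
    finally show ?thesis by (simp add: t emeasure_eq_measure)
  qed
  have "t \<le> tv_dist S (cycle_average S K D n x) (measure \<pi>)" for n
  proof -
    have "real D * t = (\<Sum>r=1..D. t)" by simp
    also have "\<dots> \<le> (\<Sum>r=1..D. measure (nst (n * D + r) x) V)" by (intro sum_mono le)
    finally have "t \<le> cycle_average S K D n x V"
      unfolding cycle_average_def using D by (simp add: field_simps)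
    then show ?thesis using le_tv_dist[OF xs V, of D n] V0 by simp
  qed
  then have "t \<le> 0" by (intro LIMSEQ_le_const[OF lim]) auto
  then show ?thesis using t by (simp add: B_def[symmetric] ennreal_neg)
qed

end

section \<open>The six conditions\<close>

theorem theorem6:
  fixes S :: "'a measure" and K :: "'a \<Rightarrow> 'a measure" and \<pi> :: "'a measure" and D :: nat
    and G :: "'a set"
  assumes kernel: "K \<in> S \<rightarrow>\<^sub>M prob_algebra S"
    and irreducible: "phi_irreducible S K"
    and stationary: "stationary S K \<pi>"
    and period: "is_period S K \<pi> D"
    and G: "G = convergence_set S K \<pi> D"
  defines "i \<equiv> harris_recurrent S K \<pi>"
    and "ii \<equiv> \<forall>A\<in>sets S. measure \<pi> A > 0 \<longrightarrow>
      (\<forall>x\<in>space S. \<P>(\<omega> in chain_law S K x. \<exists>\<^sub>\<infinity>n. \<omega> n \<in> A) = 1)"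
    and "iii \<equiv> \<forall>x\<in>space S. (\<lambda>n. tv_dist S (cycle_average S K D n x) (measure \<pi>)) \<longlonglongrightarrow> 0"
    and "iv \<equiv> \<forall>x\<in>space S. \<P>(\<omega> in chain_law S K x. return_time G \<omega> < \<infinity>) = 1"
    and "v \<equiv> \<forall>x\<in>space S. \<forall>A\<in>sets S. measure \<pi> A = 1 \<longrightarrow>
      \<P>(\<omega> in chain_law S K x. return_time A \<omega> < \<infinity>) = 1"
    and "vi \<equiv> \<forall>x\<in>space S. \<forall>A\<in>sets S. measure \<pi> A = 0 \<longrightarrow>
      \<P>(\<omega> in chain_law S K x. \<forall>n. \<omega> n \<in> A) = 0"
  shows "(i \<longleftrightarrow> ii) \<and> (i \<longleftrightarrow> iii) \<and> (i \<longleftrightarrow> iv) \<and> (i \<longleftrightarrow> v) \<and> (i \<longleftrightarrow> vi)"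
proof -
  interpret stationary_irreducible_chain S K \<pi>
    by unfold_locales (fact kernel irreducible stationary)+
  have D: "D \<ge> 1" using period unfolding is_period_def by (rule conjunct1)
  have pos_iff: "measure \<pi> A > 0 \<longleftrightarrow> emeasure \<pi> A > 0" for A by (simp add: pi.emeasure_eq_measure)
  have compl: "space S - (space S - A) = A" if "A \<in> sets S" for A
    using sets.sets_into_space[OF that] by blast
  have i_iff: "i \<longleftrightarrow> (\<forall>A\<in>sets S. measure \<pi> A > 0 \<longrightarrow> (\<forall>x\<in>space S. trapped (space S - A) x = 0))"
    unfolding i_def harris_recurrent_def using prob_return_eq_1_iff by blast
  have v_iff: "v \<longleftrightarrow> (\<forall>x\<in>space S. \<forall>A\<in>sets S. measure \<pi> A = 1 \<longrightarrow> trapped (space S - A) x = 0)"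
    unfolding v_def using prob_return_eq_1_iff by blast
  have vi_iff: "vi \<longleftrightarrow> (\<forall>x\<in>space S. \<forall>A\<in>sets S. measure \<pi> A = 0 \<longrightarrow> (x \<in> A \<longrightarrow> trapped A x = 0))"
    unfolding vi_def using prob_never_leave_eq_0_iff by blast
  have "ii" if i: "i"
    unfolding ii_def
  proof (intro ballI impI)
    fix A x assume A: "A \<in> sets S" "measure \<pi> A > 0" and x: "x \<in> space S"
    have "(\<integral>\<^sup>+y. trapped (space S - A) y \<partial>nst m x) = 0" for m
    proof -
      have "(\<integral>\<^sup>+y. trapped (space S - A) y \<partial>nst m x) = (\<integral>\<^sup>+y. 0 \<partial>nst m x)"
        using i A unfolding i_iff by (intro nn_integral_cong) (simp add: space_nstep[OF x])
      then show ?thesis by simp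
    qed
    then show "\<P>(\<omega> in law x. \<exists>\<^sub>\<infinity>n. \<omega> n \<in> A) = 1"
      using prob_infinitely_often_eq_1_iff[OF x A(1)] by blast
  qed
  moreover have "i" if ii: "ii"
    unfolding i_iff
  proof (intro ballI impI)
    fix A x assume A: "A \<in> sets S" "measure \<pi> A > 0" and x: "x \<in> space S"
    have "\<P>(\<omega> in law x. \<exists>\<^sub>\<infinity>n. \<omega> n \<in> A) = 1" using ii A x unfolding ii_def by blast
    \<comment> \<open>The instance \<open>m = 0\<close> evaluates \<open>trapped\<close> at the
      starting point itself.\<close>
    then have "(\<integral>\<^sup>+y. trapped (space S - A) y \<partial>nst 0 x) = 0"
      using prob_infinitely_often_eq_1_iff[OF x A(1)] by blast
    moreover have "(\<integral>\<^sup>+y. trapped (space S - A) y \<partial>nst 0 x) = trapped (space S - A) x"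
      unfolding nstep.simps by (rule nn_integral_return[OF x]) (use A in simp)
    ultimately show "trapped (space S - A) x = 0" by simp
  qed
  moreover have "iii" if i: "i"
    unfolding iii_def
  proof
    fix x assume x: "x \<in> space S"
    show "(\<lambda>n. tv_dist S (cycle_average S K D n x) (measure \<pi>)) \<longlonglongrightarrow> 0"
      by (rule harris_imp_tv_convergence[OF period x]) (use i x pos_iff in \<open>unfold i_iff, blast\<close>)
  qed
  moreover have "iv" if iii: "iii"
    unfolding iv_def
  proof
    fix x assume x: "x \<in> space S"
    interpret prob_space "law x" by (rule prob_space_law[OF x])
    \<comment> \<open>Convergence from every point makes the event certain, which also settles its
      measurability.\<close>
    have "G = space S" using iii unfolding G convergence_set_def iii_def by blast
    then have "{\<omega> \<in> space (law x). return_time G \<omega> < \<infinity>} = space (law x)"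
      unfolding return_time_finite_iff using path_in_space[OF x] by blast
    then show "\<P>(\<omega> in law x. return_time G \<omega> < \<infinity>) = 1" by (simp only: prob_space)
  qed
  moreover have "i" if iv: "iv"
    unfolding i_iff
  proof (intro ballI impI)
    fix A x assume A: "A \<in> sets S" "measure \<pi> A > 0" and x: "x \<in> space S"
    have "AE \<omega> in law x. \<exists>m\<ge>1. \<omega> m \<in> G"
      using iv x unfolding iv_def by (intro AE_visit[OF x]) blast
    then have "AE \<omega> in law x. \<exists>m\<ge>1. trapped (space S - A) (\<omega> m) = 0"
    proof (rule AE_mono_space)
      fix \<omega> assume "\<exists>m\<ge>1. \<omega> m \<in> G"
      then show "\<exists>m\<ge>1. trapped (space S - A) (\<omega> m) = 0"
        using convergence_imp_trapped_eq_0[OF D _ A(1)] A(2) unfolding pos_iff G by blast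
    qed
    then show "trapped (space S - A) x = 0" using A by (intro trapped_eq_0_of_AE[OF x]) auto
  qed
  moreover have "v" if i: "i"
    using i unfolding i_iff v_iff by simp
  moreover have "i" if v: "v"
    unfolding i_iff
  proof (intro ballI impI)
    fix A x assume A: "A \<in> sets S" "measure \<pi> A > 0" and x: "x \<in> space S"
    have [measurable]: "space S - A \<in> sets S" using A by auto
    \<comment> \<open>The zero set of \<open>trapped\<close> has full measure, so (v) sends the
      chain into it, and from there \<open>A\<close> is reached almost surely.\<close>
    define H where "H = {y \<in> space S. trapped (space S - A) y = 0}"
    have H: "H \<in> sets S" unfolding H_def by measurable
    have "AE y in \<pi>. trapped (space S - A) y = 0" using AE_trapped_eq_0[OF A(1)] A(2) unfolding pos_iff .
    then have "AE y in \<pi>. y \<in> H" by (rule AE_mono_space) (simp add: H_def space_pi)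
    then have "measure \<pi> H = 1" using pi.prob_eq_1[of H] H by (simp add: sets_pi)
    then have "\<P>(\<omega> in law x. return_time H \<omega> < \<infinity>) = 1"
      using v x H unfolding v_def by blast
    from AE_visit[OF x this] have "AE \<omega> in law x. \<exists>m\<ge>1. trapped (space S - A) (\<omega> m) = 0"
      by (rule AE_mono_space) (auto simp: H_def)
    then show "trapped (space S - A) x = 0" by (intro trapped_eq_0_of_AE[OF x]) auto
  qed
  moreover have "vi" if v: "v"
    unfolding vi_iff
  proof (intro ballI impI)
    fix x A assume x: "x \<in> space S" and A: "A \<in> sets S" "measure \<pi> A = 0"
    have "measure \<pi> (space S - A) = 1"
      using pi.prob_compl[of A] A by (simp add: sets_pi space_pi)
    moreover have "space S - A \<in> sets S" using A by auto
    ultimately have "trapped (space S - (space S - A)) x = 0" using v x unfolding v_iff by blast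
    then show "trapped A x = 0" by (simp only: compl[OF A(1)])
  qed
  moreover have "v" if vi: "vi"
    unfolding v_iff
  proof (intro ballI impI)
    fix x A assume x: "x \<in> space S" and A: "A \<in> sets S" "measure \<pi> A = 1"
    have B: "space S - A \<in> sets S" using A by auto
    have "measure \<pi> (space S - A) = 0"
      using pi.prob_compl[of A] A by (simp add: sets_pi space_pi)
    then have 0: "trapped (space S - A) y = 0" if "y \<in> space S - A" for y
      using vi B that unfolding vi_iff by blast
    \<comment> \<open>Condition (vi) gives information only about starts in the null set. One step
      of the fixed-point equation extends it to every start, because only points of the null set
      contribute to the integral.\<close>
    have "trapped (space S - A) x = (\<integral>\<^sup>+y. indicator (space S - A) y * trapped (space S - A) y \<partial>K x)"
      by (rule trapped_eq[OF B x])
    also have "\<dots> = (\<integral>\<^sup>+y. 0 \<partial>K x)" using 0 by (intro nn_integral_cong) (auto simp: indicator_def)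
    finally show "trapped (space S - A) x = 0" by simp
  qed
  ultimately show ?thesis by blast
qed

end
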